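(* The theory of valued $K$-vector spaces eliminates quantifiers relative to the skeleton in the language $\mathrm{L}_{S,K}$ (fixed base field $K$) and in the language $\mathrm{L}_S$ (variable base field).
   Context: Valued vector space: $K$ is a field, $V$ a $K$-vector space, $(\Gamma,<,\infty)$ a totally ordered set with last element $\infty$, and $\mathrm{val}:V\to\Gamma$ a surjective map such that $\mathrm{val}(x)=\infty$ iff $x=0$, $\mathrm{val}(x-y)\ge\min(\mathrm{val}(x),\mathrm{val}(y))$, and $\mathrm{val}(kx)=\mathrm{val}(x)$ for all $k\in K\setminus\{0\}$, $x\in V$. For $\gamma\in\Gamma$ write $V^\gamma=\{x\mid\mathrm{val}(x)\ge\gamma\}$ and $V_\gamma=\{x\mid\mathrm{val}(x)>\gamma\}$. Skeleton: $S(V)$ is the quotient of $\{(\gamma,v)\in\Gamma\times V\mid\mathrm{val}(v)\ge\gamma\}$ by the equivalence relation $(\gamma,v)\simeq(\gamma',v')$ iff $\gamma=\gamma'$ and $\mathrm{val}(v-v')>\gamma$. The class of $(\gamma,v)$ is written $(\gamma,v+V_\gamma)$, and $\mathbf{0}=(\infty,0)$ is the unique class over $\infty$. The following maps are defined: - $\pi:V\to S(V)$, $v\mapsto(\mathrm{val}(v),v+V_{\mathrm{val}(v)})$; - $\mathrm{val}_S:S(V)\to\Gamma$, $(\gamma,v+V_\gamma)\mapsto\gamma$; - $\mathrm{scal}_\bullet(k,(\gamma,v+V_\gamma)):=(\gamma,kv+V_\gamma)$, also written $\mathrm{scal}_{\bullet,k}$ for fixed $k$; - $(\gamma,v+V_\gamma)+_\bullet(\gamma',v'+V_{\gamma'}):=(\gamma,v+v'+V_\gamma)$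 if $\gamma=\gamma'$, and $\mathbf{0}$ otherwise. Languages. $\mathrm{L}_K=\{(V,+,0,(\mathrm{scal}_k:V\to V)_{k\in K}),(\Gamma,<,\infty),\mathrm{val}\}$ for fixed base field $K$, and $\mathrm{L}=\{(V,+,0),(K,+,\cdot,0,1),(\Gamma,<,\infty),\mathrm{scal}:K\times V\to V,\mathrm{val}\}$ for variable base field (so $K$ is a sort). Then $\mathrm{L}_{S,K}=\mathrm{L}_K\cup\{(S(V),+_\bullet,\mathbf{0},(\mathrm{scal}_{\bullet,k})_{k\in K}),\mathrm{val}_S:S(V)\to\Gamma,\pi:V\to S(V)\}$ and $\mathrm{L}_S=\mathrm{L}\cup\{(S(V),+_\bullet,\mathbf{0}),\mathrm{scal}_\bullet:K\times S(V)\to S(V),\mathrm{val}_S:S(V)\to\Gamma,\pi:V\to S(V)\}$. Relative quantifier elimination: a theory eliminates quantifiers relative to some sorts $\Sigma$ if it admits quantifier elimination in the language enriched with predicates for all definable sets in $\Sigma$ (a predicate for every formula of the language restricted to $\Sigma$). Here "relative to the skeleton" means relative to formulas of the sublanguage $\{(S(V),+_\bullet,\mathbf{0}),(\Gamma,<),(K,+,\cdot,0,1),\mathrm{scal}_\bullet,\mathrm{val}_S\}$ in the case of $\mathrm{L}_S$, respectively $\{(S(V),+_\bullet,(\mathrm{scal}_{\bullet,k})_k,\mathbf{0}),(\Gamma,<),\mathrm{val}_S\}$ in the case of $\mathrm{L}_{S,K}$.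
   Formalization: For variable base field, literal elimination in L_S fails (∃k x=ky is not expressible), so one block of existential quantifiers over K may remain in front; the relation defining S(V) is made reflexive over ∞; models live in fixed carrier types, which suffices by Löwenheim–Skolem. *)

theory Defs
  imports Complex_Main "HOL-Algebra.Module"
begin

section \<open>Many-sorted first-order logic\<close>

text \<open>Variables are pairs of a sort and an index. Arities of symbols belong to the language, which
  also says which sorts and symbols are available; a sublanguage is obtained by shrinking the
  sets \<open>sorts\<close>, \<open>funs\<close> and \<open>rels\<close>.\<close>

datatype ('s, 'f) tm = Var 's nat | App 'f "('s, 'f) tm list"

datatype ('s, 'f, 'r) fm =
    Eq "('s, 'f) tm" "('s, 'f) tm"
  | Rel 'r "('s, 'f) tm list"
  | Neg "('s, 'f, 'r) fm"
  | Conj "('s, 'f, 'r) fm" "('s, 'f, 'r) fm"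
  | Exi 's nat "('s, 'f, 'r) fm"

record ('s, 'f, 'r) lang =
  sorts :: "'s set"
  funs :: "'f set"
  rels :: "'r set"
  fdom :: "'f \<Rightarrow> 's list"
  fcod :: "'f \<Rightarrow> 's"
  rdom :: "'r \<Rightarrow> 's list"

record ('s, 'f, 'r, 'u) struct =
  univ :: "'s \<Rightarrow> 'u set"
  fint :: "'f \<Rightarrow> 'u list \<Rightarrow> 'u"
  rint :: "'r \<Rightarrow> 'u list \<Rightarrow> bool"

fun tm_sort :: "('s, 'f, 'r) lang \<Rightarrow> ('s, 'f) tm \<Rightarrow> 's" where
  "tm_sort L (Var s n) = s"
| "tm_sort L (App f ts) = fcod L f"

fun wf_tm :: "('s, 'f, 'r) lang \<Rightarrow> ('s, 'f) tm \<Rightarrow> bool" where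
  "wf_tm L (Var s n) \<longleftrightarrow> s \<in> sorts L"
| "wf_tm L (App f ts) \<longleftrightarrow> f \<in> funs L \<and> (\<forall>t\<in>set ts. wf_tm L t) \<and> map (tm_sort L) ts = fdom L f"

fun wf_fm :: "('s, 'f, 'r) lang \<Rightarrow> ('s, 'f, 'r) fm \<Rightarrow> bool" where
  "wf_fm L (Eq t u) \<longleftrightarrow> wf_tm L t \<and> wf_tm L u \<and> tm_sort L t = tm_sort L u"
| "wf_fm L (Rel r ts) \<longleftrightarrow> r \<in> rels L \<and> (\<forall>t\<in>set ts. wf_tm L t) \<and> map (tm_sort L) ts = rdom L r"
| "wf_fm L (Neg p) \<longleftrightarrow> wf_fm L p"
| "wf_fm L (Conj p q) \<longleftrightarrow> wf_fm L p \<and> wf_fm L q"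
| "wf_fm L (Exi s n p) \<longleftrightarrow> s \<in> sorts L \<and> wf_fm L p"

fun fv_tm :: "('s, 'f) tm \<Rightarrow> ('s \<times> nat) set" where
  "fv_tm (Var s n) = {(s, n)}"
| "fv_tm (App f ts) = (\<Union>t\<in>set ts. fv_tm t)"

fun fv :: "('s, 'f, 'r) fm \<Rightarrow> ('s \<times> nat) set" where
  "fv (Eq t u) = fv_tm t \<union> fv_tm u"
| "fv (Rel r ts) = (\<Union>t\<in>set ts. fv_tm t)"
| "fv (Neg p) = fv p"
| "fv (Conj p q) = fv p \<union> fv q"
| "fv (Exi s n p) = fv p - {(s, n)}"

fun qfree :: "('s, 'f, 'r) fm \<Rightarrow> bool" where
  "qfree (Eq t u) \<longleftrightarrow> True"
| "qfree (Rel r ts) \<longleftrightarrow> True"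
| "qfree (Neg p) \<longleftrightarrow> qfree p"
| "qfree (Conj p q) \<longleftrightarrow> qfree p \<and> qfree q"
| "qfree (Exi s n p) \<longleftrightarrow> False"

fun tm_val :: "('s, 'f, 'r, 'u) struct \<Rightarrow> ('s \<times> nat \<Rightarrow> 'u) \<Rightarrow> ('s, 'f) tm \<Rightarrow> 'u" where
  "tm_val M e (Var s n) = e (s, n)"
| "tm_val M e (App f ts) = fint M f (map (tm_val M e) ts)"

fun sat :: "('s, 'f, 'r, 'u) struct \<Rightarrow> ('s \<times> nat \<Rightarrow> 'u) \<Rightarrow> ('s, 'f, 'r) fm \<Rightarrow> bool" where
  "sat M e (Eq t u) \<longleftrightarrow> tm_val M e t = tm_val M e u"
| "sat M e (Rel r ts) \<longleftrightarrow> rint M r (map (tm_val M e) ts)"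
| "sat M e (Neg p) \<longleftrightarrow> \<not> sat M e p"
| "sat M e (Conj p q) \<longleftrightarrow> sat M e p \<and> sat M e q"
| "sat M e (Exi s n p) \<longleftrightarrow> (\<exists>a\<in>univ M s. sat M (e((s, n) := a)) p)"

text \<open>Equivalence modulo the theory of a class \<open>C\<close> of structures: the theory of \<open>C\<close> proves the
  universal closure of \<open>p \<leftrightarrow> q\<close> iff \<open>p\<close> and \<open>q\<close> agree in all members of \<open>C\<close>.\<close>

definition equivalent ::
    "('s, 'f, 'r) lang \<Rightarrow> ('s, 'f, 'r, 'u) struct set \<Rightarrow> ('s, 'f, 'r) fm \<Rightarrow> ('s, 'f, 'r) fm \<Rightarrow> bool" where
  "equivalent L C p q \<longleftrightarrow>
     (\<forall>M\<in>C. \<forall>e. (\<forall>s\<in>sorts L. \<forall>n. e (s, n) \<in> univ M s) \<longrightarrow> sat M e p = sat M e q)"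

definition eliminates_quantifiers ::
    "('s, 'f, 'r) lang \<Rightarrow> ('s, 'f, 'r, 'u) struct set \<Rightarrow> bool" where
  "eliminates_quantifiers L C \<longleftrightarrow>
     (\<forall>p. wf_fm L p \<longrightarrow>
       (\<exists>q. wf_fm L q \<and> qfree q \<and> fv q \<subseteq> fv p \<and> equivalent L C p q))"

text \<open>The variant in which one block of existential quantifiers over a sort \<open>s\<close> may remain.\<close>

definition eliminates_quantifiers_up_to ::
    "'s \<Rightarrow> ('s, 'f, 'r) lang \<Rightarrow> ('s, 'f, 'r, 'u) struct set \<Rightarrow> bool" where
  "eliminates_quantifiers_up_to s L C \<longleftrightarrow>
     (\<forall>p. wf_fm L p \<longrightarrow>
       (\<exists>ns q. wf_fm L q \<and> qfree q \<and> fv (foldr (Exi s) ns q) \<subseteq> fv p \<and>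
         equivalent L C p (foldr (Exi s) ns q)))"

subsection \<open>Predicates for the definable sets of a sublanguage\<close>

text \<open>\<open>Def p xs\<close> is a new predicate symbol for the set defined by the formula \<open>p\<close> whose free
  variables are among the list \<open>xs\<close>, which fixes the order of the arguments.\<close>

datatype ('s, 'f, 'r) esym = Base 'r | Def "('s, 'f, 'r) fm" "('s \<times> nat) list"

definition enrich ::
    "('s, 'f, 'r) lang \<Rightarrow> ('s, 'f, 'r) lang \<Rightarrow> ('s, 'f, ('s, 'f, 'r) esym) lang" where
  "enrich L L0 =
     \<lparr>sorts = sorts L, funs = funs L,
      rels = Base ` rels L \<union>
        {Def p xs |p xs. wf_fm L0 p \<and> distinct xs \<and> fv p \<subseteq> set xs \<and> fst ` set xs \<subseteq> sorts L0},
      fdom = fdom L, fcod = fcod L,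
      rdom = (\<lambda>r. case r of Base r \<Rightarrow> rdom L r | Def p xs \<Rightarrow> map fst xs)\<rparr>"

definition expand ::
    "('s, 'f, 'r, 'u) struct \<Rightarrow> ('s, 'f, ('s, 'f, 'r) esym, 'u) struct" where
  "expand M =
     \<lparr>univ = univ M, fint = fint M,
      rint = (\<lambda>r as. case r of
          Base r \<Rightarrow> rint M r as
        | Def p xs \<Rightarrow> sat M (\<lambda>x. the (map_of (zip xs as) x)) p)\<rparr>"

definition eliminates_quantifiers_relative_to ::
    "('s, 'f, 'r) lang \<Rightarrow> ('s, 'f, 'r) lang \<Rightarrow> ('s, 'f, 'r, 'u) struct set \<Rightarrow> bool" where
  "eliminates_quantifiers_relative_to L0 L C \<longleftrightarrow>
     eliminates_quantifiers (enrich L L0) (expand ` C)"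

definition eliminates_quantifiers_relative_to_up_to ::
    "('s, 'f, 'r) lang \<Rightarrow> 's \<Rightarrow> ('s, 'f, 'r) lang \<Rightarrow> ('s, 'f, 'r, 'u) struct set \<Rightarrow> bool" where
  "eliminates_quantifiers_relative_to_up_to L0 s L C \<longleftrightarrow>
     eliminates_quantifiers_up_to s (enrich L L0) (expand ` C)"

section \<open>Valued vector spaces and their skeletons\<close>

record ('k, 'v, 'g) vvs =
  scalars :: "'k ring"
  vectors :: "('k, 'v) module"
  val_chain :: "'g set"
  val_less :: "('g \<times> 'g) set"
  top_val :: 'g
  val :: "'v \<Rightarrow> 'g"

definition leq_val :: "('k, 'v, 'g) vvs \<Rightarrow> 'g \<Rightarrow> 'g \<Rightarrow> bool" where
  "leq_val X g h \<longleftrightarrow> g = h \<or> (g, h) \<in> val_less X"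

text \<open>In the ultrametric inequality, lying above a minimum of two elements of a chain means lying
  above one of them.\<close>

definition valued_vector_space :: "('k, 'v, 'g) vvs \<Rightarrow> bool" where
  "valued_vector_space X \<longleftrightarrow>
     field (scalars X) \<and> module (scalars X) (vectors X) \<and>
     strict_linear_order_on (val_chain X) (val_less X) \<and>
     top_val X \<in> val_chain X \<and> (\<forall>g\<in>val_chain X. leq_val X g (top_val X)) \<and>
     val X ` carrier (vectors X) = val_chain X \<and>
     (\<forall>x\<in>carrier (vectors X). val X x = top_val X \<longleftrightarrow> x = \<zero>\<^bsub>vectors X\<^esub>) \<and>
     (\<forall>x\<in>carrier (vectors X). \<forall>y\<in>carrier (vectors X).
        leq_val X (val X x) (val X (x \<ominus>\<^bsub>vectors X\<^esub> y)) \<or> leq_val X (val X y) (val X (x \<ominus>\<^bsub>vectors X\<^esub> y))) \<and>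
     (\<forall>k\<in>carrier (scalars X) - {\<zero>\<^bsub>scalars X\<^esub>}. \<forall>x\<in>carrier (vectors X).
        val X (k \<odot>\<^bsub>vectors X\<^esub> x) = val X x)"

definition preskel :: "('k, 'v, 'g) vvs \<Rightarrow> ('g \<times> 'v) set" where
  "preskel X = {(g, v). g \<in> val_chain X \<and> v \<in> carrier (vectors X) \<and> leq_val X g (val X v)}"

text \<open>The disjunct \<open>v = w\<close> only matters over \<open>\<infinity>\<close>, where \<open>val (v - w) > \<infinity>\<close> never holds: it makes
  \<open>(\<infinity>, 0)\<close> equivalent to itself, so that there is exactly one class over \<open>\<infinity>\<close>.\<close>

definition skel_rel :: "('k, 'v, 'g) vvs \<Rightarrow> (('g \<times> 'v) \<times> ('g \<times> 'v)) set" where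
  "skel_rel X = {((g, v), (h, w)). (g, v) \<in> preskel X \<and> (h, w) \<in> preskel X \<and> g = h \<and>
     (v = w \<or> (g, val X (v \<ominus>\<^bsub>vectors X\<^esub> w)) \<in> val_less X)}"

definition skel :: "('k, 'v, 'g) vvs \<Rightarrow> ('g \<times> 'v) set set" where
  "skel X = preskel X // skel_rel X"

definition cls :: "('k, 'v, 'g) vvs \<Rightarrow> 'g \<Rightarrow> 'v \<Rightarrow> ('g \<times> 'v) set" where
  "cls X g v = skel_rel X `` {(g, v)}"

definition pi_skel :: "('k, 'v, 'g) vvs \<Rightarrow> 'v \<Rightarrow> ('g \<times> 'v) set" where
  "pi_skel X v = cls X (val X v) v"

definition val_skel :: "('k, 'v, 'g) vvs \<Rightarrow> ('g \<times> 'v) set \<Rightarrow> 'g" where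
  "val_skel X a = the_elem (fst ` a)"

definition zero_skel :: "('k, 'v, 'g) vvs \<Rightarrow> ('g \<times> 'v) set" where
  "zero_skel X = cls X (top_val X) \<zero>\<^bsub>vectors X\<^esub>"

definition scal_skel :: "('k, 'v, 'g) vvs \<Rightarrow> 'k \<Rightarrow> ('g \<times> 'v) set \<Rightarrow> ('g \<times> 'v) set" where
  "scal_skel X k a = (\<Union>(g, v)\<in>a. cls X g (k \<odot>\<^bsub>vectors X\<^esub> v))"

definition add_skel ::
    "('k, 'v, 'g) vvs \<Rightarrow> ('g \<times> 'v) set \<Rightarrow> ('g \<times> 'v) set \<Rightarrow> ('g \<times> 'v) set" where
  "add_skel X a b =
     (if val_skel X a = val_skel X b
      then \<Union>(g, v)\<in>a. \<Union>(h, w)\<in>b. cls X g (v \<oplus>\<^bsub>vectors X\<^esub> w)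
      else zero_skel X)"

text \<open>The operations act on representatives as expected.\<close>

context
  fixes X :: "('k, 'v, 'g) vvs"
  assumes X: "valued_vector_space X"
begin

interpretation module "scalars X" "vectors X"
  using X by (simp add: valued_vector_space_def)

lemma trans_val_less: "trans (val_less X)"
  using X by (simp add: valued_vector_space_def strict_linear_order_on_def)

lemma irrefl_val_less: "(g, g) \<notin> val_less X"
  using X by (simp add: valued_vector_space_def strict_linear_order_on_def irrefl_def)

lemma leq_val_trans: "leq_val X g h \<Longrightarrow> leq_val X h i \<Longrightarrow> leq_val X g i"
  using trans_val_less unfolding leq_val_def trans_def by blast

lemma above_diff:
  assumes "x \<in> carrier (vectors X)" "y \<in> carrier (vectors X)"
    "(g, val X x) \<in> val_less X" "(g, val X y) \<in> val_less X"
  shows "(g, val X (x \<ominus>\<^bsub>vectors X\<^esub> y)) \<in> val_less X"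
proof -
  have "leq_val X (val X x) (val X (x \<ominus>\<^bsub>vectors X\<^esub> y)) \<or> leq_val X (val X y) (val X (x \<ominus>\<^bsub>vectors X\<^esub> y))"
    using X assms by (simp add: valued_vector_space_def)
  then show ?thesis using assms trans_val_less unfolding leq_val_def trans_def by metis
qed

lemma above_smult:
  assumes "x \<in> carrier (vectors X)" "k \<in> carrier (scalars X)" "(g, val X x) \<in> val_less X"
  shows "(g, val X (k \<odot>\<^bsub>vectors X\<^esub> x)) \<in> val_less X"
proof (cases "k = \<zero>\<^bsub>scalars X\<^esub>")
  case True
  have "x \<ominus>\<^bsub>vectors X\<^esub> x = \<zero>\<^bsub>vectors X\<^esub>" using assms by (simp add: M.r_neg a_minus_def)
  then show ?thesis using True above_diff[of x x g] assms by simp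
next
  case False
  then show ?thesis using X assms by (simp add: valued_vector_space_def)
qed

lemma cls_cancel:
  assumes "a \<in> carrier (vectors X)" "b \<in> carrier (vectors X)" "w \<in> carrier (vectors X)"
  shows "w \<oplus>\<^bsub>vectors X\<^esub> (a \<oplus>\<^bsub>vectors X\<^esub> \<ominus>\<^bsub>vectors X\<^esub> w) = a"
    "w \<oplus>\<^bsub>vectors X\<^esub> (a \<oplus>\<^bsub>vectors X\<^esub> (\<ominus>\<^bsub>vectors X\<^esub> w \<oplus>\<^bsub>vectors X\<^esub> b)) = a \<oplus>\<^bsub>vectors X\<^esub> b"
  using assms M.a_lcomm[of w a "\<ominus>\<^bsub>vectors X\<^esub> w"] M.a_lcomm[of w a "\<ominus>\<^bsub>vectors X\<^esub> w \<oplus>\<^bsub>vectors X\<^esub> b"]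
  by (simp_all add: M.r_neg M.r_neg2)

lemma preskelD:
  assumes "(g, v) \<in> preskel X" shows "g \<in> val_chain X" "v \<in> carrier (vectors X)"
  using assms by (auto simp: preskel_def)

lemma equiv_skel_rel: "equiv (preskel X) (skel_rel X)"
proof (rule equivI)
  show "skel_rel X \<subseteq> preskel X \<times> preskel X" by (auto simp: skel_rel_def)
  show "refl_on (preskel X) (skel_rel X)" by (auto simp: refl_on_def skel_rel_def)
  have *: "(g, val X (w \<ominus>\<^bsub>vectors X\<^esub> v)) \<in> val_less X"
    if "(g, val X (v \<ominus>\<^bsub>vectors X\<^esub> w)) \<in> val_less X" "v \<in> carrier (vectors X)" "w \<in> carrier (vectors X)" for g v w
  proof -
    let ?d = "v \<ominus>\<^bsub>vectors X\<^esub> w"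
    have "?d \<ominus>\<^bsub>vectors X\<^esub> ?d = \<zero>\<^bsub>vectors X\<^esub>"
      using that by (simp add: M.r_neg a_minus_def)
    then have "(?d \<ominus>\<^bsub>vectors X\<^esub> ?d) \<ominus>\<^bsub>vectors X\<^esub> ?d = w \<ominus>\<^bsub>vectors X\<^esub> v"
      using that by (simp add: a_minus_def M.minus_add M.a_comm)
    then show ?thesis using above_diff that by (metis M.minus_closed)
  qed
  show "sym (skel_rel X)"
    by (auto simp: sym_def skel_rel_def dest!: preskelD intro: *)
  have **: "(g, val X (u \<ominus>\<^bsub>vectors X\<^esub> w)) \<in> val_less X"
    if "(g, val X (u \<ominus>\<^bsub>vectors X\<^esub> v)) \<in> val_less X" "(g, val X (v \<ominus>\<^bsub>vectors X\<^esub> w)) \<in> val_less X"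
      "u \<in> carrier (vectors X)" "v \<in> carrier (vectors X)" "w \<in> carrier (vectors X)" for g u v w
  proof -
    have "(u \<ominus>\<^bsub>vectors X\<^esub> v) \<ominus>\<^bsub>vectors X\<^esub> (w \<ominus>\<^bsub>vectors X\<^esub> v) = u \<ominus>\<^bsub>vectors X\<^esub> w"
      using that by (simp add: a_minus_def M.minus_add M.a_ac M.r_neg2)
    then show ?thesis using above_diff that * by (metis M.minus_closed)
  qed
  show "trans (skel_rel X)"
  proof (rule transI, clarify)
    fix g u h v i w
    assume "((g, u), (h, v)) \<in> skel_rel X" "((h, v), (i, w)) \<in> skel_rel X"
    then show "((g, u), (i, w)) \<in> skel_rel X"
      using **[of g u v w] preskelD(2) unfolding skel_rel_def by blast
  qed
qed

lemma cls_in_skel: "(g, v) \<in> preskel X \<Longrightarrow> cls X g v \<in> skel X"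
  unfolding cls_def skel_def by (rule quotientI)

lemma cls_eq_iff:
  "(g, v) \<in> preskel X \<Longrightarrow> (h, w) \<in> preskel X \<Longrightarrow>
    cls X g v = cls X h w \<longleftrightarrow> g = h \<and> (v = w \<or> (g, val X (v \<ominus>\<^bsub>vectors X\<^esub> w)) \<in> val_less X)"
  unfolding cls_def using eq_equiv_class_iff[OF equiv_skel_rel, of "(g, v)" "(h, w)"]
  by (auto simp: skel_rel_def)

lemma skel_cases:
  assumes "a \<in> skel X" obtains g v where "(g, v) \<in> preskel X" "a = cls X g v"
  using assms unfolding skel_def cls_def by (auto elim!: quotientE)

lemma val_skel_cls: "(g, v) \<in> preskel X \<Longrightarrow> val_skel X (cls X g v) = g"
proof -
  assume "(g, v) \<in> preskel X"
  then have "fst ` cls X g v = {g}" by (force simp: cls_def skel_rel_def)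
  then show ?thesis by (simp add: val_skel_def)
qed

lemma preskel_smult:
  "(g, v) \<in> preskel X \<Longrightarrow> k \<in> carrier (scalars X) \<Longrightarrow> (g, k \<odot>\<^bsub>vectors X\<^esub> v) \<in> preskel X"
proof -
  assume a: "(g, v) \<in> preskel X" "k \<in> carrier (scalars X)"
  have "val X (\<zero>\<^bsub>vectors X\<^esub>) = top_val X" "\<forall>g\<in>val_chain X. leq_val X g (top_val X)"
     "k \<noteq> \<zero>\<^bsub>scalars X\<^esub> \<Longrightarrow> val X (k \<odot>\<^bsub>vectors X\<^esub> v) = val X v"
    using X a by (auto simp: valued_vector_space_def preskel_def)
  then show ?thesis using a by (cases "k = \<zero>\<^bsub>scalars X\<^esub>") (auto simp: preskel_def)
qed

lemma preskel_diff:
  assumes "(g, v) \<in> preskel X" "(g, w) \<in> preskel X"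
  shows "(g, v \<ominus>\<^bsub>vectors X\<^esub> w) \<in> preskel X"
proof -
  have "leq_val X (val X v) (val X (v \<ominus>\<^bsub>vectors X\<^esub> w)) \<or> leq_val X (val X w) (val X (v \<ominus>\<^bsub>vectors X\<^esub> w))"
    using X assms by (simp add: valued_vector_space_def preskel_def)
  then show ?thesis using assms leq_val_trans by (auto simp: preskel_def)
qed

lemma preskel_add:
  assumes "(g, v) \<in> preskel X" "(g, w) \<in> preskel X"
  shows "(g, v \<oplus>\<^bsub>vectors X\<^esub> w) \<in> preskel X"
proof -
  have c: "v \<in> carrier (vectors X)" "w \<in> carrier (vectors X)" using assms preskelD by auto
  have "(g, (w \<ominus>\<^bsub>vectors X\<^esub> w) \<ominus>\<^bsub>vectors X\<^esub> w) \<in> preskel X"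
    using assms by (intro preskel_diff)
  then have "(g, v \<ominus>\<^bsub>vectors X\<^esub> ((w \<ominus>\<^bsub>vectors X\<^esub> w) \<ominus>\<^bsub>vectors X\<^esub> w)) \<in> preskel X"
    using assms by (intro preskel_diff)
  then show ?thesis using c by (simp add: a_minus_def M.r_neg)
qed

lemma scal_skel_cls:
  assumes "(g, v) \<in> preskel X" "k \<in> carrier (scalars X)"
  shows "scal_skel X k (cls X g v) = cls X g (k \<odot>\<^bsub>vectors X\<^esub> v)"
proof -
  have "cls X h (k \<odot>\<^bsub>vectors X\<^esub> w) = cls X g (k \<odot>\<^bsub>vectors X\<^esub> v)" if "(h, w) \<in> cls X g v" for h w
  proof -
    have 1: "h = g" "(g, w) \<in> preskel X" "v = w \<or> (g, val X (v \<ominus>\<^bsub>vectors X\<^esub> w)) \<in> val_less X"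
      using that by (auto simp: cls_def skel_rel_def)
    have c: "v \<in> carrier (vectors X)" "w \<in> carrier (vectors X)" using assms 1 preskelD by auto
    have "k \<odot>\<^bsub>vectors X\<^esub> (v \<ominus>\<^bsub>vectors X\<^esub> w) = k \<odot>\<^bsub>vectors X\<^esub> v \<ominus>\<^bsub>vectors X\<^esub> k \<odot>\<^bsub>vectors X\<^esub> w"
      using c assms by (simp add: a_minus_def smult_r_distr smult_r_minus)
    then have "cls X g (k \<odot>\<^bsub>vectors X\<^esub> v) = cls X g (k \<odot>\<^bsub>vectors X\<^esub> w)"
      using 1 c assms above_smult[of "v \<ominus>\<^bsub>vectors X\<^esub> w" k g] cls_eq_iff preskel_smult by auto
    then show ?thesis using 1 by simp
  qed
  moreover have "(g, v) \<in> cls X g v" using assms by (auto simp: cls_def skel_rel_def)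
  ultimately show ?thesis unfolding scal_skel_def by blast
qed

lemma add_skel_cls:
  assumes "(g, v) \<in> preskel X" "(g, w) \<in> preskel X"
  shows "add_skel X (cls X g v) (cls X g w) = cls X g (v \<oplus>\<^bsub>vectors X\<^esub> w)"
proof -
  have "cls X h (v' \<oplus>\<^bsub>vectors X\<^esub> w') = cls X g (v \<oplus>\<^bsub>vectors X\<^esub> w)"
    if "(h, v') \<in> cls X g v" "(h', w') \<in> cls X g w" for h h' v' w'
  proof -
    have 1: "h = g" "(g, v') \<in> preskel X" "v = v' \<or> (g, val X (v \<ominus>\<^bsub>vectors X\<^esub> v')) \<in> val_less X"
      "(g, w') \<in> preskel X" "w = w' \<or> (g, val X (w \<ominus>\<^bsub>vectors X\<^esub> w')) \<in> val_less X"
      using that by (auto simp: cls_def skel_rel_def)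
    have c: "v \<in> carrier (vectors X)" "w \<in> carrier (vectors X)" "v' \<in> carrier (vectors X)" "w' \<in> carrier (vectors X)"
      using assms 1 preskelD by auto
    have "(v \<oplus>\<^bsub>vectors X\<^esub> w) \<ominus>\<^bsub>vectors X\<^esub> (v' \<oplus>\<^bsub>vectors X\<^esub> w) = v \<ominus>\<^bsub>vectors X\<^esub> v'"
      "(v' \<oplus>\<^bsub>vectors X\<^esub> w) \<ominus>\<^bsub>vectors X\<^esub> (v' \<oplus>\<^bsub>vectors X\<^esub> w') = w \<ominus>\<^bsub>vectors X\<^esub> w'"
      using c by (simp_all add: a_minus_def M.minus_add M.a_ac cls_cancel)
    then have "cls X g (v \<oplus>\<^bsub>vectors X\<^esub> w) = cls X g (v' \<oplus>\<^bsub>vectors X\<^esub> w)"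
      "cls X g (v' \<oplus>\<^bsub>vectors X\<^esub> w) = cls X g (v' \<oplus>\<^bsub>vectors X\<^esub> w')"
      using 1 assms cls_eq_iff preskel_add by auto
    then show ?thesis using 1 by simp
  qed
  moreover have "(g, v) \<in> cls X g v" "(g, w) \<in> cls X g w" using assms by (auto simp: cls_def skel_rel_def)
  ultimately have "(\<Union>(h, v')\<in>cls X g v. \<Union>(h', w')\<in>cls X g w. cls X h (v' \<oplus>\<^bsub>vectors X\<^esub> w')) =
      cls X g (v \<oplus>\<^bsub>vectors X\<^esub> w)" by fast
  then show ?thesis using assms by (simp add: add_skel_def val_skel_cls)
qed

lemma add_skel_cls_neq:
  "(g, v) \<in> preskel X \<Longrightarrow> (h, w) \<in> preskel X \<Longrightarrow> g \<noteq> h \<Longrightarrow>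
    add_skel X (cls X g v) (cls X h w) = zero_skel X"
  by (simp add: add_skel_def val_skel_cls)

lemma pi_in_preskel: "v \<in> carrier (vectors X) \<Longrightarrow> (val X v, v) \<in> preskel X"
  using X by (auto simp: preskel_def valued_vector_space_def leq_val_def)

end

section \<open>The languages\<close>

datatype srt = VV | GG | SS | KK

text \<open>\<open>ScalAt k\<close> and \<open>ScalSAt k\<close> are the unary scalar multiplications on vectors and on the skeleton
  by a fixed scalar; \<open>Scal\<close> and \<open>ScalS\<close> are the binary ones, with a scalar as first argument.\<close>

datatype 'k fsym =
    AddV | ZeroV | ScalAt 'k | Scal
  | AddK | MulK | ZeroK | OneK
  | Top | Val
  | AddS | ZeroS | ScalSAt 'k | ScalS | ValS | PiS

datatype rsym = Less

fun fsym_dom :: "'k fsym \<Rightarrow> srt list" where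
  "fsym_dom AddV = [VV, VV]" | "fsym_dom ZeroV = []"
| "fsym_dom (ScalAt k) = [VV]" | "fsym_dom Scal = [KK, VV]"
| "fsym_dom AddK = [KK, KK]" | "fsym_dom MulK = [KK, KK]"
| "fsym_dom ZeroK = []" | "fsym_dom OneK = []"
| "fsym_dom Top = []" | "fsym_dom Val = [VV]"
| "fsym_dom AddS = [SS, SS]" | "fsym_dom ZeroS = []"
| "fsym_dom (ScalSAt k) = [SS]" | "fsym_dom ScalS = [KK, SS]"
| "fsym_dom ValS = [SS]" | "fsym_dom PiS = [VV]"

fun fsym_cod :: "'k fsym \<Rightarrow> srt" where
  "fsym_cod AddV = VV" | "fsym_cod ZeroV = VV"
| "fsym_cod (ScalAt k) = VV" | "fsym_cod Scal = VV"
| "fsym_cod AddK = KK" | "fsym_cod MulK = KK"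
| "fsym_cod ZeroK = KK" | "fsym_cod OneK = KK"
| "fsym_cod Top = GG" | "fsym_cod Val = GG"
| "fsym_cod AddS = SS" | "fsym_cod ZeroS = SS"
| "fsym_cod (ScalSAt k) = SS" | "fsym_cod ScalS = SS"
| "fsym_cod ValS = GG" | "fsym_cod PiS = SS"

definition mk_lang :: "srt set \<Rightarrow> 'k fsym set \<Rightarrow> (srt, 'k fsym, rsym) lang" where
  "mk_lang Ss Fs =
     \<lparr>sorts = Ss, funs = Fs, rels = {Less}, fdom = fsym_dom, fcod = fsym_cod, rdom = (\<lambda>r. [GG, GG])\<rparr>"

definition L_SK :: "'k ring \<Rightarrow> (srt, 'k fsym, rsym) lang" where
  "L_SK K = mk_lang {VV, GG, SS}
     ({AddV, ZeroV} \<union> ScalAt ` carrier K \<union> {Top, Val} \<union>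
      {AddS, ZeroS} \<union> ScalSAt ` carrier K \<union> {ValS, PiS})"

definition skel_lang_K :: "'k ring \<Rightarrow> (srt, 'k fsym, rsym) lang" where
  "skel_lang_K K = mk_lang {SS, GG} ({AddS, ZeroS} \<union> ScalSAt ` carrier K \<union> {ValS})"

definition L_S :: "(srt, 'k fsym, rsym) lang" where
  "L_S = mk_lang {VV, KK, GG, SS}
     {AddV, ZeroV, AddK, MulK, ZeroK, OneK, Top, Scal, Val, AddS, ZeroS, ScalS, ValS, PiS}"

definition skel_lang :: "(srt, 'k fsym, rsym) lang" where
  "skel_lang = mk_lang {SS, GG, KK} {AddS, ZeroS, AddK, MulK, ZeroK, OneK, ScalS, ValS}"

section \<open>Valued vector spaces as first-order structures\<close>

datatype ('k, 'v, 'g) elem =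
    Vec (un_vec: 'v) | Gam (un_gam: 'g) | Ske (un_ske: "('g \<times> 'v) set") | Sca (un_sca: 'k)

fun vvs_dom :: "('k, 'v, 'g) vvs \<Rightarrow> srt \<Rightarrow> ('k, 'v, 'g) elem set" where
  "vvs_dom X VV = Vec ` carrier (vectors X)"
| "vvs_dom X GG = Gam ` val_chain X"
| "vvs_dom X SS = Ske ` skel X"
| "vvs_dom X KK = Sca ` carrier (scalars X)"

fun vvs_fint :: "('k, 'v, 'g) vvs \<Rightarrow> 'k fsym \<Rightarrow> ('k, 'v, 'g) elem list \<Rightarrow> ('k, 'v, 'g) elem" where
  "vvs_fint X AddV as = Vec (un_vec (as ! 0) \<oplus>\<^bsub>vectors X\<^esub> un_vec (as ! 1))"
| "vvs_fint X ZeroV as = Vec \<zero>\<^bsub>vectors X\<^esub>"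
| "vvs_fint X (ScalAt k) as = Vec (k \<odot>\<^bsub>vectors X\<^esub> un_vec (as ! 0))"
| "vvs_fint X Scal as = Vec (un_sca (as ! 0) \<odot>\<^bsub>vectors X\<^esub> un_vec (as ! 1))"
| "vvs_fint X AddK as = Sca (un_sca (as ! 0) \<oplus>\<^bsub>scalars X\<^esub> un_sca (as ! 1))"
| "vvs_fint X MulK as = Sca (un_sca (as ! 0) \<otimes>\<^bsub>scalars X\<^esub> un_sca (as ! 1))"
| "vvs_fint X ZeroK as = Sca \<zero>\<^bsub>scalars X\<^esub>"
| "vvs_fint X OneK as = Sca \<one>\<^bsub>scalars X\<^esub>"
| "vvs_fint X Top as = Gam (top_val X)"
| "vvs_fint X Val as = Gam (val X (un_vec (as ! 0)))"
| "vvs_fint X AddS as = Ske (add_skel X (un_ske (as ! 0)) (un_ske (as ! 1)))"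
| "vvs_fint X ZeroS as = Ske (zero_skel X)"
| "vvs_fint X (ScalSAt k) as = Ske (scal_skel X k (un_ske (as ! 0)))"
| "vvs_fint X ScalS as = Ske (scal_skel X (un_sca (as ! 0)) (un_ske (as ! 1)))"
| "vvs_fint X ValS as = Gam (val_skel X (un_ske (as ! 0)))"
| "vvs_fint X PiS as = Ske (pi_skel X (un_vec (as ! 0)))"

definition vvs_struct :: "('k, 'v, 'g) vvs \<Rightarrow> (srt, 'k fsym, rsym, ('k, 'v, 'g) elem) struct" where
  "vvs_struct X =
     \<lparr>univ = vvs_dom X, fint = vvs_fint X,
      rint = (\<lambda>r as. (un_gam (as ! 0), un_gam (as ! 1)) \<in> val_less X)\<rparr>"

text \<open>Base field, vector space and chain all live on subsets of the ambient types, so each class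
  below contains structures of all cardinalities up to those of the types.\<close>

definition valued_spaces_over ::
    "'k ring \<Rightarrow> (srt, 'k fsym, rsym, ('k, 'v, 'g) elem) struct set" where
  "valued_spaces_over K = {vvs_struct X |X. valued_vector_space X \<and> scalars X = K}"

definition valued_spaces :: "(srt, 'k fsym, rsym, ('k, 'v, 'g) elem) struct set" where
  "valued_spaces = {vvs_struct X |X. valued_vector_space X}"

section \<open>Quantifiers over the base field\<close>

text \<open>Over a variable base field one cannot ask for \<open>eliminates_quantifiers_relative_to skel_lang L_S\<close>.
  Take \<open>K = \<complex>\<close> and \<open>V = \<complex>\<^sup>2\<close>, where \<open>val (u, w)\<close> is \<open>0\<close> if \<open>u \<noteq> 0\<close>, \<open>1\<close> if \<open>u = 0 \<noteq> w\<close>, and \<open>\<infinity>\<close> if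
  \<open>u = w = 0\<close>. The vectors \<open>(\<i>, 0)\<close> and \<open>(\<i>, 1)\<close> satisfy the same quantifier-free formulas of the
  enriched language together with \<open>(1, 0)\<close>, because terms only form combinations with coefficients in
  the prime field (the argument allows all real coefficients, so having subtraction or inversion of
  scalars in the language would not help). But only \<open>(\<i>, 0)\<close> is a scalar multiple of \<open>(1, 0)\<close>.
  The scalars that name the coefficients in vector terms must be quantified outside the new
  predicates; \<open>eliminates_quantifiers_relative_to_up_to skel_lang KK L_S\<close> allows one block of
  existential quantifiers over the base field for them, and no quantifier over any other sort.\<close>

definition cex_K :: "complex ring" where
  "cex_K = \<lparr>carrier = UNIV, mult = (*), one = 1, zero = 0, add = (+)\<rparr>"

definition cex_V :: "(complex, complex \<times> complex) module" where
  "cex_V = \<lparr>carrier = UNIV, mult = (\<lambda>x y. x), one = (0, 0), zero = (0, 0),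
     add = (\<lambda>x y. (fst x + fst y, snd x + snd y)), smult = (\<lambda>k x. (k * fst x, k * snd x))\<rparr>"

definition cex_X :: "(complex, complex \<times> complex, nat) vvs" where
  "cex_X = \<lparr>scalars = cex_K, vectors = cex_V, val_chain = {0, 1, 2}, val_less = {(a, b). a < b}, top_val = 2,
     val = (\<lambda>x. if fst x \<noteq> 0 then 0 else if snd x \<noteq> 0 then 1 else 2)\<rparr>"

lemma field_cex_K: "field cex_K"
proof -
  have "cring cex_K"
  proof (rule cringI)
    show "abelian_group cex_K"
      by (rule abelian_groupI) (auto simp: cex_K_def intro: exI[of _ "- x" for x] left_minus)
    show "comm_monoid cex_K" by (rule comm_monoidI) (auto simp: cex_K_def)
  qed (auto simp: cex_K_def algebra_simps)
  moreover have "Units cex_K = carrier cex_K - {\<zero>\<^bsub>cex_K\<^esub>}"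
  proof -
    have "\<exists>y. y * x = 1 \<and> x * y = 1" if "x \<noteq> 0" for x :: complex
      using that by (intro exI[of _ "inverse x"]) auto
    then show ?thesis by (auto simp: Units_def cex_K_def)
  qed
  ultimately show ?thesis by (rule cring.cring_fieldI)
qed

lemma module_cex_V: "module cex_K cex_V"
proof (rule moduleI)
  show "cring cex_K" using field_cex_K by (simp add: field_def domain_def)
  show "abelian_group cex_V"
  proof (rule abelian_groupI)
    fix x assume "x \<in> carrier cex_V"
    show "\<exists>y\<in>carrier cex_V. y \<oplus>\<^bsub>cex_V\<^esub> x = \<zero>\<^bsub>cex_V\<^esub>"
      by (intro bexI[of _ "(- fst x, - snd x)"]) (auto simp: cex_V_def)
  qed (auto simp: cex_V_def)
qed (auto simp: cex_V_def cex_K_def algebra_simps)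

lemma minus_cex_V: "x \<ominus>\<^bsub>cex_V\<^esub> y = (fst x - fst y, snd x - snd y)"
proof -
  interpret module cex_K cex_V by (rule module_cex_V)
  have "\<ominus>\<^bsub>cex_V\<^esub> y = (- fst y, - snd y)"
    by (rule M.minus_equality) (auto simp: cex_V_def)
  then show ?thesis unfolding a_minus_def by (simp add: cex_V_def)
qed

definition cex_val :: "complex \<times> complex \<Rightarrow> nat" where
  "cex_val x = (if fst x \<noteq> 0 then 0 else if snd x \<noteq> 0 then 1 else 2)"

lemma cex_X_simps [simp]:
  "scalars cex_X = cex_K" "vectors cex_X = cex_V" "val_chain cex_X = {0, 1, 2}" "val_less cex_X = {(a, b). a < b}"
  "top_val cex_X = 2" "val cex_X = cex_val"
  by (simp_all add: cex_X_def cex_val_def fun_eq_iff)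

lemma cex_V_simps [simp]:
  "carrier cex_V = UNIV" "\<zero>\<^bsub>cex_V\<^esub> = (0, 0)" "x \<oplus>\<^bsub>cex_V\<^esub> y = (fst x + fst y, snd x + snd y)"
  "k \<odot>\<^bsub>cex_V\<^esub> x = (k * fst x, k * snd x)"
  "carrier cex_K = UNIV" "\<zero>\<^bsub>cex_K\<^esub> = 0" "\<one>\<^bsub>cex_K\<^esub> = 1" "h \<oplus>\<^bsub>cex_K\<^esub> k = h + k" "h \<otimes>\<^bsub>cex_K\<^esub> k = h * k"
  by (simp_all add: cex_V_def cex_K_def)

lemma leq_val_cex_X [simp]: "leq_val cex_X g h \<longleftrightarrow> g \<le> h"
  by (auto simp: leq_val_def)

lemma valued_cex_X: "valued_vector_space cex_X"
proof -
  have 1: "range cex_val = {0, 1, 2}"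
  proof -
    have "0 = cex_val (1, 0)" "1 = cex_val (0, 1)" "2 = cex_val (0, 0)" by (simp_all add: cex_val_def)
    then have "{0, 1, 2} \<subseteq> range cex_val" by (metis empty_subsetI insert_subset rangeI)
    then show ?thesis by (auto simp: cex_val_def)
  qed
  have 2: "cex_val x \<le> cex_val (x \<ominus>\<^bsub>cex_V\<^esub> y) \<or> cex_val y \<le> cex_val (x \<ominus>\<^bsub>cex_V\<^esub> y)" for x y
    by (simp add: minus_cex_V cex_val_def)
  have 3: "cex_val x = 2 \<longleftrightarrow> x = (0, 0)" for x
    by (simp add: cex_val_def prod_eq_iff)
  have 4: "cex_val (k * fst x, k * snd x) = cex_val x" if "k \<noteq> 0" for k x
    using that by (simp add: cex_val_def)
  have 5: "strict_linear_order_on {0, 1, 2::nat} {(a, b). a < b}"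
    by (auto simp: strict_linear_order_on_def trans_def irrefl_def total_on_def)
  have 6: "g \<le> 2" if "g \<in> {0, 1, 2::nat}" for g using that by auto
  show ?thesis unfolding valued_vector_space_def cex_X_simps cex_V_simps leq_val_cex_X
    by (intro conjI ballI field_cex_K module_cex_V 1 5 6 2 3 4) (simp_all add: 4)
qed

lemma pi_cex_X:
  assumes "u \<noteq> 0"
  shows "pi_skel cex_X (u, w) = {(0, (u, z)) |z. True}"
proof -
  have v: "cex_val (u, w) = 0" using assms by (simp add: cex_val_def)
  have "((0, (u, w)), (g, x)) \<in> skel_rel cex_X \<longleftrightarrow> g = 0 \<and> fst x = u" for g x
  proof -
    have "0 < cex_val ((u, w) \<ominus>\<^bsub>cex_V\<^esub> x) \<longleftrightarrow> u = fst x" by (simp add: minus_cex_V cex_val_def)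
    then show ?thesis by (auto simp: skel_rel_def preskel_def)
  qed
  then show ?thesis unfolding pi_skel_def cls_def cex_X_simps v by (auto simp: Image_def)
qed

definition cex_rel :: "srt \<Rightarrow> (complex, complex \<times> complex, nat) elem \<Rightarrow> (complex, complex \<times> complex, nat) elem \<Rightarrow> bool" where
  "cex_rel s x y \<longleftrightarrow>
    (case s of VV \<Rightarrow> (\<exists>a b::real. x = Vec (a * \<i> + b, 0) \<and> y = Vec (a * \<i> + b, complex_of_real a))
     | KK \<Rightarrow> x = y \<and> (\<exists>a::real. x = Sca a) | _ \<Rightarrow> x = y)"

definition cex_e1 :: "srt \<times> nat \<Rightarrow> (complex, complex \<times> complex, nat) elem" where
  "cex_e1 = (\<lambda>(s, n). case s of VV \<Rightarrow> if n = 0 then Vec (\<i>, 0) else Vec (1, 0)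
     | GG \<Rightarrow> Gam 0 | SS \<Rightarrow> Ske (zero_skel cex_X) | KK \<Rightarrow> Sca 0)"

definition cex_e2 :: "srt \<times> nat \<Rightarrow> (complex, complex \<times> complex, nat) elem" where
  "cex_e2 = cex_e1((VV, 0) := Vec (\<i>, 1))"

abbreviation (input) "cex_M \<equiv> expand (vvs_struct cex_X)"
abbreviation (input) "cex_L \<equiv> enrich L_S skel_lang"

lemma cex_nz: "(complex_of_real a * \<i> + complex_of_real b = 0) \<longleftrightarrow> a = 0 \<and> b = 0"
  by (auto simp add: complex_eq_iff)

lemma cex_eq:
  "(complex_of_real a * \<i> + complex_of_real b =
    complex_of_real c * \<i> + complex_of_real d) \<longleftrightarrow>
     a = c \<and> b = d"
  by (auto simp add: complex_eq_iff)

lemma cex_rel_VV: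
  "x = Vec (complex_of_real a * \<i> + complex_of_real b, 0) \<Longrightarrow>
   y = Vec (complex_of_real a * \<i> + complex_of_real b, complex_of_real a) \<Longrightarrow> cex_rel VV x y"
  unfolding cex_rel_def by auto

lemma cex_rel_tm:
  assumes "wf_tm cex_L t"
  shows "cex_rel (tm_sort cex_L t) (tm_val cex_M cex_e1 t) (tm_val cex_M cex_e2 t)"
  using assms
proof (induction t)
  case (Var s n)
  have "\<exists>a b::real. Vec (\<i>, 0) = Vec (a * \<i> + b, 0) \<and> Vec (\<i>, 1) = Vec (a * \<i> + b, complex_of_real a)"
    by (rule exI[of _ 1], rule exI[of _ 0]) simp
  moreover have "\<exists>a b::real. Vec (1, 0) = Vec (a * \<i> + b, 0) \<and> Vec (1, 0) = Vec (a * \<i> + b, complex_of_real a)"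
    by (rule exI[of _ 0], rule exI[of _ 1]) simp
  moreover have "\<exists>a::real. 0 = complex_of_real a" by (rule exI[of _ 0]) simp
  ultimately show ?case
    by (cases s) (auto simp: cex_rel_def cex_e2_def cex_e1_def)
next
  case (App f ts)
  let ?v1 = "map (tm_val cex_M cex_e1) ts" and ?v2 = "map (tm_val cex_M cex_e2) ts"
  have f: "f \<in> funs L_S" and srt: "map (tm_sort cex_L) ts = fsym_dom f" and cod: "fcod cex_L = fsym_cod"
    using App.prems by (auto simp: enrich_def L_S_def mk_lang_def)
  have len: "length ts = length (fsym_dom f)" using srt by (metis length_map)
  have arg: "cex_rel (fsym_dom f ! i) (?v1 ! i) (?v2 ! i)" if "i < length (fsym_dom f)" for i
  proof -
    have "ts ! i \<in> set ts" using that len by simp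
    then have "cex_rel (tm_sort cex_L (ts ! i)) (tm_val cex_M cex_e1 (ts ! i)) (tm_val cex_M cex_e2 (ts ! i))"
      using App.IH App.prems by simp
    then show ?thesis using that len srt by (metis nth_map)
  qed
  have "cex_rel (fsym_cod f) (vvs_fint cex_X f ?v1) (vvs_fint cex_X f ?v2)"
  proof -
    obtain x0 x1 y0 y1 where d: "x0 = ?v1 ! 0" "x1 = ?v1 ! 1" "y0 = ?v2 ! 0" "y1 = ?v2 ! 1" by blast
    have a0: "fsym_dom f = s # ss \<Longrightarrow> cex_rel s x0 y0" for s ss using arg[of 0] d by simp
    have a1: "fsym_dom f = [s, r] \<Longrightarrow> cex_rel r x1 y1" for s r using arg[of 1] d by simp
    show ?thesis
    proof (cases f)
      case AddV
      then obtain a b c d' where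
        "x0 = Vec (complex_of_real a * \<i> + complex_of_real b, 0)" "y0 = Vec (a * \<i> + b, complex_of_real a)"
        "x1 = Vec (complex_of_real c * \<i> + complex_of_real d', 0)" "y1 = Vec (c * \<i> + d', complex_of_real c)"
        using a0[of VV] a1[of VV VV] by (auto simp: cex_rel_def)
      then show ?thesis using AddV d
        by (auto simp: algebra_simps intro!: cex_rel_VV[of _ "a + c" "b + d'"])
    next
      case Scal
      then obtain a c d' where
        "x0 = Sca (complex_of_real a)" "y0 = x0"
        "x1 = Vec (complex_of_real c * \<i> + complex_of_real d', 0)" "y1 = Vec (c * \<i> + d', complex_of_real c)"
        using a0[of KK] a1[of KK VV] by (auto simp: cex_rel_def)
      then show ?thesis using Scal d
        by (auto simp: algebra_simps intro!: cex_rel_VV[of _ "a * c" "a * d'"])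
    next
      case ZeroV
      show ?thesis unfolding ZeroV
        by (auto intro!: cex_rel_VV[of _ 0 0])
    next
      case AddK
      then obtain a b where "x0 = Sca (complex_of_real a)" "y0 = x0" "x1 = Sca (complex_of_real b)" "y1 = x1"
        using a0[of KK] a1[of KK KK] by (auto simp: cex_rel_def)
      then show ?thesis using AddK d
        by (auto simp: cex_rel_def intro!: exI[of _ "a + b"])
    next
      case MulK
      then obtain a b where "x0 = Sca (complex_of_real a)" "y0 = x0" "x1 = Sca (complex_of_real b)" "y1 = x1"
        using a0[of KK] a1[of KK KK] by (auto simp: cex_rel_def)
      then show ?thesis using MulK d
        by (auto simp: cex_rel_def intro!: exI[of _ "a * b"])
    next
      case ZeroK
      then show ?thesis by (auto simp: cex_rel_def intro!: exI[of _ 0])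
    next
      case OneK
      then show ?thesis by (auto simp: cex_rel_def intro!: exI[of _ 1])
    next
      case Val
      then obtain a b where
        "x0 = Vec (complex_of_real a * \<i> + complex_of_real b, 0)" "y0 = Vec (a * \<i> + b, complex_of_real a)"
        using a0[of VV] by (auto simp: cex_rel_def)
      then show ?thesis using Val d by (auto simp: cex_rel_def cex_val_def cex_nz)
    next
      case PiS
      then obtain a b where *:
        "x0 = Vec (complex_of_real a * \<i> + complex_of_real b, 0)" "y0 = Vec (a * \<i> + b, complex_of_real a)"
        using a0[of VV] by (auto simp: cex_rel_def)
      show ?thesis
      proof (cases "a = 0 \<and> b = 0")
        case True
        then show ?thesis using PiS d * by (simp add: cex_rel_def)
      next
        case False
        then have "complex_of_real a * \<i> + complex_of_real b \<noteq> 0" by (simp add: cex_nz)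
        then show ?thesis unfolding PiS vvs_fint.simps d[symmetric] * by (simp add: cex_rel_def pi_cex_X)
      qed
    next
      case AddS
      then have "x0 = y0" "x1 = y1" using a0[of SS] a1[of SS SS] by (auto simp: cex_rel_def)
      then show ?thesis using AddS d by (simp add: cex_rel_def)
    next
      case ScalS
      then have "x0 = y0" "x1 = y1" using a0[of KK] a1[of KK SS] by (auto simp: cex_rel_def)
      then show ?thesis using ScalS d by (simp add: cex_rel_def)
    next
      case ValS
      then have "x0 = y0" using a0[of SS] by (auto simp: cex_rel_def)
      then show ?thesis using ValS d by (simp add: cex_rel_def)
    qed (use f in \<open>auto simp: cex_rel_def L_S_def mk_lang_def\<close>)
  qed
  then show ?case by (simp add: cod expand_def vvs_struct_def)
qed

lemma cex_rel_fm: "wf_fm cex_L p \<Longrightarrow> qfree p \<Longrightarrow> sat cex_M cex_e1 p = sat cex_M cex_e2 p"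
proof (induction p)
  case (Eq t u)
  then show ?case using cex_rel_tm[of t] cex_rel_tm[of u]
    by (cases "tm_sort cex_L t") (auto simp: cex_rel_def cex_eq)
next
  case (Rel r ts)
  have "\<forall>s\<in>set (rdom cex_L r). s \<noteq> VV"
  proof (cases r)
    case (Base r')
    then show ?thesis by (simp add: enrich_def L_S_def mk_lang_def)
  next
    case (Def q xs)
    then have "fst ` set xs \<subseteq> {SS, GG, KK}" "rdom cex_L r = map fst xs"
      using Rel by (auto simp: enrich_def skel_lang_def mk_lang_def)
    then show ?thesis by auto
  qed
  then have "\<forall>t\<in>set ts. tm_sort cex_L t \<noteq> VV"
    using Rel by (metis (no_types) in_set_conv_nth length_map nth_map wf_fm.simps(2))
  moreover have "x = y" if "cex_rel s x y" "s \<noteq> VV" for s x y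
    using that by (cases s) (auto simp: cex_rel_def)
  ultimately have "map (tm_val cex_M cex_e1) ts = map (tm_val cex_M cex_e2) ts"
    using Rel cex_rel_tm by (metis (no_types) map_cong wf_fm.simps(2))
  then show ?case by (simp only: sat.simps)
qed auto

lemma not_eliminates_quantifiers_relative_to_L_S:
  "\<not> eliminates_quantifiers_relative_to skel_lang L_S
     (valued_spaces :: (srt, complex fsym, rsym, (complex, complex \<times> complex, nat) elem) struct set)"
proof
  assume "eliminates_quantifiers_relative_to skel_lang L_S
     (valued_spaces :: (srt, complex fsym, rsym, (complex, complex \<times> complex, nat) elem) struct set)"
  note qe = this[unfolded eliminates_quantifiers_relative_to_def eliminates_quantifiers_def, rule_format]
  define p :: "(srt, complex fsym, (srt, complex fsym, rsym) esym) fm"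
    where "p = Exi KK 0 (Eq (Var VV 0) (App Scal [Var KK 0, Var VV 1]))"
  have "wf_fm cex_L p" by (simp add: p_def enrich_def L_S_def mk_lang_def)
  from qe[OF this] obtain q where q: "wf_fm cex_L q" "qfree q" and
    eq: "equivalent cex_L (expand ` (valued_spaces :: (srt, complex fsym, rsym, (complex, complex \<times> complex, nat) elem) struct set)) p q" by blast
  have M: "cex_M \<in> expand ` (valued_spaces :: (srt, complex fsym, rsym, (complex, complex \<times> complex, nat) elem) struct set)" unfolding valued_spaces_def using valued_cex_X by blast
  have z: "zero_skel cex_X \<in> skel cex_X"
    unfolding zero_skel_def cls_def skel_def
    by (rule quotientI) (auto simp: preskel_def cex_val_def)
  have d1: "\<forall>s\<in>sorts cex_L. \<forall>n. cex_e1 (s, n) \<in> univ cex_M s"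
    using z by (auto simp: cex_e1_def expand_def vvs_struct_def split: srt.split)
  have d2: "\<forall>s\<in>sorts cex_L. \<forall>n. cex_e2 (s, n) \<in> univ cex_M s"
    using d1 by (auto simp: cex_e2_def expand_def vvs_struct_def)
  have "sat cex_M cex_e1 p = sat cex_M cex_e1 q" "sat cex_M cex_e2 p = sat cex_M cex_e2 q"
    using eq M d1 d2 unfolding equivalent_def by blast+
  moreover have "sat cex_M cex_e1 p"
    by (auto simp: p_def expand_def vvs_struct_def cex_e1_def)
  moreover have "\<not> sat cex_M cex_e2 p"
    by (auto simp: p_def expand_def vvs_struct_def cex_e1_def cex_e2_def)
  ultimately show False using cex_rel_fm[OF q] by simp
qed

declare cex_X_simps [simp del] cex_V_simps [simp del] leq_val_cex_X [simp del]

end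

theory Submission
  imports Defs "HOL-Library.Nat_Bijection"
begin

text \<open>Predicates for definable sets can be expanded, so formulas of the plain language suffice. Define
  \<open>a \<oplus> b\<close> on the skeleton as \<open>a\<close> if \<open>val a < val b\<close>, as \<open>b\<close> if \<open>val b < val a\<close>, and as \<open>a + b\<close>
  otherwise. Then \<open>\<pi>(x + y) = \<pi>(x) \<oplus> \<pi>(y)\<close> whenever the right-hand side lies in the image of \<open>\<pi>\<close>, and
  this image is defined by \<open>a + a \<noteq> a \<or> a = 0\<close>.

  For a fixed field, a formula only depends on the skeleton, the chain and finitely many \<open>\<pi>(t)\<close>. To
  eliminate \<open>\<exists>v\<close> one may take the terms containing \<open>v\<close> to be \<open>v - d\<^sub>i\<close>. A tuple \<open>(a\<^sub>i)\<close> in the image of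
  \<open>\<pi>\<close> is \<open>(\<pi>(v - d\<^sub>i))\<close> for some \<open>v\<close> iff there is an \<open>i\<close> with \<open>a\<^sub>j = a\<^sub>i \<oplus> \<pi>(d\<^sub>i - d\<^sub>j)\<close> for all \<open>j\<close>:
  take \<open>i\<close> with \<open>val(v - d\<^sub>i)\<close> maximal, and conversely \<open>v = d\<^sub>i + w\<close> with \<open>\<pi>(w) = a\<^sub>i\<close>. This is a condition
  on the skeleton.

  For a variable field, call \<open>w\<^sub>1, \<dots>, w\<^sub>n\<close> separated if \<open>\<pi>(\<Sum> k\<^sub>i w\<^sub>i)\<close> is the \<open>\<oplus>\<close>-sum of the \<open>k\<^sub>i \<pi>(w\<^sub>i)\<close>
  for all scalars. This is definable from the \<open>\<pi>(w\<^sub>i)\<close>, every finite family spans the same space as a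
  separated one, and a separated family can be extended to span one more vector. So, by induction, a
  formula in vectors \<open>v = B w\<close> with \<open>w\<close> separated is equivalent to a formula about \<open>B\<close> and \<open>\<pi>(w)\<close>.
  Finally \<open>w = A v\<close> and \<open>v = B w\<close> are expressed with existentially quantified matrices \<open>A\<close> and \<open>B\<close>.\<close>

section \<open>Many-sorted formulas\<close>

text \<open>The obstacle is cancellation: if val x = val y < val (x + y), then \<pi>(x) and \<pi>(y)
  do not determine \<pi>(x + y). Their sum in the skeleton is then the zero of the fibre over val x,
  and this is the only class of a fibre below \<infinity> outside the image of \<pi>. So
  cancellation is visible inside the skeleton, and membership in the image certifies its absence;
  both halves rest on this test.

  Over a fixed field the scalars are symbols, so whether a vector term really involves v is decided
  before any structure is given. With scalars as a sort, a scalar quantifier moves a term through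
  infinitely many vectors, and no finite list of classes \<pi>(t) survives it. Coordinates with
  respect to a separated family repair this: scalar quantifiers change coordinates but not the
  family. Separated families may contain zero vectors. This avoids distinguishing dependent from
  independent vectors, at the price that the coordinate at a zero vector is not unique.\<close>

lemma tm_val_cong:
  "(\<And>x. x \<in> fv_tm t \<Longrightarrow> e x = e' x) \<Longrightarrow> tm_val M e t = tm_val M e' t"
proof (induction t)
  case (App f ts)
  then have "map (tm_val M e) ts = map (tm_val M e') ts" by auto
  then show ?case by (simp only: tm_val.simps)
qed simp

lemma sat_cong: "(\<And>x. x \<in> fv p \<Longrightarrow> e x = e' x) \<Longrightarrow> sat M e p = sat M e' p"
proof (induction p arbitrary: e e')
  case (Eq t u)
  then have "tm_val M e t = tm_val M e' t" "tm_val M e u = tm_val M e' u"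
    by (auto intro!: tm_val_cong)
  then show ?case by simp
next
  case (Rel r ts)
  then have "map (tm_val M e) ts = map (tm_val M e') ts" by (auto intro!: tm_val_cong)
  then show ?case by (simp only: sat.simps)
next
  case (Neg p)
  then show ?case by (metis fv.simps(3) sat.simps(3))
next
  case (Conj p q)
  then show ?case by (metis UnI1 UnI2 fv.simps(4) sat.simps(4))
next
  case (Exi s n p)
  have "sat M (e((s, n) := a)) p = sat M (e'((s, n) := a)) p" for a
    using Exi.prems by (intro Exi.IH) auto
  then show ?case by simp
qed

lemma finite_fv_tm: "finite (fv_tm t)"
  by (induction t) auto

lemma finite_fv: "finite (fv p)"
  by (induction p) (auto simp: finite_fv_tm)

lemma wf_tm_fv_sorts: "wf_tm L t \<Longrightarrow> fst ` fv_tm t \<subseteq> sorts L"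
  by (induction t) auto

lemma wf_fm_fv_sorts: "wf_fm L p \<Longrightarrow> fst ` fv p \<subseteq> sorts L"
proof (induction p)
  case (Eq t u)
  then show ?case using wf_tm_fv_sorts[of L t] wf_tm_fv_sorts[of L u] by auto
next
  case (Rel r ts)
  then show ?case using wf_tm_fv_sorts[of L] by fastforce
qed auto

subsection \<open>Substitution\<close>

fun tm_subst :: "('s \<times> nat \<Rightarrow> ('s, 'f) tm) \<Rightarrow> ('s, 'f) tm \<Rightarrow> ('s, 'f) tm" where
  "tm_subst \<sigma> (Var s n) = \<sigma> (s, n)"
| "tm_subst \<sigma> (App f ts) = App f (map (tm_subst \<sigma>) ts)"

lemma tm_val_subst: "tm_val M e (tm_subst \<sigma> t) = tm_val M (\<lambda>x. tm_val M e (\<sigma> x)) t"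
proof (induction t)
  case (App f ts)
  then have "map (tm_val M e \<circ> tm_subst \<sigma>) ts = map (tm_val M (\<lambda>x. tm_val M e (\<sigma> x))) ts" by auto
  then show ?case by (simp only: tm_val.simps tm_subst.simps map_map)
qed simp

lemma fv_tm_subst: "fv_tm (tm_subst \<sigma> t) = (\<Union>x\<in>fv_tm t. fv_tm (\<sigma> x))"
  by (induction t) auto

lemma wf_tm_subst:
  "wf_tm L t \<Longrightarrow> (\<And>x. x \<in> fv_tm t \<Longrightarrow> wf_tm L (\<sigma> x) \<and> tm_sort L (\<sigma> x) = fst x) \<Longrightarrow>
    wf_tm L (tm_subst \<sigma> t) \<and> tm_sort L (tm_subst \<sigma> t) = tm_sort L t"
proof (induction t)
  case (App f ts)
  define ts' where "ts' = map (tm_subst \<sigma>) ts"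
  have *: "\<forall>t\<in>set ts. wf_tm L (tm_subst \<sigma> t) \<and> tm_sort L (tm_subst \<sigma> t) = tm_sort L t"
    using App by auto
  then have "\<forall>t\<in>set ts'. wf_tm L t" "map (tm_sort L) ts' = map (tm_sort L) ts"
    by (simp_all add: ts'_def)
  moreover have "map (tm_sort L) ts = fdom L f" "f \<in> funs L" using App.prems(1) by simp_all
  moreover have "tm_subst \<sigma> (App f ts) = App f ts'" by (simp add: ts'_def)
  ultimately show ?case by simp
qed simp

text \<open>Renaming of bound variables makes the result depend on \<sigma>, so a formula is only
  claimed to exist. A quantifier over \<open>(s, n)\<close> is renamed to an index \<open>m\<close>
  that occurs in none of the substituted terms, which rules out capture.\<close>

lemma substitution:
  fixes p :: "('s, 'f, 'r) fm"
  assumes "wf_fm L p" "\<And>x. x \<in> fv p \<Longrightarrow> wf_tm L (\<sigma> x) \<and> tm_sort L (\<sigma> x) = fst x"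
  shows "\<exists>q. wf_fm L q \<and> fv q \<subseteq> (\<Union>x\<in>fv p. fv_tm (\<sigma> x)) \<and>
    (\<forall>(M :: ('s, 'f, 'r, 'u) struct) e. sat M e q = sat M (\<lambda>x. tm_val M e (\<sigma> x)) p)"
  using assms
proof (induction p arbitrary: \<sigma>)
  case (Eq t u)
  then have "wf_fm L (Eq (tm_subst \<sigma> t) (tm_subst \<sigma> u))"
    using wf_tm_subst[of L t \<sigma>] wf_tm_subst[of L u \<sigma>] by auto
  then show ?case
    by (intro exI[of _ "Eq (tm_subst \<sigma> t) (tm_subst \<sigma> u)"]) (auto simp: tm_val_subst fv_tm_subst)
next
  case (Rel r ts)
  have *: "\<forall>t\<in>set ts. wf_tm L (tm_subst \<sigma> t) \<and> tm_sort L (tm_subst \<sigma> t) = tm_sort L t"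
  proof
    fix t assume "t \<in> set ts"
    then show "wf_tm L (tm_subst \<sigma> t) \<and> tm_sort L (tm_subst \<sigma> t) = tm_sort L t"
      using Rel by (intro wf_tm_subst) auto
  qed
  define ts' where "ts' = map (tm_subst \<sigma>) ts"
  have "\<forall>t\<in>set ts'. wf_tm L t" "map (tm_sort L) ts' = map (tm_sort L) ts"
    using * by (simp_all add: ts'_def)
  moreover have "map (tm_sort L) ts = rdom L r" "r \<in> rels L" using Rel.prems(1) by simp_all
  ultimately have "wf_fm L (Rel r (map (tm_subst \<sigma>) ts))" unfolding ts'_def[symmetric] by simp
  then show ?case
    by (intro exI[of _ "Rel r (map (tm_subst \<sigma>) ts)"]) (auto simp: tm_val_subst fv_tm_subst comp_def)
next
  case (Neg p)
  then obtain q where "wf_fm L q \<and> fv q \<subseteq> (\<Union>x\<in>fv p. fv_tm (\<sigma> x)) \<and>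
    (\<forall>(M :: ('s, 'f, 'r, 'u) struct) e. sat M e q = sat M (\<lambda>x. tm_val M e (\<sigma> x)) p)" by fastforce
  then show ?case by (intro exI[of _ "Neg q"]) auto
next
  case (Conj p p')
  have wf: "wf_fm L p" "wf_fm L p'" using Conj.prems(1) by simp_all
  have *: "wf_tm L (\<sigma> x) \<and> tm_sort L (\<sigma> x) = fst x" if "x \<in> fv p \<or> x \<in> fv p'" for x
    using Conj.prems(2)[of x] that by simp
  from Conj.IH(1)[OF wf(1) *] obtain q where "wf_fm L q \<and> fv q \<subseteq> (\<Union>x\<in>fv p. fv_tm (\<sigma> x)) \<and>
    (\<forall>(M :: ('s, 'f, 'r, 'u) struct) e. sat M e q = sat M (\<lambda>x. tm_val M e (\<sigma> x)) p)" by blast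
  moreover from Conj.IH(2)[OF wf(2) *] obtain q' where "wf_fm L q' \<and> fv q' \<subseteq> (\<Union>x\<in>fv p'. fv_tm (\<sigma> x)) \<and>
    (\<forall>(M :: ('s, 'f, 'r, 'u) struct) e. sat M e q' = sat M (\<lambda>x. tm_val M e (\<sigma> x)) p')" by blast
  ultimately show ?case by (intro exI[of _ "Conj q q'"]) auto
next
  case (Exi s n p)
  let ?V = "\<Union>x\<in>fv p. fv_tm (\<sigma> x)"
  have "finite (snd ` ?V)" by (simp add: finite_fv finite_fv_tm)
  then obtain m where m: "m \<notin> snd ` ?V" using ex_new_if_finite infinite_UNIV_nat by blast
  define \<tau> where "\<tau> = \<sigma>((s, n) := Var s m)"
  have wf: "wf_fm L p" using Exi.prems(1) by simp
  have "wf_tm L (\<tau> x) \<and> tm_sort L (\<tau> x) = fst x" if "x \<in> fv p" for x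
    using that Exi.prems by (cases "x = (s, n)") (simp_all add: \<tau>_def)
  from Exi.IH[OF wf this] obtain q where q: "wf_fm L q" "fv q \<subseteq> (\<Union>x\<in>fv p. fv_tm (\<tau> x))"
    "\<And>(M :: ('s, 'f, 'r, 'u) struct) e. sat M e q = sat M (\<lambda>x. tm_val M e (\<tau> x)) p" by blast
  have "sat M (e((s, m) := a)) q = sat M ((\<lambda>x. tm_val M e (\<sigma> x))((s, n) := a)) p"
    for M :: "('s, 'f, 'r, 'u) struct" and e a
    unfolding q(3)
  proof (rule sat_cong)
    fix x assume x: "x \<in> fv p"
    show "tm_val M (e((s, m) := a)) (\<tau> x) = ((\<lambda>x. tm_val M e (\<sigma> x))((s, n) := a)) x"
    proof (cases "x = (s, n)")
      case False
      have "tm_val M (e((s, m) := a)) (\<sigma> x) = tm_val M e (\<sigma> x)"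
        using m x by (intro tm_val_cong) force
      then show ?thesis using False by (simp add: \<tau>_def)
    qed (simp add: \<tau>_def)
  qed
  then show ?case using q(1,2) Exi.prems
    by (intro exI[of _ "Exi s m q"]) (auto simp: \<tau>_def split: if_splits)
qed

subsection \<open>Passing to and from the enriched language\<close>

lemma enrich_simps [simp]:
  "sorts (enrich L L0) = sorts L" "funs (enrich L L0) = funs L"
  "fdom (enrich L L0) = fdom L" "fcod (enrich L L0) = fcod L"
  "Base r \<in> rels (enrich L L0) \<longleftrightarrow> r \<in> rels L"
  "Def p xs \<in> rels (enrich L L0) \<longleftrightarrow>
    wf_fm L0 p \<and> distinct xs \<and> fv p \<subseteq> set xs \<and> fst ` set xs \<subseteq> sorts L0"
  "rdom (enrich L L0) (Base r) = rdom L r" "rdom (enrich L L0) (Def p xs) = map fst xs"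
  by (auto simp: enrich_def)

lemma tm_sort_enrich [simp]: "tm_sort (enrich L L0) = tm_sort L"
proof
  show "tm_sort (enrich L L0) t = tm_sort L t" for t by (cases t) auto
qed

lemma wf_tm_enrich [simp]: "wf_tm (enrich L L0) = wf_tm L"
proof
  show "wf_tm (enrich L L0) t = wf_tm L t" for t by (induction t) auto
qed

lemma tm_val_expand [simp]: "tm_val (expand M) = tm_val M"
proof (intro ext)
  show "tm_val (expand M) e t = tm_val M e t" for e t
  proof (induction t)
    case (App f ts)
    then have "map (tm_val (expand M) e) ts = map (tm_val M e) ts" by auto
    moreover have "fint (expand M) = fint M" by (simp add: expand_def)
    ultimately show ?case by (simp only: tm_val.simps)
  qed simp
qed

lemma univ_expand [simp]: "univ (expand M) = univ M"
  by (simp add: expand_def)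

lemma rint_expand [simp]:
  "rint (expand M) (Base r) as = rint M r as"
  "rint (expand M) (Def p xs) as = sat M (\<lambda>x. the (map_of (zip xs as) x)) p"
  by (simp_all add: expand_def)

definition sublanguage :: "('s, 'f, 'r) lang \<Rightarrow> ('s, 'f, 'r) lang \<Rightarrow> bool" where
  "sublanguage L0 L \<longleftrightarrow> sorts L0 \<subseteq> sorts L \<and> funs L0 \<subseteq> funs L \<and> rels L0 \<subseteq> rels L \<and>
     fdom L0 = fdom L \<and> fcod L0 = fcod L \<and> rdom L0 = rdom L"

lemma tm_sort_sublanguage: "sublanguage L0 L \<Longrightarrow> tm_sort L0 t = tm_sort L t"
  by (cases t) (auto simp: sublanguage_def)

lemma wf_tm_sublanguage: "sublanguage L0 L \<Longrightarrow> wf_tm L0 t \<Longrightarrow> wf_tm L t"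
proof (induction t)
  case (App f ts)
  have "tm_sort L0 = tm_sort L" using tm_sort_sublanguage[OF App.prems(1)] by blast
  then show ?case using App by (auto simp: sublanguage_def)
qed (auto simp: sublanguage_def)

lemma wf_fm_sublanguage: "sublanguage L0 L \<Longrightarrow> wf_fm L0 p \<Longrightarrow> wf_fm L p"
proof (induction p)
  case (Rel r ts)
  have "tm_sort L0 = tm_sort L" using tm_sort_sublanguage[OF Rel.prems(1)] by blast
  then show ?case using Rel wf_tm_sublanguage[of L0 L] by (auto simp: sublanguage_def)
next
  case (Exi s n p)
  then show ?case by (auto simp: sublanguage_def)
qed (auto simp: tm_sort_sublanguage[of L0 L] wf_tm_sublanguage[of L0 L])

text \<open>Only a \<open>Def\<close> atom needs work: it unfolds to its defining formula with the
  arguments substituted for the variables \<open>xs\<close>. Distinctness of \<open>xs\<close> makes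
  \<open>map_of\<close> pick the intended argument, and \<open>sublanguage\<close> makes the
  defining formula a formula of \<open>L\<close>.\<close>

lemma unenrich:
  fixes p :: "('s, 'f, ('s, 'f, 'r) esym) fm"
  assumes "sublanguage L0 L" "wf_fm (enrich L L0) p"
  shows "\<exists>q. wf_fm L q \<and> fv q \<subseteq> fv p \<and>
    (\<forall>(M :: ('s, 'f, 'r, 'u) struct) e. sat M e q = sat (expand M) e p)"
  using assms(2)
proof (induction p)
  case (Eq t u)
  then show ?case by (intro exI[of _ "Eq t u"]) simp
next
  case (Rel r ts)
  show ?case
  proof (cases r)
    case (Base r')
    then show ?thesis using Rel by (intro exI[of _ "Rel r' ts"]) simp
  next
    case (Def \<psi> xs)
    then have *: "wf_fm L0 \<psi>" "distinct xs" "fv \<psi> \<subseteq> set xs" "\<forall>t\<in>set ts. wf_tm L t" "map (tm_sort L) ts = map fst xs"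
      using Rel by auto
    then have len: "length ts = length xs" by (metis length_map)
    define \<sigma> where "\<sigma> x = the (map_of (zip xs ts) x)" for x
    have \<sigma>: "\<sigma> (xs ! i) = ts ! i" if "i < length xs" for i
      using that *(2) len by (simp add: \<sigma>_def map_of_zip_nth)
    have ix: "\<exists>i<length xs. x = xs ! i" if "x \<in> fv \<psi>" for x
      using that *(3) by (metis in_set_conv_nth subsetD)
    have wf: "wf_tm L (\<sigma> x) \<and> tm_sort L (\<sigma> x) = fst x \<and> \<sigma> x \<in> set ts" if "x \<in> fv \<psi>" for x
    proof -
      from ix[OF that] obtain i where "i < length xs" "x = xs ! i" by blast
      moreover from this have "tm_sort L (ts ! i) = fst (xs ! i)" using *(5) len by (metis nth_map)
      ultimately show ?thesis using \<sigma>[of i] *(4) len by simp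
    qed
    have "\<exists>q. wf_fm L q \<and> fv q \<subseteq> (\<Union>x\<in>fv \<psi>. fv_tm (\<sigma> x)) \<and>
      (\<forall>(M :: ('s, 'f, 'r, 'u) struct) e. sat M e q = sat M (\<lambda>x. tm_val M e (\<sigma> x)) \<psi>)"
    proof (rule substitution)
      show "wf_fm L \<psi>" by (rule wf_fm_sublanguage[OF assms(1) *(1)])
      show "wf_tm L (\<sigma> x) \<and> tm_sort L (\<sigma> x) = fst x" if "x \<in> fv \<psi>" for x
        using wf[OF that] by blast
    qed
    then obtain q where q: "wf_fm L q" "fv q \<subseteq> (\<Union>x\<in>fv \<psi>. fv_tm (\<sigma> x))"
      "\<And>(M :: ('s, 'f, 'r, 'u) struct) e. sat M e q = sat M (\<lambda>x. tm_val M e (\<sigma> x)) \<psi>"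
      by blast
    have qsat: "\<forall>(M :: ('s, 'f, 'r, 'u) struct) e. sat M e q = sat (expand M) e (Rel r ts)"
    proof (intro allI)
      fix M :: "('s, 'f, 'r, 'u) struct" and e
      have "sat M (\<lambda>x. tm_val M e (\<sigma> x)) \<psi> = sat M (\<lambda>x. the (map_of (zip xs (map (tm_val M e) ts)) x)) \<psi>"
      proof (rule sat_cong)
        fix x assume "x \<in> fv \<psi>"
        then obtain i where i: "i < length xs" "x = xs ! i" using ix by blast
        have "map_of (zip xs (map (tm_val M e) ts)) (xs ! i) = Some (map (tm_val M e) ts ! i)"
          using i len *(2) by (intro map_of_zip_nth) auto
        then show "tm_val M e (\<sigma> x) = the (map_of (zip xs (map (tm_val M e) ts)) x)"
          using i \<sigma> len by simp
      qed
      then show "sat M e q = sat (expand M) e (Rel r ts)" by (simp add: q(3) Def)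
    qed
    have "(\<Union>x\<in>fv \<psi>. fv_tm (\<sigma> x)) \<subseteq> fv (Rel r ts)"
    proof
      fix y assume "y \<in> (\<Union>x\<in>fv \<psi>. fv_tm (\<sigma> x))"
      then obtain x where "x \<in> fv \<psi>" "y \<in> fv_tm (\<sigma> x)" by blast
      then show "y \<in> fv (Rel r ts)" using wf[of x] by auto
    qed
    with q(2) have "fv q \<subseteq> fv (Rel r ts)" by blast
    with q(1) qsat show ?thesis by blast
  qed
next
  case (Neg p)
  then obtain q where "wf_fm L q" "fv q \<subseteq> fv p" "\<forall>(M :: ('s, 'f, 'r, 'u) struct) e. sat M e q = sat (expand M) e p" by auto
  then show ?case by (intro exI[of _ "Neg q"]) auto
next
  case (Conj p p')
  then have "wf_fm (enrich L L0) p" "wf_fm (enrich L L0) p'" by simp_all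
  from Conj.IH(1)[OF this(1)] Conj.IH(2)[OF this(2)] obtain q q' where "wf_fm L q" "fv q \<subseteq> fv p"
    "\<forall>(M :: ('s, 'f, 'r, 'u) struct) e. sat M e q = sat (expand M) e p"
    "wf_fm L q'" "fv q' \<subseteq> fv p'" "\<forall>(M :: ('s, 'f, 'r, 'u) struct) e. sat M e q' = sat (expand M) e p'" by blast
  then show ?case by (intro exI[of _ "Conj q q'"]) auto
next
  case (Exi s n p)
  then obtain q where "wf_fm L q" "fv q \<subseteq> fv p" "\<forall>(M :: ('s, 'f, 'r, 'u) struct) e. sat M e q = sat (expand M) e p" by auto
  then show ?case using Exi.prems by (intro exI[of _ "Exi s n q"]) auto
qed

text \<open>The arguments of the predicate are the terms \<open>\<sigma> x\<close> for the free
  variables \<open>x\<close> of \<phi>. The quantifiers of \<phi> disappear into the predicate; both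
  eliminations use this with terms \<pi>(t) in place of skeleton variables.\<close>

lemma definable_atom:
  fixes \<phi> :: "('s, 'f, 'r) fm"
  assumes "wf_fm L0 \<phi>" "\<And>x. x \<in> fv \<phi> \<Longrightarrow> wf_tm L (\<sigma> x) \<and> tm_sort L (\<sigma> x) = fst x"
  shows "\<exists>a. wf_fm (enrich L L0) a \<and> qfree a \<and> fv a \<subseteq> (\<Union>x\<in>fv \<phi>. fv_tm (\<sigma> x)) \<and>
    (\<forall>(M :: ('s, 'f, 'r, 'u) struct) e. sat (expand M) e a = sat M (\<lambda>x. tm_val M e (\<sigma> x)) \<phi>)"
proof -
  obtain xs where xs: "set xs = fv \<phi>" "distinct xs" using finite_distinct_list[OF finite_fv] by blast
  let ?a = "Rel (Def \<phi> xs) (map \<sigma> xs)"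
  have "wf_fm (enrich L L0) ?a"
    unfolding wf_fm.simps enrich_simps tm_sort_enrich wf_tm_enrich xs
    using assms(1) wf_fm_fv_sorts[OF assms(1)] assms(2)[folded xs(1)] xs(2) by (simp add: xs(1))
  moreover have "sat (expand M) e ?a = sat M (\<lambda>x. tm_val M e (\<sigma> x)) \<phi>" for M :: "('s, 'f, 'r, 'u) struct" and e
  proof -
    have "sat M (\<lambda>x. the (map_of (zip xs (map (\<lambda>x. tm_val M e (\<sigma> x)) xs)) x)) \<phi> = sat M (\<lambda>x. tm_val M e (\<sigma> x)) \<phi>"
      by (rule sat_cong) (simp add: xs map_of_zip_map)
    then show ?thesis by (simp add: comp_def)
  qed
  moreover have "fv ?a \<subseteq> (\<Union>x\<in>fv \<phi>. fv_tm (\<sigma> x))" using xs by auto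
  ultimately show ?thesis by (intro exI[of _ ?a]) simp
qed

subsection \<open>Derived connectives\<close>

abbreviation Disj :: "('s, 'f, 'r) fm \<Rightarrow> ('s, 'f, 'r) fm \<Rightarrow> ('s, 'f, 'r) fm" where
  "Disj p q \<equiv> Neg (Conj (Neg p) (Neg q))"

fun Exis :: "('s \<times> nat) list \<Rightarrow> ('s, 'f, 'r) fm \<Rightarrow> ('s, 'f, 'r) fm" where
  "Exis [] p = p"
| "Exis ((s, n) # xs) p = Exi s n (Exis xs p)"

text \<open>The block amounts to a single change of the environment on the listed variables. A
  repeated variable does no harm: its innermost occurrence decides.\<close>

lemma sat_Exis:
  "sat M e (Exis xs p) \<longleftrightarrow>
    (\<exists>e'. (\<forall>x. x \<notin> set xs \<longrightarrow> e' x = e x) \<and> (\<forall>x\<in>set xs. e' x \<in> univ M (fst x)) \<and> sat M e' p)"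
proof (induction xs arbitrary: e)
  case Nil
  have "(\<forall>x. e' x = e x) \<longleftrightarrow> e' = e" for e' by auto
  then show ?case by simp
next
  case (Cons x xs)
  obtain s n where x: "x = (s, n)" by fastforce
  have "sat M e (Exis (x # xs) p) \<longleftrightarrow> (\<exists>a\<in>univ M s. sat M (e(x := a)) (Exis xs p))"
    by (simp add: x)
  also have "\<dots> \<longleftrightarrow> (\<exists>e'. (\<forall>y. y \<notin> set (x # xs) \<longrightarrow> e' y = e y) \<and>
      (\<forall>y\<in>set (x # xs). e' y \<in> univ M (fst y)) \<and> sat M e' p)" (is "?l \<longleftrightarrow> ?r")
  proof
    assume ?l
    then obtain a e' where *: "a \<in> univ M s" "\<forall>y. y \<notin> set xs \<longrightarrow> e' y = (e(x := a)) y"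
      "\<forall>y\<in>set xs. e' y \<in> univ M (fst y)" "sat M e' p" using Cons.IH by blast
    then have "e' x \<in> univ M (fst x)" by (cases "x \<in> set xs") (auto simp: x)
    then show ?r using * by (intro exI[of _ e']) auto
  next
    assume ?r
    then obtain e' where *: "\<forall>y. y \<notin> set (x # xs) \<longrightarrow> e' y = e y"
      "\<forall>y\<in>set (x # xs). e' y \<in> univ M (fst y)" "sat M e' p" by blast
    then have "sat M (e(x := e' x)) (Exis xs p)" unfolding Cons.IH by (intro exI[of _ e']) auto
    then show ?l using * by (auto simp: x)
  qed
  finally show ?case .
qed

lemma wf_Exis: "wf_fm L (Exis xs p) \<longleftrightarrow> wf_fm L p \<and> fst ` set xs \<subseteq> sorts L"
  by (induction xs p rule: Exis.induct) auto

lemma fv_Exis: "fv (Exis xs p) = fv p - set xs"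
  by (induction xs p rule: Exis.induct) auto

lemma foldr_Exi: "foldr (Exi s) ns p = Exis (map (Pair s) ns) p"
  by (induction ns) simp_all

section \<open>Arithmetic of the skeleton\<close>

definition bplus :: "('k, 'v, 'g) vvs \<Rightarrow> ('g \<times> 'v) set \<Rightarrow> ('g \<times> 'v) set \<Rightarrow> ('g \<times> 'v) set" where
  "bplus X a b = (if (val_skel X a, val_skel X b) \<in> val_less X then a
     else if (val_skel X b, val_skel X a) \<in> val_less X then b else add_skel X a b)"

text \<open>\<open>scal_skel\<close> with the scalar zero gives the zero of the same fibre, whereas
  the class of the zero vector lies over \<infinity>. The correction makes \<open>kmul_pi\<close>
  hold for all scalars.\<close>

definition kmul :: "('k, 'v, 'g) vvs \<Rightarrow> 'k \<Rightarrow> ('g \<times> 'v) set \<Rightarrow> ('g \<times> 'v) set" where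
  "kmul X k a = (if k = \<zero>\<^bsub>scalars X\<^esub> then zero_skel X else scal_skel X k a)"

definition in_pi :: "('k, 'v, 'g) vvs \<Rightarrow> ('g \<times> 'v) set \<Rightarrow> bool" where
  "in_pi X a \<longleftrightarrow> add_skel X a a \<noteq> a \<or> a = zero_skel X"

primrec lc :: "('k, 'v, 'g) vvs \<Rightarrow> nat \<Rightarrow> (nat \<Rightarrow> 'k) \<Rightarrow> (nat \<Rightarrow> 'v) \<Rightarrow> 'v" where
  "lc X 0 k w = \<zero>\<^bsub>vectors X\<^esub>"
| "lc X (Suc n) k w = lc X n k w \<oplus>\<^bsub>vectors X\<^esub> k n \<odot>\<^bsub>vectors X\<^esub> w n"

primrec lcS :: "('k, 'v, 'g) vvs \<Rightarrow> nat \<Rightarrow> (nat \<Rightarrow> 'k) \<Rightarrow> (nat \<Rightarrow> ('g \<times> 'v) set) \<Rightarrow> ('g \<times> 'v) set" where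
  "lcS X 0 k c = zero_skel X"
| "lcS X (Suc n) k c = bplus X (lcS X n k c) (kmul X (k n) (c n))"

text \<open>A condition on classes alone, hence expressible in the skeleton. It asks that every
  partial sum lie in the image of \<pi>, not that it equal the class of the vector sum; by
  \<open>pi_add_if_in_pi\<close> the former implies the latter. Zero classes are allowed.\<close>

primrec separated :: "('k, 'v, 'g) vvs \<Rightarrow> nat \<Rightarrow> (nat \<Rightarrow> ('g \<times> 'v) set) \<Rightarrow> bool" where
  "separated X 0 c \<longleftrightarrow> True"
| "separated X (Suc n) c \<longleftrightarrow> separated X n c \<and> in_pi X (c n) \<and>
     (\<forall>k. (\<forall>i. k i \<in> carrier (scalars X)) \<longrightarrow> in_pi X (lcS X (Suc n) k c))"

lemma lc_cong: "(\<And>i. i < n \<Longrightarrow> k i = k' i \<and> w i = w' i) \<Longrightarrow> lc X n k w = lc X n k' w'"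
  by (induction n) auto

lemma lcS_cong: "(\<And>i. i < n \<Longrightarrow> k i = k' i \<and> c i = c' i) \<Longrightarrow> lcS X n k c = lcS X n k' c'"
  by (induction n) auto

lemma separated_cong: "(\<And>i. i < n \<Longrightarrow> c i = c' i) \<Longrightarrow> separated X n c = separated X n c'"
proof (induction n)
  case (Suc n)
  then have "separated X n c = separated X n c'" "c n = c' n" by simp_all
  moreover have "lcS X (Suc n) k c = lcS X (Suc n) k c'" for k using Suc.prems by (intro lcS_cong) simp
  ultimately show ?case by simp
qed simp

section \<open>Elementary arithmetic of values, classes and the map \<open>pi_skel\<close>\<close>

locale valued =
  fixes X :: "('k, 'v, 'g) vvs"
  assumes X: "valued_vector_space X"
begin

abbreviation "K \<equiv> scalars X"
abbreviation "V \<equiv> vectors X"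

sublocale module K V
  using X by (simp add: valued_vector_space_def)

sublocale R: field K
  using X by (simp add: valued_vector_space_def)

abbreviation less :: "'g \<Rightarrow> 'g \<Rightarrow> bool"  (infix "\<sqsubset>" 50) where
  "g \<sqsubset> h \<equiv> (g, h) \<in> val_less X"

lemmas above_diff = above_diff[OF X] and cls_eq_iff = cls_eq_iff[OF X]
  and pi_in_preskel = pi_in_preskel[OF X] and irrefl = irrefl_val_less[OF X]

lemma less_trans: "g \<sqsubset> h \<Longrightarrow> h \<sqsubset> i \<Longrightarrow> g \<sqsubset> i"
  using trans_val_less[OF X] by (rule transD)

lemma less_linear: "g \<in> val_chain X \<Longrightarrow> h \<in> val_chain X \<Longrightarrow> g \<sqsubset> h \<or> g = h \<or> h \<sqsubset> g"
  using X unfolding valued_vector_space_def strict_linear_order_on_def total_on_def by blast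

lemma val_chain [simp]: "x \<in> carrier V \<Longrightarrow> val X x \<in> val_chain X"
  using X unfolding valued_vector_space_def by blast

lemma val_zero [simp]: "val X \<zero>\<^bsub>V\<^esub> = top_val X"
  using X unfolding valued_vector_space_def by blast

lemma val_eq_top: "x \<in> carrier V \<Longrightarrow> val X x = top_val X \<longleftrightarrow> x = \<zero>\<^bsub>V\<^esub>"
  using X unfolding valued_vector_space_def by blast

lemma val_smult: "k \<in> carrier K \<Longrightarrow> k \<noteq> \<zero>\<^bsub>K\<^esub> \<Longrightarrow> x \<in> carrier V \<Longrightarrow> val X (k \<odot>\<^bsub>V\<^esub> x) = val X x"
  using X unfolding valued_vector_space_def by blast

lemma pi_eq_iff:
  "x \<in> carrier V \<Longrightarrow> y \<in> carrier V \<Longrightarrow>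
    pi_skel X x = pi_skel X y \<longleftrightarrow> val X x = val X y \<and> (x = y \<or> val X x \<sqsubset> val X (x \<ominus>\<^bsub>V\<^esub> y))"
  unfolding pi_skel_def by (intro cls_eq_iff pi_in_preskel)

lemma val_pi [simp]: "x \<in> carrier V \<Longrightarrow> val_skel X (pi_skel X x) = val X x"
  unfolding pi_skel_def by (intro val_skel_cls[OF X] pi_in_preskel)

lemma pi_in_skel [simp]: "x \<in> carrier V \<Longrightarrow> pi_skel X x \<in> skel X"
  unfolding pi_skel_def by (intro cls_in_skel[OF X] pi_in_preskel)

lemma pi_zero [simp]: "pi_skel X \<zero>\<^bsub>V\<^esub> = zero_skel X"
  by (simp add: pi_skel_def zero_skel_def)

lemma zero_in_skel [simp]: "zero_skel X \<in> skel X"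
  unfolding pi_zero[symmetric] by (rule pi_in_skel) simp

lemma pi_eq_zero: "x \<in> carrier V \<Longrightarrow> pi_skel X x = zero_skel X \<longleftrightarrow> x = \<zero>\<^bsub>V\<^esub>"
  using pi_eq_iff[of x "\<zero>\<^bsub>V\<^esub>"] val_eq_top[of x] by auto

lemma val_skel_in_chain [simp]: "a \<in> skel X \<Longrightarrow> val_skel X a \<in> val_chain X"
  using skel_cases[OF X, of a] val_skel_cls[OF X] preskelD(1)[OF X] by metis

lemma val_zero_skel [simp]: "val_skel X (zero_skel X) = top_val X"
  unfolding pi_zero[symmetric] by (subst val_pi) auto

lemma add_skel_closed [simp]:
  assumes "a \<in> skel X" "b \<in> skel X" shows "add_skel X a b \<in> skel X"
proof -
  obtain g v where a: "(g, v) \<in> preskel X" "a = cls X g v" using skel_cases[OF X assms(1)] .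
  obtain h w where b: "(h, w) \<in> preskel X" "b = cls X h w" using skel_cases[OF X assms(2)] .
  show ?thesis
  proof (cases "g = h")
    case True
    then show ?thesis using a b add_skel_cls[OF X] preskel_add[OF X] cls_in_skel[OF X] by simp
  next
    case False
    then show ?thesis using a b add_skel_cls_neq[OF X] by simp
  qed
qed

lemma scal_skel_closed [simp]:
  assumes "a \<in> skel X" "k \<in> carrier K" shows "scal_skel X k a \<in> skel X"
proof -
  obtain g v where a: "(g, v) \<in> preskel X" "a = cls X g v" using skel_cases[OF X assms(1)] .
  then show ?thesis using scal_skel_cls[OF X] preskel_smult[OF X] cls_in_skel[OF X] assms by simp
qed

lemma val_add_skel:
  assumes "a \<in> skel X" "b \<in> skel X" "val_skel X a = val_skel X b"
  shows "val_skel X (add_skel X a b) = val_skel X a"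
proof -
  obtain g v where a: "(g, v) \<in> preskel X" "a = cls X g v" using skel_cases[OF X assms(1)] .
  obtain h w where b: "(h, w) \<in> preskel X" "b = cls X h w" using skel_cases[OF X assms(2)] .
  have "g = h" using assms(3) a b val_skel_cls[OF X] by simp
  then show ?thesis using a b add_skel_cls[OF X] preskel_add[OF X] val_skel_cls[OF X] by simp
qed

lemma val_scal_skel: "a \<in> skel X \<Longrightarrow> k \<in> carrier K \<Longrightarrow> val_skel X (scal_skel X k a) = val_skel X a"
proof -
  assume a': "a \<in> skel X" and k: "k \<in> carrier K"
  obtain g v where a: "(g, v) \<in> preskel X" "a = cls X g v" using skel_cases[OF X a'] .
  then show ?thesis using scal_skel_cls[OF X] preskel_smult[OF X] val_skel_cls[OF X] k by simp
qed

lemma scal_skel_inverse: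
  assumes "a \<in> skel X" "k \<in> carrier K" "l \<in> carrier K" "k \<otimes>\<^bsub>K\<^esub> l = \<one>\<^bsub>K\<^esub>"
  shows "scal_skel X k (scal_skel X l a) = a"
proof -
  obtain g v where a: "(g, v) \<in> preskel X" "a = cls X g v" using skel_cases[OF X assms(1)] .
  then have "k \<odot>\<^bsub>V\<^esub> (l \<odot>\<^bsub>V\<^esub> v) = v"
    using assms preskelD(2)[OF X] by (metis smult_assoc1 smult_one)
  then show ?thesis using a scal_skel_cls[OF X] preskel_smult[OF X] assms by simp
qed

lemma scal_pi:
  assumes "k \<in> carrier K" "k \<noteq> \<zero>\<^bsub>K\<^esub>" "x \<in> carrier V"
  shows "scal_skel X k (pi_skel X x) = pi_skel X (k \<odot>\<^bsub>V\<^esub> x)"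
  using assms scal_skel_cls[OF X pi_in_preskel] by (simp add: pi_skel_def val_smult)

lemma kmul_pi:
  "k \<in> carrier K \<Longrightarrow> x \<in> carrier V \<Longrightarrow> kmul X k (pi_skel X x) = pi_skel X (k \<odot>\<^bsub>V\<^esub> x)"
  by (simp add: kmul_def scal_pi)

lemma kmul_closed [simp]: "a \<in> skel X \<Longrightarrow> k \<in> carrier K \<Longrightarrow> kmul X k a \<in> skel X"
  by (simp add: kmul_def)

lemma bplus_closed [simp]: "a \<in> skel X \<Longrightarrow> b \<in> skel X \<Longrightarrow> bplus X a b \<in> skel X"
  by (simp add: bplus_def)

lemma add_minus: "x \<in> carrier V \<Longrightarrow> y \<in> carrier V \<Longrightarrow> (x \<oplus>\<^bsub>V\<^esub> y) \<ominus>\<^bsub>V\<^esub> y = x"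
  by (simp add: a_minus_def M.a_assoc M.r_neg)

lemma add_minus': "x \<in> carrier V \<Longrightarrow> y \<in> carrier V \<Longrightarrow> (x \<oplus>\<^bsub>V\<^esub> y) \<ominus>\<^bsub>V\<^esub> x = y"
  using add_minus[of y x] by (simp add: M.a_comm)

lemma minus_add: "x \<in> carrier V \<Longrightarrow> y \<in> carrier V \<Longrightarrow> (x \<ominus>\<^bsub>V\<^esub> y) \<oplus>\<^bsub>V\<^esub> y = x"
  by (simp add: a_minus_def M.a_assoc M.l_neg)

lemma uminus_zero: "\<ominus>\<^bsub>V\<^esub> \<zero>\<^bsub>V\<^esub> = \<zero>\<^bsub>V\<^esub>"
  by (rule M.minus_equality) simp_all

lemma val_uminus: "x \<in> carrier V \<Longrightarrow> val X (\<ominus>\<^bsub>V\<^esub> x) = val X x"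
proof -
  assume x: "x \<in> carrier V"
  have "\<ominus>\<^bsub>K\<^esub> \<one>\<^bsub>K\<^esub> \<noteq> \<zero>\<^bsub>K\<^esub>" using R.one_not_zero by (metis R.minus_minus R.minus_zero R.one_closed)
  moreover have "(\<ominus>\<^bsub>K\<^esub> \<one>\<^bsub>K\<^esub>) \<odot>\<^bsub>V\<^esub> x = \<ominus>\<^bsub>V\<^esub> x" using x by (simp add: smult_l_minus)
  ultimately show ?thesis using val_smult[of "\<ominus>\<^bsub>K\<^esub> \<one>\<^bsub>K\<^esub>" x] x by simp
qed

lemma above_add:
  "x \<in> carrier V \<Longrightarrow> y \<in> carrier V \<Longrightarrow> g \<sqsubset> val X x \<Longrightarrow> g \<sqsubset> val X y \<Longrightarrow> g \<sqsubset> val X (x \<oplus>\<^bsub>V\<^esub> y)"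
  using above_diff[of x "\<ominus>\<^bsub>V\<^esub> y" g] by (simp add: val_uminus a_minus_def)

lemma val_add_less:
  assumes "x \<in> carrier V" "y \<in> carrier V" "val X x \<sqsubset> val X y"
  shows "val X (x \<oplus>\<^bsub>V\<^esub> y) = val X x"
proof -
  have "\<not> val X x \<sqsubset> val X (x \<oplus>\<^bsub>V\<^esub> y)"
    using above_diff[of "x \<oplus>\<^bsub>V\<^esub> y" y "val X x"] assms irrefl add_minus by force
  moreover have "\<not> val X (x \<oplus>\<^bsub>V\<^esub> y) \<sqsubset> val X x"
    using above_add[of x y "val X (x \<oplus>\<^bsub>V\<^esub> y)"] assms irrefl less_trans by blast
  ultimately show ?thesis using less_linear[of "val X (x \<oplus>\<^bsub>V\<^esub> y)" "val X x"] assms by auto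
qed

lemma pi_add_less:
  assumes "x \<in> carrier V" "y \<in> carrier V" "val X x \<sqsubset> val X y"
  shows "pi_skel X (x \<oplus>\<^bsub>V\<^esub> y) = pi_skel X x"
  using assms by (simp add: pi_eq_iff val_add_less add_minus')

lemma add_pi:
  "x \<in> carrier V \<Longrightarrow> y \<in> carrier V \<Longrightarrow> val X x = val X y \<Longrightarrow>
    add_skel X (pi_skel X x) (pi_skel X y) = cls X (val X x) (x \<oplus>\<^bsub>V\<^esub> y)"
  unfolding pi_skel_def using add_skel_cls[OF X] pi_in_preskel by metis

text \<open>For different values the smaller one wins. For equal values the hypothesis excludes
  cancellation, so x + y has the same value and the sum in the fibre is \<pi>(x + y).\<close>

lemma bplus_pi:
  assumes "x \<in> carrier V" "y \<in> carrier V" "val X x = val X y \<Longrightarrow> \<not> val X x \<sqsubset> val X (x \<oplus>\<^bsub>V\<^esub> y)"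
  shows "bplus X (pi_skel X x) (pi_skel X y) = pi_skel X (x \<oplus>\<^bsub>V\<^esub> y)"
proof -
  consider "val X x \<sqsubset> val X y" | "val X y \<sqsubset> val X x" | "val X x = val X y"
    using less_linear assms val_chain by blast
  then show ?thesis
  proof cases
    case 1
    then show ?thesis using assms by (simp add: bplus_def pi_add_less)
  next
    case 2
    then have "\<not> val X x \<sqsubset> val X y" using irrefl less_trans by blast
    then show ?thesis using 2 assms pi_add_less[of y x] by (simp add: bplus_def M.a_comm)
  next
    case 3
    have "\<not> val X (x \<oplus>\<^bsub>V\<^esub> y) \<sqsubset> val X x"
      using above_add[of x y "val X (x \<oplus>\<^bsub>V\<^esub> y)"] 3 assms irrefl by auto
    then have "val X (x \<oplus>\<^bsub>V\<^esub> y) = val X x"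
      using less_linear[of "val X (x \<oplus>\<^bsub>V\<^esub> y)" "val X x"] assms 3 by auto
    then show ?thesis using assms 3 irrefl by (simp add: bplus_def add_pi) (simp add: pi_skel_def)
  qed
qed

text \<open>The equation a + a = a holds exactly for the zero of a fibre. Below \<infinity> this is
  the one class of the fibre that is not some \<pi>(v); over \<infinity> it is \<pi>(0).\<close>

lemma in_pi_iff:
  assumes "a \<in> skel X"
  shows "in_pi X a \<longleftrightarrow> (\<exists>v\<in>carrier V. a = pi_skel X v)"
proof -
  obtain g v where a: "(g, v) \<in> preskel X" "a = cls X g v" using skel_cases[OF X assms] .
  then have v: "v \<in> carrier V" "g = val X v \<or> g \<sqsubset> val X v" by (auto simp: preskel_def leq_val_def)
  have "v \<oplus>\<^bsub>V\<^esub> v = v \<longleftrightarrow> v = \<zero>\<^bsub>V\<^esub>" using v by (metis M.add.l_cancel_one')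
  then have eq: "add_skel X a a = a \<longleftrightarrow> v = \<zero>\<^bsub>V\<^esub> \<or> g \<sqsubset> val X v"
    using a v by (simp add: add_skel_cls[OF X] cls_eq_iff preskel_add[OF X] add_minus)
  show ?thesis
  proof
    assume i: "in_pi X a"
    show "\<exists>v\<in>carrier V. a = pi_skel X v"
    proof (cases "a = zero_skel X")
      case True
      then show ?thesis by (intro bexI[of _ "\<zero>\<^bsub>V\<^esub>"]) auto
    next
      case False
      then have "g = val X v" using i eq v by (auto simp: in_pi_def)
      then show ?thesis using a v by (intro bexI[of _ v]) (auto simp: pi_skel_def)
    qed
  next
    assume "\<exists>v\<in>carrier V. a = pi_skel X v"
    then obtain w where w: "w \<in> carrier V" "a = pi_skel X w" by blast
    show "in_pi X a"
    proof (rule ccontr)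
      assume "\<not> in_pi X a"
      then have *: "add_skel X a a = a" "a \<noteq> zero_skel X" by (simp_all add: in_pi_def)
      then have nz: "w \<noteq> \<zero>\<^bsub>V\<^esub>" using w pi_zero by metis
      have "add_skel X a a = cls X (val X w) (w \<oplus>\<^bsub>V\<^esub> w)" unfolding w(2) using w(1) by (rule add_pi[OF _ w(1) refl])
      with * have "cls X (val X w) (w \<oplus>\<^bsub>V\<^esub> w) = cls X (val X w) w"
        using w(2) by (simp add: pi_skel_def)
      then have "w \<oplus>\<^bsub>V\<^esub> w = w \<or> val X w \<sqsubset> val X w"
        using w(1) pi_in_preskel[OF w(1)] by (simp add: cls_eq_iff preskel_add[OF X] add_minus)
      then show False using irrefl w(1) nz by (metis M.add.l_cancel_one')
    qed
  qed
qed

lemma in_pi_pi [simp]: "v \<in> carrier V \<Longrightarrow> in_pi X (pi_skel X v)"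
  using in_pi_iff[OF pi_in_skel] by blast

text \<open>If x and y cancelled, their sum in the fibre would be the class of x + y over a value
  below \<open>val X (x \<oplus> y)\<close>. A vector \<open>w\<close> with this class would have
  that lower value, hence so would (x + y) - w, although equality of the classes demands a larger
  one.\<close>

lemma pi_add_if_in_pi:
  assumes "x \<in> carrier V" "y \<in> carrier V" "in_pi X (bplus X (pi_skel X x) (pi_skel X y))"
  shows "pi_skel X (x \<oplus>\<^bsub>V\<^esub> y) = bplus X (pi_skel X x) (pi_skel X y)"
proof (rule bplus_pi[symmetric])
  assume eq: "val X x = val X y"
  show "\<not> val X x \<sqsubset> val X (x \<oplus>\<^bsub>V\<^esub> y)"
  proof
    assume less: "val X x \<sqsubset> val X (x \<oplus>\<^bsub>V\<^esub> y)"
    let ?a = "cls X (val X x) (x \<oplus>\<^bsub>V\<^esub> y)"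
    have b: "bplus X (pi_skel X x) (pi_skel X y) = ?a"
      using assms eq irrefl by (simp add: bplus_def add_pi)
    have pre: "(val X x, x \<oplus>\<^bsub>V\<^esub> y) \<in> preskel X" using assms less by (simp add: preskel_def leq_val_def)
    have "?a \<in> skel X" using pre cls_in_skel[OF X] by blast
    then obtain w where w: "w \<in> carrier V" "?a = pi_skel X w" using assms(3) b in_pi_iff by auto
    then have "val X x = val X w \<and> (x \<oplus>\<^bsub>V\<^esub> y = w \<or> val X x \<sqsubset> val X ((x \<oplus>\<^bsub>V\<^esub> y) \<ominus>\<^bsub>V\<^esub> w))"
      using cls_eq_iff[OF pre pi_in_preskel[OF w(1)]] unfolding pi_skel_def by blast
    moreover have "val X ((x \<oplus>\<^bsub>V\<^esub> y) \<ominus>\<^bsub>V\<^esub> w) = val X w" if "val X x = val X w"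
    proof -
      have "(x \<oplus>\<^bsub>V\<^esub> y) \<ominus>\<^bsub>V\<^esub> w = \<ominus>\<^bsub>V\<^esub> w \<oplus>\<^bsub>V\<^esub> (x \<oplus>\<^bsub>V\<^esub> y)" using assms w by (simp add: a_minus_def M.a_comm)
      then show ?thesis using val_add_less[of "\<ominus>\<^bsub>V\<^esub> w" "x \<oplus>\<^bsub>V\<^esub> y"] assms w less that by (simp add: val_uminus)
    qed
    ultimately show False using less irrefl by auto
  qed
qed (use assms in auto)

subsection \<open>Linear combinations\<close>

lemma lc_closed [simp]: "(\<And>i. k i \<in> carrier K) \<Longrightarrow> (\<And>i. w i \<in> carrier V) \<Longrightarrow> lc X n k w \<in> carrier V"
  by (induction n) auto

lemma lcS_closed [simp]:
  "(\<And>i. k i \<in> carrier K) \<Longrightarrow> (\<And>i. i < n \<Longrightarrow> c i \<in> skel X) \<Longrightarrow> lcS X n k c \<in> skel X"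
  by (induction n) auto

lemma lc_add:
  assumes "\<And>i. k i \<in> carrier K" "\<And>i. l i \<in> carrier K" "\<And>i. w i \<in> carrier V"
  shows "lc X n (\<lambda>i. k i \<oplus>\<^bsub>K\<^esub> l i) w = lc X n k w \<oplus>\<^bsub>V\<^esub> lc X n l w"
  using assms by (induction n) (simp_all add: smult_l_distr M.a_ac)

lemma lc_smult:
  assumes "a \<in> carrier K" "\<And>i. k i \<in> carrier K" "\<And>i. w i \<in> carrier V"
  shows "lc X n (\<lambda>i. a \<otimes>\<^bsub>K\<^esub> k i) w = a \<odot>\<^bsub>V\<^esub> lc X n k w"
  using assms by (induction n) (simp_all add: smult_r_distr smult_assoc1)

lemma lc_uminus:
  assumes "\<And>i. k i \<in> carrier K" "\<And>i. w i \<in> carrier V"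
  shows "lc X n (\<lambda>i. \<ominus>\<^bsub>K\<^esub> k i) w = \<ominus>\<^bsub>V\<^esub> lc X n k w"
proof (induction n)
  case 0
  show ?case by (simp add: uminus_zero)
next
  case (Suc n)
  have "\<ominus>\<^bsub>V\<^esub> (lc X n k w \<oplus>\<^bsub>V\<^esub> k n \<odot>\<^bsub>V\<^esub> w n) = \<ominus>\<^bsub>V\<^esub> lc X n k w \<oplus>\<^bsub>V\<^esub> \<ominus>\<^bsub>V\<^esub> (k n \<odot>\<^bsub>V\<^esub> w n)"
    using assms by (intro M.minus_add) simp_all
  then show ?case using Suc assms by (simp add: smult_l_minus)
qed

lemma lc_minus:
  assumes "\<And>i. k i \<in> carrier K" "\<And>i. l i \<in> carrier K" "\<And>i. w i \<in> carrier V"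
  shows "lc X n (\<lambda>i. k i \<ominus>\<^bsub>K\<^esub> l i) w = lc X n k w \<ominus>\<^bsub>V\<^esub> lc X n l w"
  unfolding a_minus_def using lc_add[of k "\<lambda>i. \<ominus>\<^bsub>K\<^esub> l i" w n] assms by (simp add: lc_uminus)

lemma lc_trivial: "(\<And>i. i < n \<Longrightarrow> k i = \<zero>\<^bsub>K\<^esub>) \<Longrightarrow> (\<And>i. w i \<in> carrier V) \<Longrightarrow> lc X n k w = \<zero>\<^bsub>V\<^esub>"
  by (induction n) auto

text \<open>Each partial sum is known to lie in the image, so \<open>pi_add_if_in_pi\<close> applies
  at every step of the recursion.\<close>

lemma pi_lc:
  assumes "separated X n (\<lambda>i. pi_skel X (w i))" "\<And>i. k i \<in> carrier K" "\<And>i. w i \<in> carrier V"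
  shows "pi_skel X (lc X n k w) = lcS X n k (\<lambda>i. pi_skel X (w i))"
  using assms(1)
proof (induction n)
  case (Suc n)
  let ?c = "\<lambda>i. pi_skel X (w i)"
  have 1: "pi_skel X (lc X n k w) = lcS X n k ?c" using Suc by simp
  have 2: "pi_skel X (k n \<odot>\<^bsub>V\<^esub> w n) = kmul X (k n) (?c n)" using assms by (simp add: kmul_pi)
  have "in_pi X (lcS X (Suc n) k ?c)" using Suc.prems assms(2) by simp
  then show ?case using pi_add_if_in_pi[of "lc X n k w" "k n \<odot>\<^bsub>V\<^esub> w n"] assms(2,3) 1 2 by simp
qed simp

text \<open>\<open>bplus\<close> always has the value of one of its arguments. If the result is the
  zero class, one of the two summands has value \<infinity> and is zero, hence so is the other, and
  the induction continues with the shorter sum.\<close>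

lemma lc_eq_zero:
  assumes "separated X n (\<lambda>i. pi_skel X (w i))" "\<And>i. k i \<in> carrier K" "\<And>i. w i \<in> carrier V"
    "lc X n k w = \<zero>\<^bsub>V\<^esub>" "i < n"
  shows "k i \<odot>\<^bsub>V\<^esub> w i = \<zero>\<^bsub>V\<^esub>"
  using assms(1,4,5)
proof (induction n)
  case (Suc n)
  let ?c = "\<lambda>i. pi_skel X (w i)" and ?x = "lc X n k w" and ?y = "k n \<odot>\<^bsub>V\<^esub> w n"
  have y: "?y \<in> carrier V" and x: "?x \<in> carrier V" using assms(2,3) by simp_all
  have "pi_skel X ?x = lcS X n k ?c" using Suc.prems(1) pi_lc assms(2,3) by simp
  moreover have "pi_skel X ?y = kmul X (k n) (?c n)" using assms(2,3) by (simp add: kmul_pi)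
  ultimately have z: "bplus X (pi_skel X ?x) (pi_skel X ?y) = zero_skel X"
    using pi_lc[OF Suc.prems(1), of k] Suc.prems(2) assms(2,3) by simp
  have "val X ?x = top_val X \<or> val X ?y = top_val X"
  proof (cases "val X ?x = val X ?y")
    case True
    then have "val_skel X (bplus X (pi_skel X ?x) (pi_skel X ?y)) = val X ?x"
      using x y irrefl by (simp add: bplus_def val_add_skel)
    then show ?thesis using z by simp
  next
    case False
    then have "bplus X (pi_skel X ?x) (pi_skel X ?y) \<in> {pi_skel X ?x, pi_skel X ?y}"
      using x y less_linear[of "val X ?x" "val X ?y"] by (auto simp: bplus_def)
    then show ?thesis using z val_pi[OF x] val_pi[OF y] val_zero_skel by (metis empty_iff insert_iff)
  qed
  then have "?x = \<zero>\<^bsub>V\<^esub> \<or> ?y = \<zero>\<^bsub>V\<^esub>" using x y val_eq_top by blast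
  then have *: "?x = \<zero>\<^bsub>V\<^esub>" "?y = \<zero>\<^bsub>V\<^esub>" using Suc.prems(2) x y by auto
  show ?case
  proof (cases "i = n")
    case False
    then show ?thesis using Suc.IH * Suc.prems by simp
  qed (simp add: *)
qed simp

text \<open>The nonzero members of a separated family are linearly independent, by
  \<open>lc_eq_zero\<close> for the differences k - l. Members equal to zero are exempt. Both
  alternatives are visible in the scalars and the classes, so this criterion serves as the
  translation of vector equations.\<close>

lemma lc_eq_iff:
  assumes "separated X n (\<lambda>i. pi_skel X (w i))" "\<And>i. k i \<in> carrier K" "\<And>i. l i \<in> carrier K"
    "\<And>i. w i \<in> carrier V"
  shows "lc X n k w = lc X n l w \<longleftrightarrow> (\<forall>i<n. k i = l i \<or> pi_skel X (w i) = zero_skel X)"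
proof
  assume "lc X n k w = lc X n l w"
  then have "lc X n (\<lambda>i. k i \<ominus>\<^bsub>K\<^esub> l i) w = \<zero>\<^bsub>V\<^esub>"
    using assms by (subst lc_minus) (simp_all add: a_minus_def M.r_neg)
  then have *: "(k i \<ominus>\<^bsub>K\<^esub> l i) \<odot>\<^bsub>V\<^esub> w i = \<zero>\<^bsub>V\<^esub>" if "i < n" for i
    using lc_eq_zero[OF assms(1) _ assms(4), of "\<lambda>i. k i \<ominus>\<^bsub>K\<^esub> l i" i] that assms(2,3) by simp
  show "\<forall>i<n. k i = l i \<or> pi_skel X (w i) = zero_skel X"
  proof (intro allI impI)
    fix i assume "i < n"
    show "k i = l i \<or> pi_skel X (w i) = zero_skel X"
    proof (cases "k i \<ominus>\<^bsub>K\<^esub> l i = \<zero>\<^bsub>K\<^esub>")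
      case True
      then have "\<ominus>\<^bsub>K\<^esub> (\<ominus>\<^bsub>K\<^esub> l i) = k i"
        using assms(2,3) by (intro R.minus_equality) (simp_all add: a_minus_def)
      then show ?thesis using assms(3) by simp
    next
      case False
      then have "val X (w i) = top_val X"
        using val_smult[of "k i \<ominus>\<^bsub>K\<^esub> l i" "w i"] *[OF \<open>i < n\<close>] assms by simp
      then show ?thesis using val_eq_top assms(4) pi_eq_zero by blast
    qed
  qed
next
  assume *: "\<forall>i<n. k i = l i \<or> pi_skel X (w i) = zero_skel X"
  then show "lc X n k w = lc X n l w"
  proof (induction n)
    case (Suc n)
    have "k n \<odot>\<^bsub>V\<^esub> w n = l n \<odot>\<^bsub>V\<^esub> w n"
      using Suc.prems[rule_format, of n] assms(2-4) pi_eq_zero by auto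
    then show ?case using Suc by simp
  qed simp
qed

text \<open>Cancellation stays in its fibre, so \<open>bplus\<close> creates no new value, and
  \<open>kmul\<close> at most \<infinity>. This provides the finiteness behind the maximum in
  \<open>separated_extend\<close>.\<close>

lemma val_lcS:
  assumes "\<And>i. k i \<in> carrier K" "\<And>i. c i \<in> skel X"
  shows "val_skel X (lcS X n k c) \<in> insert (top_val X) ((\<lambda>i. val_skel X (c i)) ` {..<n})"
proof (induction n)
  case (Suc n)
  have "val_skel X (bplus X a b) \<in> {val_skel X a, val_skel X b}" if "a \<in> skel X" "b \<in> skel X" for a b
    using that less_linear[of "val_skel X a" "val_skel X b"] by (auto simp: bplus_def val_add_skel)
  from this[of "lcS X n k c" "kmul X (k n) (c n)"]
  have "val_skel X (lcS X (Suc n) k c) \<in> {val_skel X (lcS X n k c), val_skel X (kmul X (k n) (c n))}"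
    using assms by simp
  moreover have "val_skel X (kmul X (k n) (c n)) \<in> {top_val X, val_skel X (c n)}"
    using assms by (simp add: kmul_def val_scal_skel)
  ultimately show ?case using Suc.IH by (auto simp: lessThan_Suc)
qed simp

section \<open>Existence of separated families\<close>

lemma finite_maximal:
  assumes "finite A" "A \<noteq> {}" "A \<subseteq> val_chain X"
  shows "\<exists>m\<in>A. \<forall>a\<in>A. \<not> m \<sqsubset> a"
  using assms
proof (induction A rule: finite_ne_induct)
  case (singleton x)
  then show ?case using irrefl by simp
next
  case (insert x A)
  then obtain m where m: "m \<in> A" "\<forall>a\<in>A. \<not> m \<sqsubset> a" by auto
  show ?case
  proof (cases "m \<sqsubset> x")
    case True
    then show ?thesis using m irrefl less_trans by (intro bexI[of _ x]) auto
  next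
    case False
    then show ?thesis using m by blast
  qed
qed

text \<open>A representative of maximal value in the coset of \<open>v\<close> modulo the span of \<open>w\<close> extends the
  separated family. The maximum exists because an improvable value is a value of the span, and there
  are only finitely many of these.\<close>

lemma separated_extend:
  assumes sep: "separated X n (\<lambda>i. pi_skel X (w i))" and w: "\<And>i. w i \<in> carrier V" and v: "v \<in> carrier V"
  obtains k x where "\<And>i. k i \<in> carrier K" "x \<in> carrier V" "v = lc X n k w \<oplus>\<^bsub>V\<^esub> x"
    "separated X (Suc n) (\<lambda>i. pi_skel X ((w(n := x)) i))"
proof -
  let ?KK = "{k :: nat \<Rightarrow> 'k. \<forall>i. k i \<in> carrier K}"
  let ?r = "\<lambda>k :: nat \<Rightarrow> 'k. v \<ominus>\<^bsub>V\<^esub> lc X n k w"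
  let ?S = "(\<lambda>k. val X (?r k)) ` ?KK"
  let ?F = "insert (top_val X) ((\<lambda>i. val_skel X (pi_skel X (w i))) ` {..<n})"
  have r: "?r k \<in> carrier V" if "k \<in> ?KK" for k using that w v by simp
  have "\<exists>k\<in>?KK. \<forall>l\<in>?KK. \<not> val X (?r k) \<sqsubset> val X (?r l)"
  proof (rule ccontr)
    assume "\<not> ?thesis"
    then have *: "\<exists>l\<in>?KK. val X (?r k) \<sqsubset> val X (?r l)" if "k \<in> ?KK" for k using that by blast
    have "?S \<subseteq> ?F"
    proof (rule image_subsetI)
      fix k assume k: "k \<in> ?KK"
      then obtain l where l: "l \<in> ?KK" "val X (?r k) \<sqsubset> val X (?r l)" using * by blast
      \<comment> \<open>The difference of the two approximations lies in the span. As
        \<open>?r l\<close> has the larger value, the difference has the value of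
        \<open>?r k\<close>, and \<open>pi_lc\<close> with \<open>val_lcS\<close> places it in the
        finite set \<open>?F\<close>.\<close>
      let ?s = "lc X n (\<lambda>i. k i \<ominus>\<^bsub>K\<^esub> l i) w"
      have kl: "\<And>i. k i \<in> carrier K" "\<And>i. l i \<in> carrier K" using k l by auto
      have s: "?s \<in> carrier V" using kl w by simp
      have "?s = lc X n k w \<ominus>\<^bsub>V\<^esub> lc X n l w" using kl w by (intro lc_minus) auto
      then have "?s = \<ominus>\<^bsub>V\<^esub> ?r k \<oplus>\<^bsub>V\<^esub> ?r l"
        using kl w v by (simp add: a_minus_def M.minus_add M.a_ac M.r_neg2 M.r_neg1)
      then have "val X ?s = val X (?r k)"
        using val_add_less[of "\<ominus>\<^bsub>V\<^esub> ?r k" "?r l"] l k r by (simp add: val_uminus)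
      moreover have "val X ?s = val_skel X (lcS X n (\<lambda>i. k i \<ominus>\<^bsub>K\<^esub> l i) (\<lambda>i. pi_skel X (w i)))"
        using pi_lc[OF sep, of "\<lambda>i. k i \<ominus>\<^bsub>K\<^esub> l i"] kl w s by (metis R.minus_closed val_pi)
      ultimately show "val X (?r k) \<in> ?F"
        using val_lcS[of "\<lambda>i. k i \<ominus>\<^bsub>K\<^esub> l i" "\<lambda>i. pi_skel X (w i)" n] kl w by simp
    qed
    then have "finite ?S" by (rule finite_subset) simp
    moreover have "(\<lambda>i. \<zero>\<^bsub>K\<^esub>) \<in> ?KK" by simp
    then have "?S \<noteq> {}" by blast
    moreover have "?S \<subseteq> val_chain X" using r by auto
    ultimately show False using finite_maximal[of ?S] * by blast
  qed
  then obtain k where k: "\<And>i. k i \<in> carrier K" and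
    max: "\<And>l. (\<And>i. l i \<in> carrier K) \<Longrightarrow> \<not> val X (?r k) \<sqsubset> val X (?r l)" by blast
  define x where "x = ?r k"
  have x: "x \<in> carrier V" using r k by (simp add: x_def)
  let ?w = "w(n := x)"
  have wc: "?w i \<in> carrier V" for i using w x by simp
  have low: "lc X n l ?w = lc X n l w" for l by (rule lc_cong) simp
  have "separated X n (\<lambda>i. pi_skel X (?w i)) = separated X n (\<lambda>i. pi_skel X (w i))"
    by (rule separated_cong) simp
  then have sep': "separated X n (\<lambda>i. pi_skel X (?w i))" using sep by simp
  have "in_pi X (lcS X (Suc n) l (\<lambda>i. pi_skel X (?w i)))" if l: "\<And>i. l i \<in> carrier K" for l
  proof -
    let ?s = "lc X n l w" and ?y = "l n \<odot>\<^bsub>V\<^esub> x"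
    have s: "?s \<in> carrier V" "?y \<in> carrier V" using l w x by simp_all
    have "lcS X n l (\<lambda>i. pi_skel X (?w i)) = pi_skel X ?s"
      using pi_lc[OF sep' l wc] unfolding low by (rule sym)
    then have "lcS X (Suc n) l (\<lambda>i. pi_skel X (?w i)) = bplus X (pi_skel X ?s) (pi_skel X ?y)"
      using l x by (simp add: kmul_pi)
    also have "\<dots> = pi_skel X (?s \<oplus>\<^bsub>V\<^esub> ?y)"
    proof (rule bplus_pi[OF s], rule notI)
      assume eq: "val X ?s = val X ?y" and less: "val X ?s \<sqsubset> val X (?s \<oplus>\<^bsub>V\<^esub> ?y)"
      have nz: "l n \<noteq> \<zero>\<^bsub>K\<^esub>"
      proof
        assume "l n = \<zero>\<^bsub>K\<^esub>"
        then show False using less s x irrefl by simp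
      qed
      \<comment> \<open>After division by \<open>l n\<close> the sum becomes another residue of
        \<open>v\<close>, with coefficients k - a l. Its value is that of the cancelled sum, thus
        above \<open>val X x\<close>, against the maximality of \<open>x\<close>.\<close>
      define a where "a = inv\<^bsub>K\<^esub> (l n)"
      have a: "a \<in> carrier K" "a \<otimes>\<^bsub>K\<^esub> l n = \<one>\<^bsub>K\<^esub>"
        using nz l[of n] by (simp_all add: a_def R.field_Units)
      then have "a \<noteq> \<zero>\<^bsub>K\<^esub>" using l[of n] by auto
      then have "val X (a \<odot>\<^bsub>V\<^esub> (?s \<oplus>\<^bsub>V\<^esub> ?y)) = val X (?s \<oplus>\<^bsub>V\<^esub> ?y)"
        using val_smult a s by simp
      moreover have "a \<odot>\<^bsub>V\<^esub> (?s \<oplus>\<^bsub>V\<^esub> ?y) = lc X n (\<lambda>i. a \<otimes>\<^bsub>K\<^esub> l i) w \<oplus>\<^bsub>V\<^esub> x"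
        using a s l w x by (simp add: smult_r_distr lc_smult flip: smult_assoc1)
      moreover have "\<dots> = ?r (\<lambda>i. k i \<ominus>\<^bsub>K\<^esub> a \<otimes>\<^bsub>K\<^esub> l i)"
        using a l w v k by (subst lc_minus) (simp_all add: x_def a_minus_def M.minus_add M.a_ac)
      moreover have "val X ?s = val X x" using eq val_smult[of "l n" x] nz l x by simp
      ultimately have "val X (?r k) \<sqsubset> val X (?r (\<lambda>i. k i \<ominus>\<^bsub>K\<^esub> a \<otimes>\<^bsub>K\<^esub> l i))"
        using less by (simp add: x_def)
      then show False using max[of "\<lambda>i. k i \<ominus>\<^bsub>K\<^esub> a \<otimes>\<^bsub>K\<^esub> l i"] a k l by simp
    qed
    finally show ?thesis using s by simp
  qed
  then have "separated X (Suc n) (\<lambda>i. pi_skel X (?w i))" using sep' x by simp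
  moreover have "v = lc X n k w \<oplus>\<^bsub>V\<^esub> x" using minus_add[of v "lc X n k w"] v k w by (simp add: x_def M.a_comm)
  ultimately show ?thesis using that k x by blast
qed

lemma lc_span:
  assumes "\<And>i. i < n \<Longrightarrow> \<exists>a. (\<forall>j. a j \<in> carrier K) \<and> w i = lc X m a v"
    "\<And>i. k i \<in> carrier K" "\<And>i. v i \<in> carrier V"
  shows "\<exists>a. (\<forall>j. a j \<in> carrier K) \<and> lc X n k w = lc X m a v"
  using assms(1)
proof (induction n)
  case 0
  show ?case using assms(3) lc_trivial[of m "\<lambda>_. \<zero>\<^bsub>K\<^esub>" v] by (intro exI[of _ "\<lambda>_. \<zero>\<^bsub>K\<^esub>"]) simp
next
  case (Suc n)
  then obtain a where a: "\<And>j. a j \<in> carrier K" "lc X n k w = lc X m a v" by auto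
  from Suc.prems[of n] obtain b where b: "\<And>j. b j \<in> carrier K" "w n = lc X m b v" by auto
  have "lc X (Suc n) k w = lc X m (\<lambda>i. a i \<oplus>\<^bsub>K\<^esub> k n \<otimes>\<^bsub>K\<^esub> b i) v"
    using a b assms(2,3) by (simp add: lc_add lc_smult)
  then show ?case using a b assms(2) by (intro exI[of _ "\<lambda>i. a i \<oplus>\<^bsub>K\<^esub> k n \<otimes>\<^bsub>K\<^esub> b i"]) simp
qed

text \<open>Iteration of \<open>separated_extend\<close> along \<open>v\<close>. A new member may be
  zero, so the family keeps exactly \<open>n\<close> members and both matrices are n by n, whatever
  the dimension of the span.\<close>

lemma separated_basis:
  assumes v: "\<And>i. v i \<in> carrier V"
  obtains w A B where "\<And>i. w i \<in> carrier V" "separated X n (\<lambda>i. pi_skel X (w i))"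
    "\<And>i j. A i j \<in> carrier K" "\<And>i j. B i j \<in> carrier K"
    "\<And>i. i < n \<Longrightarrow> w i = lc X n (A i) v" "\<And>i. i < n \<Longrightarrow> v i = lc X n (B i) w"
proof -
  have "\<exists>w. (\<forall>i. w i \<in> carrier V) \<and> separated X n (\<lambda>i. pi_skel X (w i)) \<and>
    (\<forall>i<n. (\<exists>a. (\<forall>j. a j \<in> carrier K) \<and> w i = lc X n a v) \<and> (\<exists>a. (\<forall>j. a j \<in> carrier K) \<and> v i = lc X n a w))"
  proof (induction n)
    case 0
    show ?case by (intro exI[of _ "\<lambda>_. \<zero>\<^bsub>V\<^esub>"]) simp
  next
    case (Suc n)
    then obtain w where w: "\<And>i. w i \<in> carrier V" and sep: "separated X n (\<lambda>i. pi_skel X (w i))"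
      and A: "\<And>i. i < n \<Longrightarrow> \<exists>a. (\<forall>j. a j \<in> carrier K) \<and> w i = lc X n a v"
      and B: "\<And>i. i < n \<Longrightarrow> \<exists>a. (\<forall>j. a j \<in> carrier K) \<and> v i = lc X n a w" by blast
    obtain k x where k: "\<And>i. k i \<in> carrier K" and x: "x \<in> carrier V" "v n = lc X n k w \<oplus>\<^bsub>V\<^esub> x"
      "separated X (Suc n) (\<lambda>i. pi_skel X ((w(n := x)) i))"
      using separated_extend[OF sep w v[of n]] by blast
    let ?w = "w(n := x)"
    have low: "lc X n a ?w = lc X n a w" for a by (rule lc_cong) simp
    have up: "lc X (Suc n) (a(n := c)) u = lc X n a u \<oplus>\<^bsub>V\<^esub> c \<odot>\<^bsub>V\<^esub> u n" for a c u
      using lc_cong[of n "a(n := c)" a u u X] by simp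
    have "\<exists>a. (\<forall>j. a j \<in> carrier K) \<and> ?w i = lc X (Suc n) a v" if "i < Suc n" for i
    proof (cases "i = n")
      case False
      with that have "i < n" by simp
      from A[OF this] obtain a where a: "\<And>j. a j \<in> carrier K" "w i = lc X n a v" by blast
      then show ?thesis using False v by (intro exI[of _ "a(n := \<zero>\<^bsub>K\<^esub>)"]) (simp add: up del: lc.simps)
    next
      case True
      \<comment> \<open>The new row of A comes from x = v n - lc k w: the old members in lc k w are
        rewritten in terms of \<open>v\<close>, so its entries are -a, followed by one.\<close>
      obtain a where a: "\<And>j. a j \<in> carrier K" "lc X n k w = lc X n a v" using lc_span[of n w n v k] A k v by blast
      have "x = \<ominus>\<^bsub>V\<^esub> lc X n a v \<oplus>\<^bsub>V\<^esub> v n" using x a v by (simp add: M.r_neg1)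
      then show ?thesis using True a v
        by (intro exI[of _ "(\<lambda>j. \<ominus>\<^bsub>K\<^esub> a j)(n := \<one>\<^bsub>K\<^esub>)"]) (simp add: up lc_uminus del: lc.simps)
    qed
    moreover have "\<exists>a. (\<forall>j. a j \<in> carrier K) \<and> v i = lc X (Suc n) a ?w" if "i < Suc n" for i
    proof (cases "i = n")
      case False
      with that have "i < n" by simp
      from B[OF this] obtain a where a: "\<And>j. a j \<in> carrier K" "v i = lc X n a w" by blast
      then show ?thesis using w x by (intro exI[of _ "a(n := \<zero>\<^bsub>K\<^esub>)"]) (simp add: up low del: lc.simps)
    next
      case True
      then show ?thesis using k w x by (intro exI[of _ "k(n := \<one>\<^bsub>K\<^esub>)"]) (simp add: up low del: lc.simps)
    qed
    moreover have "?w i \<in> carrier V" for i using w x by simp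
    ultimately show ?case using x(3) by (intro exI[of _ ?w]) blast
  qed
  then obtain w where w: "\<forall>i. w i \<in> carrier V" "separated X n (\<lambda>i. pi_skel X (w i))"
    "\<forall>i<n. \<exists>a. (\<forall>j. a j \<in> carrier K) \<and> w i = lc X n a v"
    "\<forall>i<n. \<exists>a. (\<forall>j. a j \<in> carrier K) \<and> v i = lc X n a w" by blast
  have "\<exists>a. (\<forall>j. a j \<in> carrier K) \<and> (i < n \<longrightarrow> w i = lc X n a v)" for i
    using w(3) by (cases "i < n") (blast, auto intro: exI[of _ "\<lambda>_. \<zero>\<^bsub>K\<^esub>"])
  then obtain A where A: "\<And>i j. A i j \<in> carrier K" "\<And>i. i < n \<Longrightarrow> w i = lc X n (A i) v" by metis
  have "\<exists>a. (\<forall>j. a j \<in> carrier K) \<and> (i < n \<longrightarrow> v i = lc X n a w)" for i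
    using w(4) by (cases "i < n") (blast, auto intro: exI[of _ "\<lambda>_. \<zero>\<^bsub>K\<^esub>"])
  then obtain B where B: "\<And>i j. B i j \<in> carrier K" "\<And>i. i < n \<Longrightarrow> v i = lc X n (B i) w" by metis
  show ?thesis using that[of w A B] w A B by blast
qed

end

section \<open>Valued vector spaces as structures\<close>

lemma vvs_struct_simps [simp]:
  "univ (vvs_struct X) = vvs_dom X" "fint (vvs_struct X) = vvs_fint X"
  "rint (vvs_struct X) r as \<longleftrightarrow> (un_gam (as ! 0), un_gam (as ! 1)) \<in> val_less X"
  by (simp_all add: vvs_struct_def)

lemma mk_lang_simps [simp]:
  "sorts (mk_lang Ss Fs) = Ss" "funs (mk_lang Ss Fs) = Fs" "rels (mk_lang Ss Fs) = {Less}"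
  "fdom (mk_lang Ss Fs) = fsym_dom" "fcod (mk_lang Ss Fs) = fsym_cod" "rdom (mk_lang Ss Fs) = (\<lambda>r. [GG, GG])"
  by (simp_all add: mk_lang_def)

definition env_ok :: "('k, 'v, 'g) vvs \<Rightarrow> srt set \<Rightarrow> (srt \<times> nat \<Rightarrow> ('k, 'v, 'g) elem) \<Rightarrow> bool" where
  "env_ok X Ss e \<longleftrightarrow> (\<forall>s\<in>Ss. \<forall>n. e (s, n) \<in> vvs_dom X s)"

lemma env_okD: "env_ok X Ss e \<Longrightarrow> s \<in> Ss \<Longrightarrow> e (s, n) \<in> vvs_dom X s"
  by (simp add: env_ok_def)

context valued
begin

abbreviation "M \<equiv> vvs_struct X"

lemma fint_in_dom:
  assumes "list_all2 (\<lambda>s a. a \<in> vvs_dom X s) (fsym_dom f) as"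
    "\<And>k. f = ScalAt k \<or> f = ScalSAt k \<Longrightarrow> k \<in> carrier K"
  shows "vvs_fint X f as \<in> vvs_dom X (fsym_cod f)"
proof (cases f)
  case Top
  have "top_val X \<in> val_chain X" using val_chain[of "\<zero>\<^bsub>V\<^esub>"] by simp
  then show ?thesis by (simp add: Top)
qed (use assms in \<open>auto simp: list_all2_Cons1\<close>)

lemma tm_in_dom:
  assumes "wf_tm (mk_lang Ss Fs) t" "env_ok X Ss e"
    "\<And>k. ScalAt k \<in> Fs \<or> ScalSAt k \<in> Fs \<Longrightarrow> k \<in> carrier K"
  shows "tm_val M e t \<in> vvs_dom X (tm_sort (mk_lang Ss Fs) t)"
  using assms(1)
proof (induction t)
  case (Var s n)
  then show ?case using assms(2) by (simp add: env_ok_def)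
next
  case (App f ts)
  then have "fsym_dom f = map (tm_sort (mk_lang Ss Fs)) ts" "f \<in> Fs"
    "\<And>t. t \<in> set ts \<Longrightarrow> tm_val M e t \<in> vvs_dom X (tm_sort (mk_lang Ss Fs) t)" by auto
  then have "list_all2 (\<lambda>s a. a \<in> vvs_dom X s) (fsym_dom f) (map (tm_val M e) ts)"
    by (simp add: list_all2_conv_all_nth)
  then have "vvs_fint X f (map (tm_val M e) ts) \<in> vvs_dom X (fsym_cod f)"
    by (rule fint_in_dom) (use assms(3) \<open>f \<in> Fs\<close> in blast)
  then show ?case by simp
qed

end

subsection \<open>Guarded terms\<close>

text \<open>Whether \<open>bplus\<close> is given by its first argument, its second argument or their sum depends on the
  structure, so a term over the skeleton is represented by a list of terms with guards, of which at
  least one holds and all of which that hold give the same value.\<close>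

type_synonym 'k guarded = "((srt, 'k fsym, rsym) fm \<times> (srt, 'k fsym) tm) list"

abbreviation "tZeroS \<equiv> App ZeroS []"
abbreviation "tValS s \<equiv> App ValS [s]"
abbreviation "tAddS s t \<equiv> App AddS [s, t]"
text \<open>The syntax has no constant for truth; \<open>ZeroS\<close> belongs to all four languages
  in use.\<close>

abbreviation "Tru \<equiv> Eq tZeroS tZeroS"
abbreviation "lessS s t \<equiv> Rel Less [tValS s, tValS t]"

definition fm_in_pi :: "(srt, 'k fsym) tm \<Rightarrow> (srt, 'k fsym, rsym) fm" where
  "fm_in_pi s = Disj (Neg (Eq (tAddS s s) s)) (Eq s tZeroS)"

fun Conjs :: "(srt, 'k fsym, 'r) fm list \<Rightarrow> (srt, 'k fsym, 'r) fm" where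
  "Conjs [] = Tru"
| "Conjs (p # ps) = Conj p (Conjs ps)"

definition Disjs :: "(srt, 'k fsym, rsym) fm list \<Rightarrow> (srt, 'k fsym, rsym) fm" where
  "Disjs ps = Neg (Conjs (map Neg ps))"

definition gany :: "((srt, 'k fsym) tm \<Rightarrow> (srt, 'k fsym, rsym) fm) \<Rightarrow> 'k guarded \<Rightarrow> (srt, 'k fsym, rsym) fm" where
  "gany F gs = Disjs (map (\<lambda>(G, s). Conj G (F s)) gs)"

definition gbind :: "'k guarded \<Rightarrow> ((srt, 'k fsym) tm \<Rightarrow> 'k guarded) \<Rightarrow> 'k guarded" where
  "gbind gs f = concat (map (\<lambda>(G, s). map (\<lambda>(H, t). (Conj G H, t)) (f s)) gs)"

definition gret :: "(srt, 'k fsym) tm \<Rightarrow> 'k guarded" where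
  "gret s = [(Tru, s)]"

definition guarded_bplus :: "'k guarded \<Rightarrow> 'k guarded \<Rightarrow> 'k guarded" where
  "guarded_bplus gs hs = gbind gs (\<lambda>s. gbind hs (\<lambda>t.
     [(lessS s t, s), (lessS t s, t), (Conj (Neg (lessS s t)) (Neg (lessS t s)), tAddS s t)]))"

definition guarded_kmul :: "(srt, 'k fsym) tm \<Rightarrow> (srt, 'k fsym) tm \<Rightarrow> 'k guarded" where
  "guarded_kmul k s = [(Eq k (App ZeroK []), tZeroS), (Neg (Eq k (App ZeroK [])), App ScalS [k, s])]"

fun guarded_lc :: "nat \<Rightarrow> (nat \<Rightarrow> (srt, 'k fsym) tm) \<Rightarrow> (nat \<Rightarrow> (srt, 'k fsym) tm) \<Rightarrow> 'k guarded" where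
  "guarded_lc 0 P C = gret tZeroS"
| "guarded_lc (Suc n) P C = guarded_bplus (guarded_lc n P C) (guarded_kmul (P n) (C n))"

lemma sat_Conjs [simp]: "sat M e (Conjs ps) \<longleftrightarrow> (\<forall>p\<in>set ps. sat M e p)"
  by (induction ps) auto

lemma sat_Disjs [simp]: "sat M e (Disjs ps) \<longleftrightarrow> (\<exists>p\<in>set ps. sat M e p)"
  by (auto simp: Disjs_def)

definition gval :: "(srt, 'k fsym, rsym, 'u) struct \<Rightarrow> (srt \<times> nat \<Rightarrow> 'u) \<Rightarrow> 'k guarded \<Rightarrow> 'u \<Rightarrow> bool" where
  "gval M e gs a \<longleftrightarrow> (\<exists>(G, s)\<in>set gs. sat M e G) \<and> (\<forall>(G, s)\<in>set gs. sat M e G \<longrightarrow> tm_val M e s = a)"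

text \<open>Some guard holds, and all terms whose guards hold have the same value, so it does not
  matter which of them the disjunction picks.\<close>

lemma sat_gany:
  assumes "gval M e gs a" "\<And>s. tm_val M e s = a \<Longrightarrow> sat M e (F s) \<longleftrightarrow> P"
  shows "sat M e (gany F gs) \<longleftrightarrow> P"
proof -
  have "sat M e (gany F gs) \<longleftrightarrow> (\<exists>(G, s)\<in>set gs. sat M e G \<and> sat M e (F s))"
    by (simp add: gany_def case_prod_beta)
  also have "\<dots> \<longleftrightarrow> (\<exists>(G, s)\<in>set gs. sat M e G \<and> P)"
    using assms unfolding gval_def by (intro bex_cong) auto
  also have "\<dots> \<longleftrightarrow> P" using assms(1) unfolding gval_def by blast
  finally show ?thesis .
qed

lemma gval_gret: "tm_val M e s = a \<Longrightarrow> gval M e (gret s) a"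
  by (simp add: gval_def gret_def)

lemma gval_gbind:
  assumes "gval M e gs a" "\<And>s. tm_val M e s = a \<Longrightarrow> gval M e (f s) b"
  shows "gval M e (gbind gs f) b"
proof -
  obtain G s where G: "(G, s) \<in> set gs" "sat M e G" using assms(1) by (auto simp: gval_def)
  then have "gval M e (f s) b" using assms by (auto simp: gval_def)
  then obtain H t where "(H, t) \<in> set (f s)" "sat M e H" by (auto simp: gval_def)
  with G have "(Conj G H, t) \<in> set (gbind gs f)" "sat M e (Conj G H)" by (force simp: gbind_def)+
  moreover have "tm_val M e u = b" if "(Q, u) \<in> set (gbind gs f)" "sat M e Q" for Q u
  proof -
    obtain G s H where *: "(G, s) \<in> set gs" "(H, u) \<in> set (f s)" "Q = Conj G H"
      using \<open>(Q, u) \<in> set (gbind gs f)\<close> by (auto simp: gbind_def)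
    then have "gval M e (f s) b" using assms \<open>sat M e Q\<close> by (auto simp: gval_def)
    then show ?thesis using * \<open>sat M e Q\<close> by (auto simp: gval_def)
  qed
  ultimately show ?thesis unfolding gval_def by blast
qed

definition gwf :: "(srt, 'k fsym, rsym) lang \<Rightarrow> srt \<Rightarrow> 'k guarded \<Rightarrow> bool" where
  "gwf L s gs \<longleftrightarrow> (\<forall>(G, t)\<in>set gs. wf_fm L G \<and> wf_tm L t \<and> tm_sort L t = s)"

lemma gwf_gbind:
  "gwf L s gs \<Longrightarrow> (\<And>t. wf_tm L t \<Longrightarrow> tm_sort L t = s \<Longrightarrow> gwf L s' (f t)) \<Longrightarrow> gwf L s' (gbind gs f)"
proof -
  assume *: "gwf L s gs" "\<And>t. wf_tm L t \<Longrightarrow> tm_sort L t = s \<Longrightarrow> gwf L s' (f t)"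
  show ?thesis unfolding gwf_def
  proof clarify
    fix Q u assume "(Q, u) \<in> set (gbind gs f)"
    then obtain G t H where G: "(G, t) \<in> set gs" "(H, u) \<in> set (f t)" "Q = Conj G H"
      by (auto simp: gbind_def)
    then have "wf_fm L G" "wf_tm L t" "tm_sort L t = s" using *(1) by (auto simp: gwf_def)
    moreover from this have "wf_fm L H \<and> wf_tm L u \<and> tm_sort L u = s'"
      using *(2)[of t] G(2) by (auto simp: gwf_def)
    ultimately show "wf_fm L Q \<and> wf_tm L u \<and> tm_sort L u = s'" using G(3) by simp
  qed
qed

lemma wf_Conjs [simp]: "wf_fm L (Conjs ps) \<longleftrightarrow> wf_fm L Tru \<and> (\<forall>p\<in>set ps. wf_fm L p)"
  by (induction ps) auto

lemma wf_Disjs [simp]: "wf_fm L (Disjs ps) \<longleftrightarrow> wf_fm L Tru \<and> (\<forall>p\<in>set ps. wf_fm L p)"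
  by (auto simp: Disjs_def)

lemma wf_gany:
  "wf_fm L Tru \<Longrightarrow> gwf L s gs \<Longrightarrow> (\<And>t. wf_tm L t \<Longrightarrow> tm_sort L t = s \<Longrightarrow> wf_fm L (F t)) \<Longrightarrow> wf_fm L (gany F gs)"
  unfolding gwf_def gany_def by auto

lemma sat_fm_in_pi: "tm_val (vvs_struct X) e s = Ske a \<Longrightarrow> sat (vvs_struct X) e (fm_in_pi s) \<longleftrightarrow> in_pi X a"
  by (simp add: fm_in_pi_def in_pi_def)

text \<open>The last hypothesis is asymmetry of the order at these two values: otherwise the guards
  of \<open>s\<close> and of \<open>t\<close> could hold together for different classes.\<close>

lemma gval_guarded_bplus:
  assumes "gval (vvs_struct X) e gs (Ske a)" "gval (vvs_struct X) e hs (Ske b)"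
    "\<not> ((val_skel X a, val_skel X b) \<in> val_less X \<and> (val_skel X b, val_skel X a) \<in> val_less X)"
  shows "gval (vvs_struct X) e (guarded_bplus gs hs) (Ske (bplus X a b))"
  unfolding guarded_bplus_def
  by (intro gval_gbind[OF assms(1)] gval_gbind[OF assms(2)]) (use assms(3) in \<open>auto simp: gval_def bplus_def\<close>)

lemma gval_guarded_kmul:
  "tm_val (vvs_struct X) e k = Sca c \<Longrightarrow> tm_val (vvs_struct X) e s = Ske a \<Longrightarrow>
    gval (vvs_struct X) e (guarded_kmul k s) (Ske (kmul X c a))"
  by (auto simp: gval_def guarded_kmul_def kmul_def)

lemma gval_guarded_lc:
  assumes "valued_vector_space X"
    "\<And>i. i < n \<Longrightarrow> tm_val (vvs_struct X) e (P i) = Sca (k i) \<and> tm_val (vvs_struct X) e (C i) = Ske (c i)"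
  shows "gval (vvs_struct X) e (guarded_lc n P C) (Ske (lcS X n k c))"
  using assms(2)
proof (induction n)
  case 0
  show ?case by (simp add: gval_gret)
next
  case (Suc n)
  interpret valued X by (unfold_locales) (rule assms(1))
  have "gval (vvs_struct X) e (guarded_lc n P C) (Ske (lcS X n k c))" using Suc by simp
  moreover have "gval (vvs_struct X) e (guarded_kmul (P n) (C n)) (Ske (kmul X (k n) (c n)))"
    using Suc.prems[of n] by (intro gval_guarded_kmul) simp_all
  ultimately show ?case unfolding guarded_lc.simps lcS.simps
    by (rule gval_guarded_bplus) (use irrefl less_trans in blast)
qed

section \<open>Variable base field\<close>

text \<open>In the translated formula, the variable \<open>n\<close> of the original becomes \<open>2n\<close>. The odd skeleton
  variable \<open>2i + 1\<close> stands for \<open>\<pi>(w\<^sub>i)\<close>, where \<open>w\<close> is the current separated family, and the odd scalar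
  variable \<open>coef_index j i\<close> for the coefficient at \<open>w\<^sub>i\<close> of the vector variable \<open>j\<close>. Only the first
  \<open>r j\<close> coefficients of \<open>j\<close> are in use: \<open>w\<close> may have grown since \<open>j\<close> was bound.\<close>

definition coef_index :: "nat \<Rightarrow> nat \<Rightarrow> nat" where
  "coef_index j i = Suc (2 * prod_encode (j, i))"

lemma odd_neq [simp]: "Suc (2 * m) \<noteq> 2 * n" "2 * n \<noteq> Suc (2 * m)"
  using double_not_eq_Suc_double[of n m] Suc_double_not_eq_double[of m n] by simp_all

lemma coef_index_eq_iff [simp]: "coef_index j i = coef_index j' i' \<longleftrightarrow> j = j' \<and> i = i'"
  by (simp add: coef_index_def)

lemma coef_index_neq [simp]: "coef_index j i \<noteq> 2 * n" "2 * n \<noteq> coef_index j i"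
  unfolding coef_index_def by (rule odd_neq)+

abbreviation "skel_var i \<equiv> Var SS (Suc (2 * i))"

fun scalar_tm :: "(srt, 'k fsym) tm \<Rightarrow> (srt, 'k fsym) tm" where
  "scalar_tm (Var s n) = Var s (2 * n)"
| "scalar_tm (App f ts) = App f (map scalar_tm ts)"

text \<open>A term of sort \<open>VV\<close> is built from vector variables by \<open>AddV\<close>,
  \<open>ZeroV\<close> and \<open>Scal\<close>, and the scalar arguments of \<open>Scal\<close>
  contain no vectors. So its coordinate at each member of the family is a scalar term.\<close>

fun coef_tm :: "(nat \<Rightarrow> nat) \<Rightarrow> (srt, 'k fsym) tm \<Rightarrow> nat \<Rightarrow> (srt, 'k fsym) tm" where
  "coef_tm r (Var s j) i = (if i < r j then Var KK (coef_index j i) else App ZeroK [])"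
| "coef_tm r (App f ts) i = (let us = map (\<lambda>t. coef_tm r t i) ts in
     case f of AddV \<Rightarrow> App AddK us | Scal \<Rightarrow> App MulK [scalar_tm (ts ! 0), us ! 1] | _ \<Rightarrow> App ZeroK [])"

text \<open>For terms of the sorts other than \<open>VV\<close>. Vectors enter them only below
  \<open>PiS\<close> and \<open>Val\<close>, where the class is assembled from coordinates by
  \<open>guarded_lc\<close>. \<open>Top\<close> is not a symbol of \<open>skel_lang\<close> and is
  written as the value of the zero class.\<close>

fun guarded_tm :: "nat \<Rightarrow> (nat \<Rightarrow> nat) \<Rightarrow> (srt, 'k fsym) tm \<Rightarrow> 'k guarded" where
  "guarded_tm N r (Var s n) = gret (Var s (2 * n))"
| "guarded_tm N r (App f ts) = (let us = map (guarded_tm N r) ts in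
     case f of
       AddS \<Rightarrow> gbind (us ! 0) (\<lambda>s. gbind (us ! 1) (\<lambda>t. gret (tAddS s t)))
     | ScalS \<Rightarrow> gbind (us ! 1) (\<lambda>s. gret (App ScalS [scalar_tm (ts ! 0), s]))
     | ValS \<Rightarrow> gbind (us ! 0) (\<lambda>s. gret (tValS s))
     | Top \<Rightarrow> gret (tValS tZeroS)
     | PiS \<Rightarrow> guarded_lc N (coef_tm r (ts ! 0)) skel_var
     | Val \<Rightarrow> gbind (guarded_lc N (coef_tm r (ts ! 0)) skel_var) (\<lambda>s. gret (tValS s))
     | _ \<Rightarrow> gret (App f (map scalar_tm ts)))"

text \<open>The doubly negated existential block is the universal quantifier over scalars. Its
  variables 0, ..., n may coincide with scalar variables used elsewhere; this is harmless, because
  every scalar variable of the formula is bound and only skeleton variables are free.\<close>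

fun fm_separated :: "nat \<Rightarrow> (srt, 'k fsym, rsym) fm" where
  "fm_separated 0 = Tru"
| "fm_separated (Suc n) = Conj (Conj (fm_separated n) (fm_in_pi (skel_var n)))
     (Neg (Exis (map (Pair KK) [0..<Suc n]) (Neg (gany fm_in_pi (guarded_lc (Suc n) (Var KK) skel_var)))))"

text \<open>A vector quantifier becomes a quantifier over the class of one more member of the family
  and over \<open>Suc N\<close> coefficients of the new vector; by \<open>separated_extend\<close>
  this reaches every vector. Older coefficients of \<open>n\<close> may be overwritten, since
  \<open>n\<close> is bound again.\<close>

fun translate :: "nat \<Rightarrow> (nat \<Rightarrow> nat) \<Rightarrow> (srt, 'k fsym, rsym) fm \<Rightarrow> (srt, 'k fsym, rsym) fm" where
  "translate N r (Eq t u) = (if tm_sort L_S t = VV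
     then Conjs (map (\<lambda>i. Disj (Eq (coef_tm r t i) (coef_tm r u i)) (Eq (skel_var i) tZeroS)) [0..<N])
     else gany (\<lambda>s. gany (Eq s) (guarded_tm N r u)) (guarded_tm N r t))"
| "translate N r (Rel R ts) = gany (\<lambda>s. gany (\<lambda>s'. Rel R [s, s']) (guarded_tm N r (ts ! 1))) (guarded_tm N r (ts ! 0))"
| "translate N r (Neg p) = Neg (translate N r p)"
| "translate N r (Conj p q) = Conj (translate N r p) (translate N r q)"
| "translate N r (Exi s n p) = (if s = VV
     then Exis ((SS, Suc (2 * N)) # map (\<lambda>i. (KK, coef_index n i)) [0..<Suc N])
       (Conj (fm_separated (Suc N)) (translate (Suc N) (r(n := Suc N)) p))
     else Exi s (2 * n) (translate N r p))"

section \<open>The translation lands in the language of the skeleton\<close>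

lemma skel_lang_simps [simp]:
  "sorts skel_lang = {SS, GG, KK}" "fcod skel_lang = fsym_cod" "fdom skel_lang = fsym_dom"
  "rels skel_lang = {Less}" "rdom skel_lang = (\<lambda>r. [GG, GG])"
  "funs skel_lang = {AddS, ZeroS, AddK, MulK, ZeroK, OneK, ScalS, ValS}"
  by (simp_all add: skel_lang_def)

lemma L_S_simps [simp]:
  "sorts L_S = {VV, KK, GG, SS}" "fcod L_S = fsym_cod" "fdom L_S = fsym_dom"
  "rels L_S = {Less}" "rdom L_S = (\<lambda>r. [GG, GG])"
  "funs L_S = {AddV, ZeroV, AddK, MulK, ZeroK, OneK, Top, Scal, Val, AddS, ZeroS, ScalS, ValS, PiS}"
  by (simp_all add: L_S_def)

lemma gwf_guarded_lc:
  assumes "\<And>i. i < n \<Longrightarrow> wf_tm skel_lang (P i) \<and> tm_sort skel_lang (P i) = KK"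
    "\<And>i. i < n \<Longrightarrow> wf_tm skel_lang (C i) \<and> tm_sort skel_lang (C i) = SS"
  shows "gwf skel_lang SS (guarded_lc n P C)"
  using assms
proof (induction n)
  case 0
  show ?case by (simp add: gwf_def gret_def)
next
  case (Suc n)
  have "gwf skel_lang SS (guarded_kmul (P n) (C n))" using Suc.prems[of n] by (simp add: gwf_def guarded_kmul_def)
  moreover have "gwf skel_lang SS (guarded_lc n P C)" using Suc by simp
  ultimately show ?case unfolding guarded_lc.simps guarded_bplus_def
    by (intro gwf_gbind[where s = SS and gs = "guarded_lc n P C"] gwf_gbind[where s = SS and gs = "guarded_kmul (P n) (C n)"])
       (auto simp: gwf_def)
qed

lemma wf_fm_in_pi: "wf_tm skel_lang s \<Longrightarrow> tm_sort skel_lang s = SS \<Longrightarrow> wf_fm skel_lang (fm_in_pi s)"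
  by (simp add: fm_in_pi_def)

lemma wf_fm_separated: "wf_fm skel_lang (fm_separated n)"
proof (induction n)
  case (Suc n)
  have "wf_fm skel_lang (gany fm_in_pi (guarded_lc (Suc n) (Var KK) skel_var))"
    by (rule wf_gany[where s = SS]) (auto intro!: gwf_guarded_lc wf_fm_in_pi simp del: guarded_lc.simps)
  moreover have "wf_fm skel_lang (fm_in_pi (skel_var n))" by (rule wf_fm_in_pi) simp_all
  ultimately show ?case using Suc by (auto simp add: wf_Exis simp del: guarded_lc.simps)
qed simp

lemma wf_scalar_tm:
  assumes "wf_tm L_S t" "tm_sort L_S t = KK"
  shows "wf_tm skel_lang (scalar_tm t) \<and> tm_sort skel_lang (scalar_tm t) = KK"
  using assms
proof (induction t)
  case (App f ts)
  then show ?case by (cases f) (auto simp: map_eq_Cons_conv)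
qed simp

lemma wf_coef_tm:
  assumes "wf_tm L_S t" "tm_sort L_S t = VV"
  shows "wf_tm skel_lang (coef_tm r t i) \<and> tm_sort skel_lang (coef_tm r t i) = KK"
  using assms
proof (induction t)
  case (App f ts)
  then show ?case by (cases f) (auto simp: map_eq_Cons_conv wf_scalar_tm)
qed simp

lemma gwf_guarded_tm:
  fixes t :: "(srt, 'k fsym) tm"
  assumes "wf_tm L_S t" "tm_sort L_S t \<noteq> VV"
  shows "gwf skel_lang (tm_sort L_S t) (guarded_tm N r t)"
  using assms
proof (induction t)
  case (Var s n)
  then show ?case by (auto simp: gwf_def gret_def)
next
  case (App f ts)
  have guarded_lc: "gwf skel_lang SS (guarded_lc N (coef_tm r t) skel_var)" if "wf_tm L_S t" "tm_sort L_S t = VV" for t :: "(srt, 'k fsym) tm"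
    using wf_coef_tm[OF that] by (intro gwf_guarded_lc) simp_all
  have ret: "gwf skel_lang s (gret t)" if "wf_tm skel_lang t" "tm_sort skel_lang t = s" for s and t :: "(srt, 'k fsym) tm"
    using that by (simp add: gwf_def gret_def)
  have IH: "gwf skel_lang SS (guarded_tm N r t)" if "t \<in> set ts" "tm_sort L_S t = SS" for t
    using App.IH[of t] App.prems(1) that by simp
  show ?case using App.prems IH
    by (cases f) (auto simp: map_eq_Cons_conv wf_scalar_tm intro!: ret guarded_lc gwf_gbind[where s = SS])
qed

lemma wf_translate: "wf_fm L_S p \<Longrightarrow> wf_fm skel_lang (translate N r p)"
proof (induction p arbitrary: N r)
  case (Eq t u)
  show ?case
  proof (cases "tm_sort L_S t = VV")
    case True
    then show ?thesis using Eq by (auto simp: wf_coef_tm)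
  next
    case False
    then have "gwf skel_lang (tm_sort L_S t) (guarded_tm N r t)" "gwf skel_lang (tm_sort L_S t) (guarded_tm N r u)"
      using Eq gwf_guarded_tm[of t N r] gwf_guarded_tm[of u N r] by simp_all
    then show ?thesis using False by (auto intro!: wf_gany[where s = "tm_sort L_S t"])
  qed
next
  case (Rel R ts)
  then show ?case using gwf_guarded_tm[of "ts ! 0" N r] gwf_guarded_tm[of "ts ! 1" N r]
    by (auto simp: map_eq_Cons_conv intro!: wf_gany[where s = GG])
next
  case (Exi s n p)
  then show ?case by (auto simp: wf_Exis wf_fm_separated simp del: fm_separated.simps upt.simps)
qed simp_all

section \<open>The translation preserves truth\<close>

context valued
begin

lemma sat_fm_separated:
  assumes "env_ok X {KK} e" "\<And>i. i < n \<Longrightarrow> e (SS, Suc (2 * i)) = Ske (c i)"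
  shows "sat M e (fm_separated n) \<longleftrightarrow> separated X n c"
  using assms(2)
proof (induction n)
  case (Suc n)
  let ?P = "gany fm_in_pi (guarded_lc (Suc n) (Var KK) skel_var)" and ?xs = "map (Pair KK) [0..<Suc n]"
  have P: "sat M e' ?P \<longleftrightarrow> in_pi X (lcS X (Suc n) k c)"
    if "\<And>i. i < Suc n \<Longrightarrow> e' (KK, i) = Sca (k i)" "\<And>x. x \<notin> set ?xs \<Longrightarrow> e' x = e x" for e' k
  proof (rule sat_gany)
    have "e' (SS, Suc (2 * i)) = Ske (c i)" if "i < Suc n" for i
      using \<open>\<And>x. x \<notin> set ?xs \<Longrightarrow> e' x = e x\<close>[of "(SS, Suc (2 * i))"] Suc.prems[OF that] by auto
    then show "gval M e' (guarded_lc (Suc n) (Var KK) skel_var) (Ske (lcS X (Suc n) k c))"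
      using that(1) by (intro gval_guarded_lc[OF X]) simp
  qed (rule sat_fm_in_pi)
  have "sat M e (Neg (Exis ?xs (Neg ?P))) \<longleftrightarrow>
      (\<forall>k. (\<forall>i. k i \<in> carrier K) \<longrightarrow> in_pi X (lcS X (Suc n) k c))" (is "?l \<longleftrightarrow> ?r")
  proof
    assume l: ?l
    show ?r
    proof (intro allI impI)
      fix k :: "nat \<Rightarrow> 'k" assume k: "\<forall>i. k i \<in> carrier K"
      define e' where "e' x = (if x \<in> set ?xs then Sca (k (snd x)) else e x)" for x
      have "sat M e' ?P"
      proof (rule ccontr)
        assume "\<not> sat M e' ?P"
        then have "sat M e (Exis ?xs (Neg ?P))"
          unfolding sat_Exis using k by (intro exI[of _ e']) (auto simp: e'_def)
        then show False using l by simp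
      qed
      moreover have "e' (KK, i) = Sca (k i)" if "i < Suc n" for i using that by (auto simp: e'_def)
      moreover have "e' x = e x" if "x \<notin> set ?xs" for x using that by (simp add: e'_def)
      ultimately show "in_pi X (lcS X (Suc n) k c)" using P by blast
    qed
  next
    assume r: ?r
    show ?l
    proof (rule ccontr)
      assume "\<not> ?l"
      then have "sat M e (Exis ?xs (Neg ?P))" by simp
      then obtain e' where e': "\<And>x. x \<notin> set ?xs \<Longrightarrow> e' x = e x" "\<forall>x\<in>set ?xs. e' x \<in> vvs_dom X (fst x)"
        "\<not> sat M e' ?P" unfolding sat_Exis by auto
      \<comment> \<open>\<open>separated\<close> quantifies over total scalar functions, so the
        finitely many chosen scalars are padded with zero.\<close>
      define k where "k i = (if i < Suc n then un_sca (e' (KK, i)) else \<zero>\<^bsub>K\<^esub>)" for i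
      have *: "e' (KK, i) \<in> Sca ` carrier K" if "i < Suc n" for i
      proof -
        have "(KK, i) \<in> set ?xs" using that by auto
        then show ?thesis using e'(2) by fastforce
      qed
      have "k i \<in> carrier K" for i
      proof (cases "i < Suc n")
        case True
        then show ?thesis using *[OF True] by (auto simp: k_def)
      qed (simp add: k_def)
      moreover have "e' (KK, i) = Sca (k i)" if "i < Suc n" for i using *[OF that] that by (force simp: k_def)
      ultimately show False using P[of e' k] e'(1,3) r by blast
    qed
  qed
  moreover have "sat M e (fm_in_pi (skel_var n)) \<longleftrightarrow> in_pi X (c n)"
    using Suc.prems[of n] by (intro sat_fm_in_pi) simp
  moreover have "sat M e (fm_separated n) \<longleftrightarrow> separated X n c" using Suc by simp
  ultimately show ?case unfolding fm_separated.simps separated.simps sat.simps(4) by blast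
qed simp

definition coef :: "(nat \<Rightarrow> nat) \<Rightarrow> (srt \<times> nat \<Rightarrow> ('k, 'v, 'g) elem) \<Rightarrow> nat \<Rightarrow> nat \<Rightarrow> 'k" where
  "coef r e j i = (if i < r j then un_sca (e (KK, coef_index j i)) else \<zero>\<^bsub>K\<^esub>)"

text \<open>The invariant relating an environment of the original formula to one of its translation,
  on the variables \<open>xs\<close>. Of the family \<open>w\<close>, the second environment records
  only the classes. This is why any vectors with these classes can serve in
  \<open>sat_translate\<close>.\<close>

definition encodes :: "nat \<Rightarrow> (nat \<Rightarrow> nat) \<Rightarrow> (nat \<Rightarrow> 'v) \<Rightarrow> (srt \<times> nat) set \<Rightarrow>
    (srt \<times> nat \<Rightarrow> ('k, 'v, 'g) elem) \<Rightarrow> (srt \<times> nat \<Rightarrow> ('k, 'v, 'g) elem) \<Rightarrow> bool" where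
  "encodes N r w xs e e' \<longleftrightarrow>
     (\<forall>i. w i \<in> carrier V) \<and> separated X N (\<lambda>i. pi_skel X (w i)) \<and> (\<forall>j. r j \<le> N) \<and>
     env_ok X {SS, GG, KK} e' \<and>
     (\<forall>i<N. e' (SS, Suc (2 * i)) = Ske (pi_skel X (w i))) \<and>
     (\<forall>s n. (s, n) \<in> xs \<longrightarrow> s \<noteq> VV \<longrightarrow> e' (s, 2 * n) = e (s, n)) \<and>
     (\<forall>j. (VV, j) \<in> xs \<longrightarrow> e (VV, j) = Vec (lc X N (coef r e' j) w))"

lemma encodes_mono: "encodes N r w xs e e' \<Longrightarrow> ys \<subseteq> xs \<Longrightarrow> encodes N r w ys e e'"
  by (auto simp: encodes_def)

lemma skel_tm_in_dom:
  "wf_tm skel_lang t \<Longrightarrow> env_ok X {SS, GG, KK} e \<Longrightarrow> tm_val M e t \<in> vvs_dom X (tm_sort skel_lang t)"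
  unfolding skel_lang_def by (rule tm_in_dom) auto

lemma tm_val_scalar_tm:
  assumes "wf_tm L_S t" "tm_sort L_S t = KK" "encodes N r w (fv_tm t) e e'"
  shows "tm_val M e' (scalar_tm t) = tm_val M e t"
  using assms
proof (induction t)
  case (Var s n)
  then show ?case by (simp add: encodes_def)
next
  case (App f ts)
  have "tm_val M e' (scalar_tm t) = tm_val M e t" if "t \<in> set ts" "tm_sort L_S t = KK" for t
    using that App.prems by (intro App.IH) (auto intro: encodes_mono)
  then show ?case using App.prems(1,2) by (cases f) (auto simp: map_eq_Cons_conv)
qed

lemma tm_val_coef_tm:
  assumes "wf_tm L_S t" "tm_sort L_S t = VV" "encodes N r w (fv_tm t) e e'"
  shows "tm_val M e t = Vec (lc X N (\<lambda>i. un_sca (tm_val M e' (coef_tm r t i))) w)"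
  using assms
proof (induction t)
  case (Var s n)
  then have "e (VV, n) = Vec (lc X N (coef r e' n) w)" by (simp add: encodes_def)
  moreover have "coef r e' n = (\<lambda>i. un_sca (tm_val M e' (coef_tm r (Var VV n) i)))"
    by (simp add: coef_def fun_eq_iff)
  ultimately show ?case using Var by simp
next
  case (App f ts)
  have IH: "tm_val M e t = Vec (lc X N (\<lambda>i. un_sca (tm_val M e' (coef_tm r t i))) w)"
    if "t \<in> set ts" "tm_sort L_S t = VV" for t
    using that App.prems by (intro App.IH) (auto intro: encodes_mono)
  have scalar_tm: "tm_val M e' (scalar_tm t) = tm_val M e t" if "t \<in> set ts" "tm_sort L_S t = KK" for t
    using that App.prems by (intro tm_val_scalar_tm) (auto intro: encodes_mono)
  have ok: "env_ok X {SS, GG, KK} e'" and w: "\<And>i. w i \<in> carrier V"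
    using App.prems(3) by (simp_all add: encodes_def)
  have dom: "un_sca (tm_val M e' (coef_tm r t i)) \<in> carrier K" if "t \<in> set ts" "tm_sort L_S t = VV" for t i
    using skel_tm_in_dom[OF _ ok, of "coef_tm r t i"] wf_coef_tm[of t r i] that App.prems(1) by auto
  have domK: "un_sca (tm_val M e' (scalar_tm t)) \<in> carrier K" if "t \<in> set ts" "tm_sort L_S t = KK" for t
    using skel_tm_in_dom[OF _ ok, of "scalar_tm t"] wf_scalar_tm[of t] that App.prems(1) by auto
  consider "f = AddV" | "f = Scal" | "f = ZeroV"
    using App.prems(1,2) by (cases f) auto
  then show ?case
  proof cases
    case 1
    then obtain a b where ts: "ts = [a, b]" "tm_sort L_S a = VV" "tm_sort L_S b = VV"
      using App.prems(1) by (auto simp: map_eq_Cons_conv)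
    then show ?thesis using 1 IH[of a] IH[of b] dom[of a] dom[of b] w
      by (simp add: lc_add)
  next
    case 2
    then obtain a b where ts: "ts = [a, b]" "tm_sort L_S a = KK" "tm_sort L_S b = VV"
      using App.prems(1) by (auto simp: map_eq_Cons_conv)
    then show ?thesis using 2 IH[of b] scalar_tm[of a] domK[of a] dom[of b] w
      by (simp add: lc_smult)
  next
    case 3
    then show ?thesis using lc_trivial[of N "\<lambda>_. \<zero>\<^bsub>K\<^esub>" w] w by simp
  qed
qed

text \<open>Separatedness enters here: \<open>pi_lc\<close> turns the class of a linear combination
  into a computation with classes, which \<open>guarded_lc\<close> writes down.\<close>

lemma gval_pi:
  assumes "wf_tm L_S t" "tm_sort L_S t = VV" "encodes N r w (fv_tm t) e e'"
  shows "gval M e' (guarded_lc N (coef_tm r t) skel_var) (Ske (pi_skel X (un_vec (tm_val M e t))))"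
    and "un_vec (tm_val M e t) \<in> carrier V"
proof -
  have enc: "env_ok X {SS, GG, KK} e'" "\<And>i. w i \<in> carrier V" "separated X N (\<lambda>i. pi_skel X (w i))"
    "\<And>i. i < N \<Longrightarrow> e' (SS, Suc (2 * i)) = Ske (pi_skel X (w i))"
    using assms(3) by (simp_all add: encodes_def)
  let ?k = "\<lambda>i. un_sca (tm_val M e' (coef_tm r t i))"
  have coef_tm: "tm_val M e' (coef_tm r t i) \<in> Sca ` carrier K" for i
    using skel_tm_in_dom[OF _ enc(1), of "coef_tm r t i"] wf_coef_tm[OF assms(1,2), of r i] by simp
  have k: "?k i \<in> carrier K" "tm_val M e' (coef_tm r t i) = Sca (?k i)" for i using coef_tm[of i] by force+
  have "gval M e' (guarded_lc N (coef_tm r t) skel_var) (Ske (lcS X N ?k (\<lambda>i. pi_skel X (w i))))"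
    by (rule gval_guarded_lc[OF X]) (use k(2) enc(4) in auto)
  also have "lcS X N ?k (\<lambda>i. pi_skel X (w i)) = pi_skel X (lc X N ?k w)"
    by (rule pi_lc[OF enc(3) k(1) enc(2), symmetric])
  finally show "gval M e' (guarded_lc N (coef_tm r t) skel_var) (Ske (pi_skel X (un_vec (tm_val M e t))))"
    using tm_val_coef_tm[OF assms] by simp
  show "un_vec (tm_val M e t) \<in> carrier V" using tm_val_coef_tm[OF assms] k(1) enc(2) by simp
qed

lemma gval_guarded_tm:
  assumes "wf_tm L_S t" "tm_sort L_S t \<noteq> VV" "encodes N r w (fv_tm t) e e'"
  shows "gval M e' (guarded_tm N r t) (tm_val M e t)"
  using assms
proof (induction t)
  case (Var s n)
  then show ?case by (auto simp: encodes_def intro!: gval_gret)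
next
  case (App f ts)
  have IH: "gval M e' (guarded_tm N r t) (tm_val M e t)" if "t \<in> set ts" "tm_sort L_S t \<noteq> VV" for t
    using that App.prems by (intro App.IH) (auto intro: encodes_mono)
  have scalar_tm: "tm_val M e' (scalar_tm t) = tm_val M e t" if "t \<in> set ts" "tm_sort L_S t = KK" for t
    using that App.prems by (intro tm_val_scalar_tm) (auto intro: encodes_mono)
  have pi: "gval M e' (guarded_lc N (coef_tm r t) skel_var) (Ske (pi_skel X (un_vec (tm_val M e t))))"
    "un_vec (tm_val M e t) \<in> carrier V"
    if "t \<in> set ts" "tm_sort L_S t = VV" for t
    using that App.prems by (intro gval_pi[of t N r w e e']; auto intro: encodes_mono)+
  show ?case
  proof (cases f)
    case AddS
    then obtain a b where ts: "ts = [a, b]" "tm_sort L_S a = SS" "tm_sort L_S b = SS"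
      using App.prems(1) by (auto simp: map_eq_Cons_conv)
    have "gval M e' (guarded_tm N r a) (tm_val M e a)" "gval M e' (guarded_tm N r b) (tm_val M e b)"
      using IH ts by simp_all
    then have "gval M e' (gbind (guarded_tm N r a) (\<lambda>s. gbind (guarded_tm N r b) (\<lambda>t. gret (tAddS s t))))
        (Ske (add_skel X (un_ske (tm_val M e a)) (un_ske (tm_val M e b))))"
      by (rule gval_gbind[OF _ gval_gbind[OF _ gval_gret]]) simp
    then show ?thesis using AddS ts by simp
  next
    case ScalS
    then obtain a b where ts: "ts = [a, b]" "tm_sort L_S a = KK" "tm_sort L_S b = SS"
      using App.prems(1) by (auto simp: map_eq_Cons_conv)
    then show ?thesis using ScalS scalar_tm[of a] IH[of b]
      by (auto intro!: gval_gbind[of M e' _ "tm_val M e b"] gval_gret)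
  next
    case ValS
    then obtain a where ts: "ts = [a]" "tm_sort L_S a = SS"
      using App.prems(1) by (auto simp: map_eq_Cons_conv)
    then show ?thesis using ValS IH[of a]
      by (auto intro!: gval_gbind[of M e' _ "tm_val M e a"] gval_gret)
  next
    case PiS
    then obtain a where ts: "ts = [a]" "tm_sort L_S a = VV"
      using App.prems(1) by (auto simp: map_eq_Cons_conv)
    then show ?thesis using PiS pi[of a] by simp
  next
    case Val
    then obtain a where ts: "ts = [a]" "tm_sort L_S a = VV"
      using App.prems(1) by (auto simp: map_eq_Cons_conv)
    then show ?thesis using Val pi[of a]
      by (auto intro!: gval_gbind[of M e' _ "Ske (pi_skel X (un_vec (tm_val M e a)))"] gval_gret)
  next
    case Top
    then show ?thesis using App.prems(1) by (auto intro!: gval_gret)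
  qed (use App.prems scalar_tm in \<open>auto simp: map_eq_Cons_conv intro!: gval_gret\<close>)
qed

lemma coef_closed:
  assumes "env_ok X {SS, GG, KK} e" shows "coef r e j i \<in> carrier K"
  using env_okD[OF assms, of KK "coef_index j i"] by (auto simp: coef_def)

text \<open>A vector variable \<open>j\<close> other than \<open>n\<close> has
  \<open>r j \<le> N\<close>, so its coefficient at the new member is read as zero and its value is
  unchanged. The variable \<open>n\<close> is removed from \<open>xs\<close> beforehand, since its
  old coefficients are lost.\<close>

lemma encodes_extend:
  assumes enc: "encodes N r w (xs - {(VV, n)}) e e'"
    and x: "x \<in> carrier V" "separated X (Suc N) (\<lambda>i. pi_skel X ((w(N := x)) i))"
    and e1: "\<And>y. y \<notin> insert (SS, Suc (2 * N)) ((\<lambda>i. (KK, coef_index n i)) ` {..<Suc N}) \<Longrightarrow> e1 y = e' y"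
      "env_ok X {SS, GG, KK} e1" "e1 (SS, Suc (2 * N)) = Ske (pi_skel X x)"
    and v: "v = lc X (Suc N) (coef (r(n := Suc N)) e1 n) (w(N := x))"
  shows "encodes (Suc N) (r(n := Suc N)) (w(N := x)) xs (e((VV, n) := Vec v)) e1"
proof -
  have w: "\<And>i. w i \<in> carrier V" and r: "\<And>j. r j \<le> N" using enc by (simp_all add: encodes_def)
  have 1: "e1 (SS, Suc (2 * i)) = Ske (pi_skel X ((w(N := x)) i))" if "i < Suc N" for i
  proof (cases "i = N")
    case False
    then show ?thesis using that enc e1(1)[of "(SS, Suc (2 * i))"] by (auto simp: encodes_def)
  qed (simp add: e1(3))
  have 2: "e1 (s, 2 * m) = (e((VV, n) := Vec v)) (s, m)" if "(s, m) \<in> xs" "s \<noteq> VV" for s m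
  proof -
    have "e1 (s, 2 * m) = e' (s, 2 * m)" using e1(1)[of "(s, 2 * m)"] by (auto simp: image_iff)
    also have "\<dots> = e (s, m)" using enc that by (simp add: encodes_def)
    finally show ?thesis using that by simp
  qed
  have 3: "(e((VV, n) := Vec v)) (VV, j) = Vec (lc X (Suc N) (coef (r(n := Suc N)) e1 j) (w(N := x)))"
    if "(VV, j) \<in> xs" for j
  proof (cases "j = n")
    case False
    have "e1 (KK, coef_index j i) = e' (KK, coef_index j i)" for i
      by (rule e1(1)) (use False in auto)
    then have "coef (r(n := Suc N)) e1 j i = coef r e' j i" for i using False by (simp add: coef_def)
    then have c: "coef (r(n := Suc N)) e1 j = coef r e' j" by blast
    have "coef r e' j N = \<zero>\<^bsub>K\<^esub>" using r[of j] by (simp add: coef_def)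
    moreover have "lc X N (coef r e' j) (w(N := x)) = lc X N (coef r e' j) w" by (rule lc_cong) simp
    moreover have "env_ok X {SS, GG, KK} e'" using enc by (simp add: encodes_def)
    then have "coef r e' j i \<in> carrier K" for i by (rule coef_closed)
    ultimately have "lc X (Suc N) (coef r e' j) (w(N := x)) = lc X N (coef r e' j) w"
      using x(1) w by simp
    then show ?thesis using False that enc c by (simp add: encodes_def)
  qed (simp add: v)
  show ?thesis unfolding encodes_def using 1 2 3 w x e1(2) r by (simp add: le_SucI del: lc.simps separated.simps)
qed

text \<open>The work is in the vector quantifier. From left to right \<open>separated_extend\<close>
  supplies the class and the coefficients; from right to left any vector in the given class serves
  as the new member, because the invariant only sees its class.\<close>

lemma sat_translate:
  assumes "wf_fm L_S p" "encodes N r w (fv p) e e'"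
  shows "sat M e p \<longleftrightarrow> sat M e' (translate N r p)"
  using assms
proof (induction p arbitrary: N r w e e')
  case (Eq t u)
  have t: "encodes N r w (fv_tm t) e e'" and u: "encodes N r w (fv_tm u) e e'"
    using Eq.prems(2) by (auto intro: encodes_mono)
  have wf: "wf_tm L_S t" "wf_tm L_S u" "tm_sort L_S u = tm_sort L_S t" using Eq.prems(1) by simp_all
  show ?case
  proof (cases "tm_sort L_S t = VV")
    case True
    have enc: "env_ok X {SS, GG, KK} e'" "\<And>i. w i \<in> carrier V" "separated X N (\<lambda>i. pi_skel X (w i))"
      "\<And>i. i < N \<Longrightarrow> e' (SS, Suc (2 * i)) = Ske (pi_skel X (w i))"
      using t by (simp_all add: encodes_def)
    have dom: "tm_val M e' (coef_tm r t i) \<in> Sca ` carrier K" if "wf_tm L_S t" "tm_sort L_S t = VV" for t i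
      using skel_tm_in_dom[OF _ enc(1), of "coef_tm r t i"] wf_coef_tm[OF that, of r i] by simp
    have inj: "a = b \<longleftrightarrow> un_sca a = un_sca b" if "a \<in> Sca ` carrier K" "b \<in> Sca ` carrier K" for a b :: "('k, 'v, 'g) elem"
      using that by auto
    have k: "un_sca (tm_val M e' (coef_tm r t i)) \<in> carrier K" "un_sca (tm_val M e' (coef_tm r u i)) \<in> carrier K" for i
      using dom[OF wf(1) True, of i] dom[of u i] wf True by auto
    have "sat M e (Eq t u) \<longleftrightarrow> (\<forall>i<N. un_sca (tm_val M e' (coef_tm r t i)) = un_sca (tm_val M e' (coef_tm r u i)) \<or>
        pi_skel X (w i) = zero_skel X)"
      using lc_eq_iff[OF enc(3) k enc(2)] tm_val_coef_tm[OF wf(1) True t] tm_val_coef_tm[OF wf(2) _ u] True wf(3) by simp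
    also have "\<dots> \<longleftrightarrow> sat M e' (translate N r (Eq t u))"
      using True wf inj[OF dom dom] enc(4) by auto
    finally show ?thesis .
  next
    case False
    have g: "gval M e' (guarded_tm N r t) (tm_val M e t)" "gval M e' (guarded_tm N r u) (tm_val M e u)"
      using gval_guarded_tm wf False t u by simp_all
    have "sat M e' (gany (\<lambda>s. gany (Eq s) (guarded_tm N r u)) (guarded_tm N r t)) \<longleftrightarrow> tm_val M e t = tm_val M e u"
      by (rule sat_gany[OF g(1)], rule sat_gany[OF g(2)]) simp
    then show ?thesis using False by simp
  qed
next
  case (Rel R ts)
  then obtain t u where ts: "ts = [t, u]" "tm_sort L_S t = GG" "tm_sort L_S u = GG" "wf_tm L_S t" "wf_tm L_S u"
    by (auto simp: map_eq_Cons_conv)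
  have t: "encodes N r w (fv_tm t) e e'" and u: "encodes N r w (fv_tm u) e e'"
    using Rel.prems(2) ts by (auto intro: encodes_mono)
  have g: "gval M e' (guarded_tm N r t) (tm_val M e t)" "gval M e' (guarded_tm N r u) (tm_val M e u)"
    using gval_guarded_tm ts t u by simp_all
  have "sat M e' (gany (\<lambda>s. gany (\<lambda>s'. Rel R [s, s']) (guarded_tm N r u)) (guarded_tm N r t)) \<longleftrightarrow> sat M e (Rel R [t, u])"
    by (rule sat_gany[OF g(1)], rule sat_gany[OF g(2)]) simp
  then show ?case using ts by simp
next
  case (Neg p)
  then have "sat M e p \<longleftrightarrow> sat M e' (translate N r p)" by simp
  then show ?case by simp
next
  case (Conj p q)
  have "sat M e p \<longleftrightarrow> sat M e' (translate N r p)" "sat M e q \<longleftrightarrow> sat M e' (translate N r q)"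
    using Conj.prems by (auto intro!: Conj.IH intro: encodes_mono)
  then show ?case by simp
next
  case (Exi s n p)
  have wf: "wf_fm L_S p" using Exi.prems(1) by simp
  have enc: "encodes N r w (fv p - {(s, n)}) e e'" using Exi.prems(2) by simp
  show ?case
  proof (cases "s = VV")
    case False
    have "sat M (e((s, n) := a)) p \<longleftrightarrow> sat M (e'((s, 2 * n) := a)) (translate N r p)" if "a \<in> vvs_dom X s" for a
    proof (rule Exi.IH[OF wf])
      \<comment> \<open>Coefficients sit at odd indices, which the change at \<open>2 * n\<close>
        does not touch.\<close>
      have "coef r (e'((s, 2 * n) := a)) = coef r e'" by (auto simp: coef_def fun_eq_iff)
      then show "encodes N r w (fv p) (e((s, n) := a)) (e'((s, 2 * n) := a))"
        using enc False that unfolding encodes_def env_ok_def by auto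
    qed
    then show ?thesis using False by simp
  next
    case True
    let ?xs = "(SS, Suc (2 * N)) # map (\<lambda>i. (KK, coef_index n i)) [0..<Suc N]"
    let ?q = "Conj (fm_separated (Suc N)) (translate (Suc N) (r(n := Suc N)) p)"
    have set_xs: "set ?xs = insert (SS, Suc (2 * N)) ((\<lambda>i. (KK, coef_index n i)) ` {..<Suc N})"
      by (auto simp: image_iff)
    have encD: "\<And>i. w i \<in> carrier V" "separated X N (\<lambda>i. pi_skel X (w i))" "env_ok X {SS, GG, KK} e'"
      "\<And>i. i < N \<Longrightarrow> e' (SS, Suc (2 * i)) = Ske (pi_skel X (w i))"
      using enc by (simp_all add: encodes_def)
    have step: "sat M e1 (fm_separated (Suc N)) \<longleftrightarrow> separated X (Suc N) (\<lambda>i. pi_skel X ((w(N := x)) i))"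
      if "x \<in> carrier V" "\<And>y. y \<notin> set ?xs \<Longrightarrow> e1 y = e' y" "env_ok X {SS, GG, KK} e1"
        "e1 (SS, Suc (2 * N)) = Ske (pi_skel X x)" for e1 x
    proof (rule sat_fm_separated)
      show "env_ok X {KK} e1" using that(3) by (simp add: env_ok_def)
      show "e1 (SS, Suc (2 * i)) = Ske (pi_skel X ((w(N := x)) i))" if "i < Suc N" for i
        using that encD(4)[of i] \<open>e1 (SS, Suc (2 * N)) = Ske (pi_skel X x)\<close>
          \<open>\<And>y. y \<notin> set ?xs \<Longrightarrow> e1 y = e' y\<close>[of "(SS, Suc (2 * i))"] by (cases "i = N") auto
    qed
    have "sat M e (Exi VV n p) \<longleftrightarrow> sat M e' (Exis ?xs ?q)"
    proof
      assume "sat M e (Exi VV n p)"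
      then obtain v where v: "v \<in> carrier V" "sat M (e((VV, n) := Vec v)) p" by auto
      obtain k x where k: "\<And>i. k i \<in> carrier K" and x: "x \<in> carrier V" "v = lc X N k w \<oplus>\<^bsub>V\<^esub> x"
        "separated X (Suc N) (\<lambda>i. pi_skel X ((w(N := x)) i))"
        using separated_extend[OF encD(2,1) v(1)] by blast
      \<comment> \<open>The vector is lc k w + x, so its coefficient at the new member is
        one.\<close>
      define l where "l = k(N := \<one>\<^bsub>K\<^esub>)"
      have l: "l i \<in> carrier K" for i using k by (simp add: l_def)
      \<comment> \<open>Decoding the index \<open>coef_index n i\<close> recovers
        \<open>i\<close>.\<close>
      define e1 where "e1 y = (if y = (SS, Suc (2 * N)) then Ske (pi_skel X x)
        else if y \<in> set ?xs then Sca (l (snd (prod_decode (snd y div 2)))) else e' y)" for y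
      have e1: "\<And>y. y \<notin> set ?xs \<Longrightarrow> e1 y = e' y" "e1 (SS, Suc (2 * N)) = Ske (pi_skel X x)"
        by (simp_all add: e1_def)
      have e1K: "e1 (KK, coef_index n i) = Sca (l i)" if "i < Suc N" for i
        using that unfolding e1_def set_xs by (auto simp: coef_index_def)
      have ok: "env_ok X {SS, GG, KK} e1"
        using encD(3) x(1) l unfolding e1_def set_xs by (auto simp: env_ok_def)
      have "lc X (Suc N) (coef (r(n := Suc N)) e1 n) (w(N := x)) = lc X (Suc N) l (w(N := x))"
        by (rule lc_cong) (simp add: coef_def e1K)
      also have "\<dots> = lc X N l (w(N := x)) \<oplus>\<^bsub>V\<^esub> x" using x(1) by (simp add: l_def)
      also have "lc X N l (w(N := x)) = lc X N k w" by (rule lc_cong) (simp add: l_def)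
      finally have veq: "v = lc X (Suc N) (coef (r(n := Suc N)) e1 n) (w(N := x))" unfolding x(2) by (rule sym)
      have "encodes (Suc N) (r(n := Suc N)) (w(N := x)) (fv p) (e((VV, n) := Vec v)) e1"
        by (rule encodes_extend[OF enc[unfolded True] x(1,3) e1(1)[unfolded set_xs] ok e1(2) veq])
      then have "sat M e1 (translate (Suc N) (r(n := Suc N)) p)" using Exi.IH[OF wf] v(2) by blast
      moreover have "sat M e1 (fm_separated (Suc N))" using step[OF x(1) e1(1) ok e1(2)] x(3) by blast
      moreover have "\<forall>y\<in>set ?xs. e1 y \<in> vvs_dom X (fst y)"
        using e1K e1(2) l x(1) unfolding set_xs by auto
      ultimately show "sat M e' (Exis ?xs ?q)"
        unfolding sat_Exis vvs_struct_simps sat.simps(4) using e1(1) by blast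
    next
      assume "sat M e' (Exis ?xs ?q)"
      then obtain e1 where e1: "\<And>y. y \<notin> set ?xs \<Longrightarrow> e1 y = e' y" "\<And>y. y \<in> set ?xs \<Longrightarrow> e1 y \<in> vvs_dom X (fst y)"
        "sat M e1 (fm_separated (Suc N))" "sat M e1 (translate (Suc N) (r(n := Suc N)) p)"
        unfolding sat_Exis vvs_struct_simps sat.simps(4) by blast
      have ok: "env_ok X {SS, GG, KK} e1"
        unfolding env_ok_def
      proof (intro ballI allI)
        fix s i assume "s \<in> {SS, GG, KK}"
        then show "e1 (s, i) \<in> vvs_dom X s"
          using e1(1)[of "(s, i)"] e1(2)[of "(s, i)"] env_okD[OF encD(3), of s i] by (cases "(s, i) \<in> set ?xs") auto
      qed
      obtain a where a: "a \<in> skel X" "e1 (SS, Suc (2 * N)) = Ske a" using e1(2)[of "(SS, Suc (2 * N))"] by auto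
      \<comment> \<open>\<open>fm_separated\<close> includes the condition that the new class lies
        in the image of \<pi>; this yields the representative \<open>x\<close>.\<close>
      have "sat M e1 (fm_in_pi (skel_var N))" using e1(3) by simp
      then have "in_pi X a" using sat_fm_in_pi[of X e1 "skel_var N" a] a(2) by simp
      then obtain x where x: "x \<in> carrier V" "a = pi_skel X x" using in_pi_iff[OF a(1)] by blast
      have e1x: "e1 (SS, Suc (2 * N)) = Ske (pi_skel X x)" using a x by simp
      define v where "v = lc X (Suc N) (coef (r(n := Suc N)) e1 n) (w(N := x))"
      have sepx: "separated X (Suc N) (\<lambda>i. pi_skel X ((w(N := x)) i))" using step[OF x(1) e1(1) ok e1x] e1(3) by blast
      have "encodes (Suc N) (r(n := Suc N)) (w(N := x)) (fv p) (e((VV, n) := Vec v)) e1"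
        by (rule encodes_extend[OF enc[unfolded True] x(1) sepx e1(1)[unfolded set_xs] ok e1x v_def])
      then have "sat M (e((VV, n) := Vec v)) p" using Exi.IH[OF wf] e1(4) by blast
      moreover have "v \<in> carrier V" unfolding v_def
        by (rule lc_closed) (use encD(1) x(1) coef_closed[OF ok] in simp_all)
      ultimately show "sat M e (Exi VV n p)" by auto
    qed
    then show ?thesis using True by (simp del: upt.simps fm_separated.simps)
  qed
qed

end

section \<open>Guessing a separated family by a block of scalar quantifiers\<close>

fun lc_tm :: "nat \<Rightarrow> (nat \<Rightarrow> (srt, 'k fsym) tm) \<Rightarrow> (nat \<Rightarrow> (srt, 'k fsym) tm) \<Rightarrow> (srt, 'k fsym) tm" where
  "lc_tm 0 P T = App ZeroV []"
| "lc_tm (Suc n) P T = App AddV [lc_tm n P T, App Scal [P n, T n]]"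

lemma tm_val_lc_tm:
  "(\<And>i. i < n \<Longrightarrow> tm_val (vvs_struct X) e (P i) = Sca (k i) \<and> tm_val (vvs_struct X) e (T i) = Vec (w i)) \<Longrightarrow>
    tm_val (vvs_struct X) e (lc_tm n P T) = Vec (lc X n k w)"
  by (induction n) simp_all

lemma wf_lc_tm:
  "(\<And>i. i < n \<Longrightarrow> wf_tm L_S (P i) \<and> tm_sort L_S (P i) = KK \<and> wf_tm L_S (T i) \<and> tm_sort L_S (T i) = VV) \<Longrightarrow>
    wf_tm L_S (lc_tm n P T) \<and> tm_sort L_S (lc_tm n P T) = VV"
  by (induction n) simp_all

lemma fv_lc_tm: "fv_tm (lc_tm n P T) = (\<Union>i<n. fv_tm (P i) \<union> fv_tm (T i))"
  by (induction n) (auto simp: lessThan_Suc)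

lemma fv_Conjs [simp]: "fv (Conjs ps) = (\<Union>p\<in>set ps. fv p)"
  by (induction ps) auto

lemma qfree_Conjs [simp]: "qfree (Conjs ps) \<longleftrightarrow> (\<forall>p\<in>set ps. qfree p)"
  by (induction ps) auto

text \<open>Closed terms for the variables to which a substitution assigns nothing in particular:
  the resulting environment must be well-sorted at every variable, without new free
  variables.\<close>

fun default_tm :: "srt \<Rightarrow> (srt, 'k fsym) tm" where
  "default_tm SS = App ZeroS []" | "default_tm KK = App ZeroK []" | "default_tm GG = App Top []" | "default_tm VV = App ZeroV []"

lemma default_tm_simps [simp]: "wf_tm L_S (default_tm s)" "tm_sort L_S (default_tm s) = s" "fv_tm (default_tm s) = {}"
  by (cases s; simp)+

lemma sublanguage_skel_lang: "sublanguage skel_lang L_S"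
  by (auto simp: sublanguage_def)

text \<open>The members of the family are the terms \<open>wT i\<close> built from the rows of A, so
  w = A v needs no equation. The equations v = B w speak of vectors and stay outside the predicate.
  Separatedness and the translated formula form one predicate in the classes \<pi>(w i), the entries
  of B and the remaining variables of \<open>p'\<close>. Any matrices passing these tests yield the
  invariant \<open>encodes\<close>, and \<open>separated_basis\<close> provides some.\<close>

lemma eliminate_L_S:
  fixes p :: "(srt, 'k fsym, (srt, 'k fsym, rsym) esym) fm"
  assumes p: "wf_fm (enrich L_S skel_lang) p"
  shows "\<exists>ns q. wf_fm (enrich L_S skel_lang) q \<and> qfree q \<and> fv (foldr (Exi KK) ns q) \<subseteq> fv p \<and>
    equivalent (enrich L_S skel_lang)
      (expand ` (valued_spaces :: (srt, 'k fsym, rsym, ('k, 'v, 'g) elem) struct set)) p (foldr (Exi KK) ns q)"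
proof -
  obtain p' where p': "wf_fm L_S p'" "fv p' \<subseteq> fv p"
    "\<And>(M :: (srt, 'k fsym, rsym, ('k, 'v, 'g) elem) struct) e. sat M e p' = sat (expand M) e p"
    using unenrich[OF sublanguage_skel_lang p] by blast
  have fin: "finite {n. (s, n) \<in> fv p'}" for s
    by (rule finite_subset[of _ "snd ` fv p'"]) (force simp: finite_fv)+
  obtain js where js: "set js = {j. (VV, j) \<in> fv p'}" "distinct js"
    using finite_distinct_list[OF fin] by blast
  obtain m where m: "\<And>n. (KK, n) \<in> fv p' \<Longrightarrow> n < m"
    using fin[of KK] unfolding finite_nat_set_iff_bounded by blast
  define N where "N = length js"
  \<comment> \<open>Scalar indices from \<open>m\<close> on do not occur in \<open>p'\<close>. The
    parity of the offset keeps the entries of A and B apart.\<close>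
  define Av where "Av i l = m + 2 * prod_encode (i, l)" for i l
  define Bv where "Bv j i = Suc (m + 2 * prod_encode (j, i))" for j i
  define wT :: "nat \<Rightarrow> (srt, 'k fsym) tm" where "wT i = lc_tm N (\<lambda>l. Var KK (Av i l)) (\<lambda>l. Var VV (js ! l))" for i
  \<comment> \<open>Odd variables are the auxiliary ones of the translation: a skeleton variable
    becomes the class of a member of the family, a scalar variable the entry of B with the decoded
    indices.\<close>
  define \<sigma>odd where "\<sigma>odd s n = (case s of
      SS \<Rightarrow> if n < N then App PiS [wT n] else default_tm SS
    | KK \<Rightarrow> if fst (prod_decode n) \<in> set js \<and> snd (prod_decode n) < N
        then Var KK (Bv (fst (prod_decode n)) (snd (prod_decode n))) else default_tm KK
    | _ \<Rightarrow> default_tm s)" for s n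
  define \<sigma> where "\<sigma> x = (if even (snd x)
      then if (fst x, snd x div 2) \<in> fv p' then Var (fst x) (snd x div 2) else default_tm (fst x)
      else \<sigma>odd (fst x) (snd x div 2))" for x
  have \<sigma>even: "\<sigma> (s, 2 * n) = (if (s, n) \<in> fv p' then Var s n else default_tm s)"
    and \<sigma>_odd: "\<sigma> (s, Suc (2 * n)) = \<sigma>odd s n" for s n by (simp_all add: \<sigma>_def)
  have wf_wT: "wf_tm L_S (wT i) \<and> tm_sort L_S (wT i) = VV" for i
    unfolding wT_def by (rule wf_lc_tm) simp
  have wf_odd: "wf_tm L_S (\<sigma>odd s n) \<and> tm_sort L_S (\<sigma>odd s n) = s" for s n
    using wf_wT by (cases s) (auto simp: \<sigma>odd_def simp del: default_tm.simps)
  have srt: "s \<in> sorts L_S" for s by (cases s) auto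
  have wf_\<sigma>: "wf_tm L_S (\<sigma> x) \<and> tm_sort L_S (\<sigma> x) = fst x" for x
    using wf_odd srt by (auto simp: \<sigma>_def simp del: L_S_simps(1))
  have js_nth: "js ! l \<in> set js" "(VV, js ! l) \<in> fv p'" if "l < N" for l
    using that js(1) nth_mem[of l js] by (auto simp: N_def)
  have fv_wT: "fv_tm (wT i) \<subseteq> fv p' \<union> {KK} \<times> {m..}" for i
    using js_nth by (auto simp: wT_def fv_lc_tm Av_def)
  have fv_\<sigma>: "fv_tm (\<sigma> x) \<subseteq> fv p' \<union> {KK} \<times> {m..}" for x
  proof (cases "even (snd x)")
    case False
    then show ?thesis using fv_wT by (cases "fst x") (auto simp: \<sigma>_def \<sigma>odd_def Bv_def simp del: default_tm.simps)
  qed (auto simp: \<sigma>_def)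
  define \<Phi> :: "(srt, 'k fsym, rsym) fm" where "\<Phi> = Conj (fm_separated N) (translate N (\<lambda>_. N) p')"
  have "wf_fm skel_lang \<Phi>" by (simp add: \<Phi>_def wf_fm_separated wf_translate p'(1))
  from definable_atom[OF this, of L_S \<sigma>] wf_\<sigma> obtain a :: "(srt, 'k fsym, (srt, 'k fsym, rsym) esym) fm"
    where a: "wf_fm (enrich L_S skel_lang) a" "qfree a" "fv a \<subseteq> (\<Union>x\<in>fv \<Phi>. fv_tm (\<sigma> x))"
    "\<And>(M :: (srt, 'k fsym, rsym, ('k, 'v, 'g) elem) struct) e. sat (expand M) e a = sat M (\<lambda>x. tm_val M e (\<sigma> x)) \<Phi>"
    by blast
  define eq :: "nat \<Rightarrow> (srt, 'k fsym, (srt, 'k fsym, rsym) esym) fm"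
    where "eq l = Eq (Var VV (js ! l)) (lc_tm N (\<lambda>i. Var KK (Bv (js ! l) i)) wT)" for l
  define q where "q = Conj (Conjs (map eq [0..<N])) a"
  have "wf_tm L_S (lc_tm N (\<lambda>i. Var KK (Bv (js ! l) i)) wT) \<and> tm_sort L_S (lc_tm N (\<lambda>i. Var KK (Bv (js ! l) i)) wT) = VV" for l
    using wf_wT by (intro wf_lc_tm) simp
  then have wf_q: "wf_fm (enrich L_S skel_lang) q" using a(1) by (simp add: q_def eq_def)
  have qf: "qfree q" using a(2) by (simp add: q_def eq_def)
  have fv_eq: "fv (eq l) \<subseteq> fv p' \<union> {KK} \<times> {m..}" if "l < N" for l
    using fv_wT js_nth that by (auto simp: eq_def fv_lc_tm Bv_def)
  have fv_q: "fv q \<subseteq> fv p' \<union> {KK} \<times> {m..}"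
    using a(3) fv_\<sigma> fv_eq by (fastforce simp: q_def)
  \<comment> \<open>The block must reach beyond the free variables of \<open>q\<close> and all
    matrix entries, which are assigned below.\<close>
  let ?S = "snd ` fv q \<union> (\<lambda>(i, l). Av i l) ` ({..<N} \<times> {..<N}) \<union> (\<lambda>(l, i). Bv (js ! l) i) ` ({..<N} \<times> {..<N})"
  have "finite ?S" using finite_fv by blast
  then obtain m' where "\<forall>n\<in>?S. n < m'" unfolding finite_nat_set_iff_bounded ..
  note m' = bspec[OF this]
  have m'_q: "n < m'" if "(s, n) \<in> fv q" for s n by (rule m') (use that in force)
  have m'_A: "Av i l < m'" and m'_B: "Bv (js ! l) i < m'" if "i < N" "l < N" for i l
    by (rule m', use that in force)+
  define ns where "ns = [m..<m']"
  have Q: "foldr (Exi KK) ns q = Exis (map (Pair KK) ns) q" by (rule foldr_Exi)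
  have ns: "set (map (Pair KK) ns) = {KK} \<times> {m..<m'}" by (auto simp: ns_def)
  have fv_Q: "fv (foldr (Exi KK) ns q) \<subseteq> fv p"
    unfolding Q fv_Exis ns
  proof
    fix x assume x: "x \<in> fv q - {KK} \<times> {m..<m'}"
    then have "x \<in> fv p' \<or> x \<in> {KK} \<times> {m..}" using fv_q by blast
    moreover have "snd x < m'" using x m'_q[of "fst x" "snd x"] by simp
    ultimately show "x \<in> fv p" using x p'(2) by (cases x) auto
  qed
  have "sat (expand M) e p \<longleftrightarrow> sat (expand M) e (foldr (Exi KK) ns q)"
    if M: "M \<in> (valued_spaces :: (srt, 'k fsym, rsym, ('k, 'v, 'g) elem) struct set)"
      and e: "\<forall>s\<in>{VV, KK, GG, SS}. \<forall>n. e (s, n) \<in> univ M s" for M e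
  proof -
    obtain X where XM: "valued_vector_space X" "M = vvs_struct X" using M by (auto simp: valued_spaces_def)
    interpret valued X by unfold_locales (rule XM(1))
    have dom: "e (s, n) \<in> vvs_dom X s" for s n using e by (cases s) (simp_all add: XM(2))
    define w where "w e' i = (if i < N then un_vec (tm_val M e' (wT i)) else \<zero>\<^bsub>V\<^esub>)" for e' i
    \<comment> \<open>Nothing is presupposed about the chosen matrices: the equations and the
      separatedness test in \<open>q\<close> are just what \<open>encodes\<close> demands of
      them.\<close>
    have key: "sat (expand M) e' q \<longleftrightarrow>
        (\<forall>l<N. e' (VV, js ! l) = Vec (lc X N (\<lambda>i. un_sca (e' (KK, Bv (js ! l) i))) (w e'))) \<and>
        separated X N (\<lambda>i. pi_skel X (w e' i)) \<and> sat M e' p'" (is "_ \<longleftrightarrow> (\<forall>l<N. ?eq l) \<and> ?sep \<and> _")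
      if dom': "\<And>s n. e' (s, n) \<in> vvs_dom X s" for e'
    proof -
      define e'' where "e'' x = tm_val M e' (\<sigma> x)" for x
      have e''_abs: "e'' = (\<lambda>x. tm_val M e' (\<sigma> x))" by (simp add: fun_eq_iff e''_def)
      have L: "tm_val M e' t \<in> vvs_dom X (tm_sort L_S t)" if "wf_tm L_S t" for t
        using that dom' unfolding L_S_def XM(2) by (intro tm_in_dom) (auto simp: env_ok_def)
      have wT: "tm_val M e' (wT i) \<in> Vec ` carrier V" for i using L[of "wT i"] wf_wT[of i] by simp
      have wc: "w e' i \<in> carrier V" and wv: "i < N \<Longrightarrow> tm_val M e' (wT i) = Vec (w e' i)" for i
        using wT[of i] by (auto simp: w_def)
      have eqs: "sat (expand M) e' (eq l) \<longleftrightarrow> ?eq l" if "l < N" for l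
      proof -
        have "e' (KK, n) = Sca (un_sca (e' (KK, n)))" for n using dom'[of KK n] by auto
        then have "tm_val M e' (lc_tm N (\<lambda>i. Var KK (Bv (js ! l) i)) wT) =
            Vec (lc X N (\<lambda>i. un_sca (e' (KK, Bv (js ! l) i))) (w e'))"
          using wv unfolding XM(2) by (intro tm_val_lc_tm) simp
        then show ?thesis by (simp add: eq_def)
      qed
      have ok: "env_ok X {SS, GG, KK} e''"
        using L wf_\<sigma> unfolding env_ok_def e''_def by (metis fst_conv)
      have e''SS: "e'' (SS, Suc (2 * i)) = Ske (pi_skel X (w e' i))" if "i < N" for i
        using that wv by (simp add: e''_def \<sigma>_odd \<sigma>odd_def XM(2))
      have sep: "sat M e'' (fm_separated N) \<longleftrightarrow> ?sep"
        unfolding XM(2) by (rule sat_fm_separated) (use ok e''SS in \<open>auto simp: env_ok_def\<close>)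
      have translate: "sat M e'' (translate N (\<lambda>_. N) p') \<longleftrightarrow> sat M e' p'" if eq: "\<forall>l<N. ?eq l" and sep: ?sep
      proof -
        have "encodes N (\<lambda>_. N) (w e') (fv p') e' e''"
          unfolding encodes_def
        proof (intro conjI allI impI)
          fix s n assume "(s, n) \<in> fv p'" "s \<noteq> VV"
          then show "e'' (s, 2 * n) = e' (s, n)" by (simp add: e''_def \<sigma>even)
        next
          fix j assume "(VV, j) \<in> fv p'"
          then have "j \<in> set js" using js(1) by simp
          then obtain l where l: "l < N" "j = js ! l" by (auto simp: N_def in_set_conv_nth)
          have "coef (\<lambda>_. N) e'' j i = un_sca (e' (KK, Bv j i))" if "i < N" for i
            using that \<open>j \<in> set js\<close> by (simp add: coef_def coef_index_def e''_def \<sigma>_odd \<sigma>odd_def)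
          then have "lc X N (coef (\<lambda>_. N) e'' j) (w e') = lc X N (\<lambda>i. un_sca (e' (KK, Bv j i))) (w e')"
            by (intro lc_cong) simp
          then show "e' (VV, j) = Vec (lc X N (coef (\<lambda>_. N) e'' j) (w e'))" using eq l by simp
        qed (use wc sep ok e''SS in simp_all)
        then show ?thesis using sat_translate[OF p'(1)] unfolding XM(2) by blast
      qed
      have "sat (expand M) e' q \<longleftrightarrow> (\<forall>l<N. ?eq l) \<and> sat M e'' \<Phi>"
        using eqs a(4)[of M e', folded e''_abs] by (auto simp: q_def)
      then show ?thesis using sep translate by (auto simp: \<Phi>_def)
    qed
    have agree: "sat M e' p' \<longleftrightarrow> sat M e p'" if "\<And>x. x \<notin> {KK} \<times> {m..<m'} \<Longrightarrow> e' x = e x" for e'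
      using m by (intro sat_cong that) fastforce
    have "sat M e p' \<longleftrightarrow> sat (expand M) e (Exis (map (Pair KK) ns) q)"
    proof
      assume "sat (expand M) e (Exis (map (Pair KK) ns) q)"
      then obtain e' where e': "\<And>x. x \<notin> {KK} \<times> {m..<m'} \<Longrightarrow> e' x = e x"
        "\<And>x. x \<in> {KK} \<times> {m..<m'} \<Longrightarrow> e' x \<in> vvs_dom X (fst x)" "sat (expand M) e' q"
        unfolding sat_Exis ns univ_expand XM(2) vvs_struct_simps by blast
      have "e' (s, n) \<in> vvs_dom X s" for s n
        using e'(1)[of "(s, n)"] e'(2)[of "(s, n)"] dom by (cases "(s, n) \<in> {KK} \<times> {m..<m'}") auto
      then show "sat M e p'" using key[of e'] e'(3) agree[OF e'(1)] by blast
    next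
      assume sat: "sat M e p'"
      define v where "v l = (if l < N then un_vec (e (VV, js ! l)) else \<zero>\<^bsub>V\<^esub>)" for l
      have ev: "e (VV, js ! l) \<in> Vec ` carrier V" for l using dom[of VV "js ! l"] by simp
      have v: "v l \<in> carrier V" and ve: "l < N \<Longrightarrow> e (VV, js ! l) = Vec (v l)" for l
        using ev[of l] by (auto simp: v_def)
      obtain u A B where u: "\<And>i. u i \<in> carrier V" "separated X N (\<lambda>i. pi_skel X (u i))"
        "\<And>i j. A i j \<in> carrier K" "\<And>i j. B i j \<in> carrier K"
        "\<And>i. i < N \<Longrightarrow> u i = lc X N (A i) v" "\<And>i. i < N \<Longrightarrow> v i = lc X N (B i) u"
        using separated_basis[of v N] v by blast
      \<comment> \<open>The variables \<open>Bv\<close> are indexed by vector variables, the rows of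
        B by positions in \<open>js\<close>; \<open>ix\<close> converts.\<close>
      define ix where "ix j = (SOME l. l < N \<and> js ! l = j)" for j
      have ix: "ix (js ! l) = l" if "l < N" for l
      proof -
        have "ix (js ! l) < N \<and> js ! ix (js ! l) = js ! l" unfolding ix_def by (rule someI[of _ l]) (simp add: that)
        then show ?thesis using nth_eq_iff_index_eq[OF js(2), of "ix (js ! l)" l] that by (simp add: N_def)
      qed
      \<comment> \<open>A single function assigns both matrices by inverting \<open>Av\<close> and
        \<open>Bv\<close>: the parity of \<open>n - m\<close> selects the matrix.\<close>
      define val where "val n = (let (i, l) = prod_decode ((n - m) div 2) in
        if even (n - m) then A i l else B (ix i) l)" for n
      have val: "val n \<in> carrier K" "val (Av i l) = A i l" "val (Bv i l) = B (ix i) l" for n i l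
        using u(3,4) by (simp_all add: val_def Av_def Bv_def split: prod.split)
      define e' where "e' x = (if x \<in> {KK} \<times> {m..<m'} then Sca (val (snd x)) else e x)" for x
      have e'V: "e' (VV, n) = e (VV, n)" for n by (simp add: e'_def)
      have A: "e' (KK, Av i l) = Sca (A i l)" if "i < N" "l < N" for i l
      proof -
        have "Av i l < m'" using m'_A that by blast
        then show ?thesis using val(2) by (simp add: e'_def) (simp add: Av_def)
      qed
      have B: "e' (KK, Bv (js ! l) i) = Sca (B l i)" if "i < N" "l < N" for i l
      proof -
        have "Bv (js ! l) i < m'" using m'_B that by blast
        then show ?thesis using val(3) ix that by (simp add: e'_def) (simp add: Bv_def)
      qed
      have dom': "e' (s, n) \<in> vvs_dom X s" for s n using dom val(1) by (simp add: e'_def)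
      have wu: "w e' i = u i" if "i < N" for i
      proof -
        have "tm_val M e' (wT i) = Vec (lc X N (A i) v)"
          unfolding wT_def XM(2) using A that ve e'V by (intro tm_val_lc_tm) simp
        then show ?thesis using that u(5) by (simp add: w_def)
      qed
      have "sat (expand M) e' q"
        unfolding key[OF dom']
      proof (intro conjI allI impI)
        fix l assume l: "l < N"
        have "lc X N (\<lambda>i. un_sca (e' (KK, Bv (js ! l) i))) (w e') = lc X N (B l) u"
          using B l wu by (intro lc_cong) simp
        then show "e' (VV, js ! l) = Vec (lc X N (\<lambda>i. un_sca (e' (KK, Bv (js ! l) i))) (w e'))"
          using e'V ve[OF l] u(6)[OF l] by simp
      next
        have "separated X N (\<lambda>i. pi_skel X (w e' i)) = separated X N (\<lambda>i. pi_skel X (u i))"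
          using wu by (intro separated_cong) simp
        then show "separated X N (\<lambda>i. pi_skel X (w e' i))" using u(2) by simp
      next
        show "sat M e' p'" using sat agree[of e'] by (simp add: e'_def)
      qed
      moreover have "\<forall>x. x \<notin> {KK} \<times> {m..<m'} \<longrightarrow> e' x = e x" by (simp add: e'_def)
      moreover have "\<forall>x\<in>{KK} \<times> {m..<m'}. e' x \<in> univ (expand M) (fst x)"
        unfolding XM(2) univ_expand vvs_struct_simps using dom' by (metis prod.collapse)
      ultimately show "sat (expand M) e (Exis (map (Pair KK) ns) q)"
        unfolding sat_Exis ns by blast
    qed
    then show ?thesis unfolding Q p'(3) .
  qed
  then have "equivalent (enrich L_S skel_lang)
      (expand ` (valued_spaces :: (srt, 'k fsym, rsym, ('k, 'v, 'g) elem) struct set)) p (foldr (Exi KK) ns q)"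
    unfolding equivalent_def by simp
  then show ?thesis using wf_q qf fv_Q by blast
qed

section \<open>Fixed base field\<close>

lemma L_SK_simps [simp]:
  "sorts (L_SK K) = {VV, GG, SS}" "fcod (L_SK K) = fsym_cod" "fdom (L_SK K) = fsym_dom"
  "rels (L_SK K) = {Less}" "rdom (L_SK K) = (\<lambda>r. [GG, GG])"
  "funs (L_SK K) = {AddV, ZeroV} \<union> ScalAt ` carrier K \<union> {Top, Val} \<union>
     {AddS, ZeroS} \<union> ScalSAt ` carrier K \<union> {ValS, PiS}"
  by (simp_all add: L_SK_def)

lemma skel_lang_K_simps [simp]:
  "sorts (skel_lang_K K) = {SS, GG}" "fcod (skel_lang_K K) = fsym_cod" "fdom (skel_lang_K K) = fsym_dom"
  "rels (skel_lang_K K) = {Less}" "rdom (skel_lang_K K) = (\<lambda>r. [GG, GG])"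
  "funs (skel_lang_K K) = {AddS, ZeroS} \<union> ScalSAt ` carrier K \<union> {ValS}"
  by (simp_all add: skel_lang_K_def)

lemma sublanguage_skel_lang_K: "sublanguage (skel_lang_K K) (L_SK K)"
  by (auto simp: sublanguage_def)

text \<open>Here the odd skeleton variables are slots for the values \<open>\<pi>(t)\<close> of finitely many vector terms \<open>t\<close>,
  placed by an arbitrary function \<open>loc\<close>, so that formulas with different slots can be merged.\<close>

abbreviation slot :: "((srt, 'k fsym) tm \<Rightarrow> nat) \<Rightarrow> (srt, 'k fsym) tm \<Rightarrow> (srt, 'k fsym) tm" where
  "slot loc t \<equiv> skel_var (loc t)"

fun slot_tm :: "((srt, 'k fsym) tm \<Rightarrow> nat) \<Rightarrow> (srt, 'k fsym) tm \<Rightarrow> (srt, 'k fsym) tm" where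
  "slot_tm loc (Var s n) = Var s (2 * n)"
| "slot_tm loc (App f ts) = (let us = map (slot_tm loc) ts in
     case f of PiS \<Rightarrow> slot loc (ts ! 0) | Val \<Rightarrow> tValS (slot loc (ts ! 0)) | Top \<Rightarrow> tValS tZeroS | _ \<Rightarrow> App f us)"

fun slots :: "(srt, 'k fsym) tm \<Rightarrow> (srt, 'k fsym) tm set" where
  "slots (Var s n) = {}"
| "slots (App f ts) = (if f \<in> {PiS, Val} then {ts ! 0} else (\<Union>t\<in>set ts. slots t))"

text \<open>The graph of \<open>bplus\<close>. It suffices here because the result is always a class
  already named by a slot.\<close>

definition fm_bplus :: "(srt, 'k fsym) tm \<Rightarrow> (srt, 'k fsym) tm \<Rightarrow> (srt, 'k fsym) tm \<Rightarrow> (srt, 'k fsym, rsym) fm" where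
  "fm_bplus s t u = Disj (Conj (lessS s t) (Eq u s)) (Disj (Conj (lessS t s) (Eq u t))
     (Conj (Conj (Neg (lessS s t)) (Neg (lessS t s))) (Eq u (tAddS s t))))"

text \<open>The placement \<open>loc\<close> may be non-injective: terms sharing a slot are then
  required to have the same class.\<close>

definition slotted :: "('k, 'v, 'g) vvs \<Rightarrow> (srt, 'k fsym) tm set \<Rightarrow> ((srt, 'k fsym) tm \<Rightarrow> nat) \<Rightarrow> (srt \<times> nat) set \<Rightarrow>
    (srt \<times> nat \<Rightarrow> ('k, 'v, 'g) elem) \<Rightarrow> (srt \<times> nat \<Rightarrow> ('k, 'v, 'g) elem) \<Rightarrow> bool" where
  "slotted X F loc xs e e' \<longleftrightarrow> env_ok X {VV, GG, SS} e \<and> env_ok X {SS, GG} e' \<and>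
     (\<forall>s n. (s, n) \<in> xs \<longrightarrow> s \<noteq> VV \<longrightarrow> e' (s, 2 * n) = e (s, n)) \<and>
     (\<forall>t\<in>F. e' (SS, Suc (2 * loc t)) = Ske (pi_skel X (un_vec (tm_val (vvs_struct X) e t))))"

lemma slotted_mono: "slotted X F loc xs e e' \<Longrightarrow> G \<subseteq> F \<Longrightarrow> ys \<subseteq> xs \<Longrightarrow> slotted X G loc ys e e'"
  by (auto simp: slotted_def)

lemma finite_slots: "finite (slots t)"
  by (induction t) auto

lemma slots_wf:
  assumes "wf_tm (L_SK K) t" "u \<in> slots t"
  shows "wf_tm (L_SK K) u \<and> tm_sort (L_SK K) u = VV \<and> fv_tm u \<subseteq> fv_tm t"
  using assms
proof (induction t)
  case (App f ts)
  show ?case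
  proof (cases "f \<in> {PiS, Val}")
    case True
    then show ?thesis using App.prems by (auto simp: map_eq_Cons_conv)
  next
    case False
    then obtain t where "t \<in> set ts" "u \<in> slots t" using App.prems(2) by auto
    then show ?thesis using App by auto
  qed
qed simp

lemma fv_vector_tm: "wf_tm (L_SK K) t \<Longrightarrow> tm_sort (L_SK K) t = VV \<Longrightarrow> fv_tm t \<subseteq> {VV} \<times> UNIV"
proof (induction t)
  case (App f ts)
  have "tm_sort (L_SK K) t = VV" if "t \<in> set ts" for t
    using App.prems that by (cases f) (auto simp: map_eq_Cons_conv)
  then show ?case using App by fastforce
qed simp

lemma wf_slot_tm:
  assumes "wf_tm (L_SK K) t" "tm_sort (L_SK K) t \<noteq> VV"
  shows "wf_tm (skel_lang_K K) (slot_tm loc t) \<and> tm_sort (skel_lang_K K) (slot_tm loc t) = tm_sort (L_SK K) t"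
  using assms
proof (induction t)
  case (App f ts)
  then show ?case by (cases f) (auto simp: map_eq_Cons_conv)
qed auto

context valued
begin

lemma L_SK_tm_in_dom:
  "wf_tm (L_SK K) t \<Longrightarrow> env_ok X {VV, GG, SS} e \<Longrightarrow> tm_val M e t \<in> vvs_dom X (tm_sort (L_SK K) t)"
  unfolding L_SK_def by (rule tm_in_dom) auto

lemma vector_tm_closed:
  "wf_tm (L_SK K) t \<Longrightarrow> tm_sort (L_SK K) t = VV \<Longrightarrow> env_ok X {VV, GG, SS} e \<Longrightarrow> un_vec (tm_val M e t) \<in> carrier V"
  using L_SK_tm_in_dom[of t e] by auto

lemma tm_val_slot_tm:
  assumes "wf_tm (L_SK K) t" "tm_sort (L_SK K) t \<noteq> VV" "slotted X (slots t) loc (fv_tm t) e e'"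
  shows "tm_val M e' (slot_tm loc t) = tm_val M e t"
  using assms
proof (induction t)
  case (Var s n)
  then show ?case by (simp add: slotted_def)
next
  case (App f ts)
  have ok: "env_ok X {VV, GG, SS} e" using App.prems(3) by (simp add: slotted_def)
  show ?case
  proof (cases "f \<in> {PiS, Val}")
    case True
    then obtain t where t: "ts = [t]" "wf_tm (L_SK K) t" "tm_sort (L_SK K) t = VV"
      using App.prems(1) by (auto simp: map_eq_Cons_conv)
    then have "e' (SS, Suc (2 * loc t)) = Ske (pi_skel X (un_vec (tm_val M e t)))"
      using App.prems(3) True by (auto simp: slotted_def)
    then show ?thesis using True t vector_tm_closed[OF t(2,3) ok] by auto
  next
    case False
    have "tm_val M e' (slot_tm loc t) = tm_val M e t" if "t \<in> set ts" "tm_sort (L_SK K) t \<noteq> VV" for t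
      using that App.prems False by (intro App.IH) (auto intro: slotted_mono)
    then show ?thesis using App.prems(1,2) False by (cases f) (auto simp: map_eq_Cons_conv)
  qed
qed

lemma sat_fm_bplus:
  assumes "tm_val M e s = Ske a" "tm_val M e t = Ske b" "tm_val M e u = Ske c"
  shows "sat M e (fm_bplus s t u) \<longleftrightarrow> c = bplus X a b"
  using assms irrefl less_trans[of "val_skel X a" "val_skel X b" "val_skel X a"]
  by (auto simp: fm_bplus_def bplus_def)

text \<open>Choose \<open>i\<close> such that \<open>val (v - d i)\<close> is maximal.\<close>

lemma pi_tuple:
  assumes "finite I" "I \<noteq> {}" "\<And>j. j \<in> I \<Longrightarrow> d j \<in> carrier V" "v \<in> carrier V"
  shows "\<exists>i\<in>I. \<forall>j\<in>I. pi_skel X (v \<ominus>\<^bsub>V\<^esub> d j) = bplus X (pi_skel X (v \<ominus>\<^bsub>V\<^esub> d i)) (pi_skel X (d i \<ominus>\<^bsub>V\<^esub> d j))"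
proof -
  have "\<exists>m\<in>(\<lambda>j. val X (v \<ominus>\<^bsub>V\<^esub> d j)) ` I. \<forall>a\<in>(\<lambda>j. val X (v \<ominus>\<^bsub>V\<^esub> d j)) ` I. \<not> m \<sqsubset> a"
    by (rule finite_maximal) (use assms in auto)
  then obtain i where i: "i \<in> I" "\<And>j. j \<in> I \<Longrightarrow> \<not> val X (v \<ominus>\<^bsub>V\<^esub> d i) \<sqsubset> val X (v \<ominus>\<^bsub>V\<^esub> d j)" by auto
  have "pi_skel X (v \<ominus>\<^bsub>V\<^esub> d j) = bplus X (pi_skel X (v \<ominus>\<^bsub>V\<^esub> d i)) (pi_skel X (d i \<ominus>\<^bsub>V\<^esub> d j))" if j: "j \<in> I" for j
  proof -
    have c: "d i \<in> carrier V" "d j \<in> carrier V" using assms(3) i(1) j by auto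
    have eq: "(v \<ominus>\<^bsub>V\<^esub> d i) \<oplus>\<^bsub>V\<^esub> (d i \<ominus>\<^bsub>V\<^esub> d j) = v \<ominus>\<^bsub>V\<^esub> d j"
      using c assms(4) by (simp add: a_minus_def M.a_assoc M.r_neg1)
    have "bplus X (pi_skel X (v \<ominus>\<^bsub>V\<^esub> d i)) (pi_skel X (d i \<ominus>\<^bsub>V\<^esub> d j)) =
        pi_skel X ((v \<ominus>\<^bsub>V\<^esub> d i) \<oplus>\<^bsub>V\<^esub> (d i \<ominus>\<^bsub>V\<^esub> d j))"
    proof (rule bplus_pi)
      show "\<not> val X (v \<ominus>\<^bsub>V\<^esub> d i) \<sqsubset> val X ((v \<ominus>\<^bsub>V\<^esub> d i) \<oplus>\<^bsub>V\<^esub> (d i \<ominus>\<^bsub>V\<^esub> d j))"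
        unfolding eq by (rule i(2)[OF j])
    qed (use c assms(4) in simp_all)
    then show ?thesis unfolding eq by (rule sym)
  qed
  then show ?thesis using i(1) by blast
qed

end

text \<open>An element of the field and not a term: over a fixed field, whether the variable
  \<open>n\<close> really contributes to a vector term is decided independently of structure and
  environment.\<close>

fun coeff :: "'k ring \<Rightarrow> nat \<Rightarrow> (srt, 'k fsym) tm \<Rightarrow> 'k" where
  "coeff K n (Var s m) = (if m = n then \<one>\<^bsub>K\<^esub> else \<zero>\<^bsub>K\<^esub>)"
| "coeff K n (App f ts) = (let ks = map (coeff K n) ts in
     case f of AddV \<Rightarrow> ks ! 0 \<oplus>\<^bsub>K\<^esub> ks ! 1 | ScalAt c \<Rightarrow> c \<otimes>\<^bsub>K\<^esub> ks ! 0 | _ \<Rightarrow> \<zero>\<^bsub>K\<^esub>)"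

fun rest_tm :: "nat \<Rightarrow> (srt, 'k fsym) tm \<Rightarrow> (srt, 'k fsym) tm" where
  "rest_tm n (Var s m) = (if m = n then App ZeroV [] else Var s m)"
| "rest_tm n (App f ts) = App f (map (rest_tm n) ts)"

text \<open>The vector term \<open>t\<close> is \<open>coeff K n t\<close> times the difference of the variable \<open>n\<close> and
  \<open>root_tm K n t\<close>, if the coefficient is not zero.\<close>

definition root_tm :: "'k ring \<Rightarrow> nat \<Rightarrow> (srt, 'k fsym) tm \<Rightarrow> (srt, 'k fsym) tm" where
  "root_tm K n t = App (ScalAt (\<ominus>\<^bsub>K\<^esub> (inv\<^bsub>K\<^esub> (coeff K n t)))) [rest_tm n t]"

definition minus_tm :: "'k ring \<Rightarrow> (srt, 'k fsym) tm \<Rightarrow> (srt, 'k fsym) tm \<Rightarrow> (srt, 'k fsym) tm" where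
  "minus_tm K s t = App AddV [s, App (ScalAt (\<ominus>\<^bsub>K\<^esub> \<one>\<^bsub>K\<^esub>)) [t]]"

text \<open>The slot of \<open>t\<close> is meant to hold \<pi>(c (v - d)), with c the coefficient
  and d the root of \<open>t\<close>. Division by c leaves \<pi>(v - d).\<close>

definition monic_slot :: "'k ring \<Rightarrow> nat \<Rightarrow> ((srt, 'k fsym) tm \<Rightarrow> nat) \<Rightarrow> (srt, 'k fsym) tm \<Rightarrow> (srt, 'k fsym) tm" where
  "monic_slot K n loc t = App (ScalSAt (inv\<^bsub>K\<^esub> (coeff K n t))) [slot loc t]"

text \<open>The term \<open>s\<close> is the one for which v minus its root has maximal value.
  Classes of terms involving v are read through \<open>loc\<close>, those of differences of roots,
  which are free of v, through \<open>loc'\<close>.\<close>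

definition realizable :: "'k ring \<Rightarrow> nat \<Rightarrow> ((srt, 'k fsym) tm \<Rightarrow> nat) \<Rightarrow> ((srt, 'k fsym) tm \<Rightarrow> nat) \<Rightarrow>
    (srt, 'k fsym) tm list \<Rightarrow> (srt, 'k fsym, rsym) fm" where
  "realizable K n loc loc' ts = Disjs (map (\<lambda>s. Conjs (map (\<lambda>t.
     Conj (fm_in_pi (monic_slot K n loc t))
       (fm_bplus (monic_slot K n loc s) (slot loc' (minus_tm K (root_tm K n s) (root_tm K n t))) (monic_slot K n loc t))) ts)) ts)"

lemma coeff_closed:
  assumes "field K" "wf_tm (L_SK K) t" "tm_sort (L_SK K) t = VV" shows "coeff K n t \<in> carrier K"
  using assms(2,3)
proof (induction t)
  case (Var s m)
  interpret field K by (rule assms(1))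
  show ?case by simp
next
  case (App f ts)
  interpret field K by (rule assms(1))
  show ?case using App by (cases f) (auto simp: map_eq_Cons_conv)
qed

lemma wf_rest_tm:
  assumes "wf_tm (L_SK K) t" "tm_sort (L_SK K) t = VV"
  shows "wf_tm (L_SK K) (rest_tm n t) \<and> tm_sort (L_SK K) (rest_tm n t) = VV \<and> fv_tm (rest_tm n t) \<subseteq> fv_tm t - {(VV, n)}"
  using assms
proof (induction t)
  case (App f ts)
  consider a b where "f = AddV" "ts = [a, b]" "tm_sort (L_SK K) a = VV" "tm_sort (L_SK K) b = VV" "wf_tm (L_SK K) a" "wf_tm (L_SK K) b"
    | "f = ZeroV" "ts = []"
    | k a where "f = ScalAt k" "k \<in> carrier K" "ts = [a]" "tm_sort (L_SK K) a = VV" "wf_tm (L_SK K) a"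
    using App.prems by (cases f) (auto simp: map_eq_Cons_conv)
  then show ?case
  proof cases
    case 1
    then show ?thesis using App.IH[of a] App.IH[of b] by auto
  next
    case 2
    then show ?thesis by simp
  next
    case 3
    then show ?thesis using App.IH[of a] by auto
  qed
qed auto

lemma inv_closed:
  assumes "field K" "c \<in> carrier K" "c \<noteq> \<zero>\<^bsub>K\<^esub>"
  shows "inv\<^bsub>K\<^esub> c \<in> carrier K" "inv\<^bsub>K\<^esub> c \<otimes>\<^bsub>K\<^esub> c = \<one>\<^bsub>K\<^esub>" "c \<otimes>\<^bsub>K\<^esub> inv\<^bsub>K\<^esub> c = \<one>\<^bsub>K\<^esub>"
proof -
  interpret field K by (rule assms(1))
  show "inv\<^bsub>K\<^esub> c \<in> carrier K" "inv\<^bsub>K\<^esub> c \<otimes>\<^bsub>K\<^esub> c = \<one>\<^bsub>K\<^esub>" "c \<otimes>\<^bsub>K\<^esub> inv\<^bsub>K\<^esub> c = \<one>\<^bsub>K\<^esub>"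
    using assms(2,3) by (simp_all add: field_Units)
qed

lemma wf_root_tm:
  assumes "field K" "wf_tm (L_SK K) t" "tm_sort (L_SK K) t = VV" "coeff K n t \<noteq> \<zero>\<^bsub>K\<^esub>"
  shows "wf_tm (L_SK K) (root_tm K n t) \<and> tm_sort (L_SK K) (root_tm K n t) = VV \<and> fv_tm (root_tm K n t) \<subseteq> fv_tm t - {(VV, n)}"
proof -
  interpret field K by (rule assms(1))
  show ?thesis
    using wf_rest_tm[OF assms(2,3), of n] inv_closed(1)[OF assms(1) coeff_closed[OF assms(1-3)] assms(4)]
    by (auto simp: root_tm_def)
qed

lemma wf_minus_tm:
  assumes "field K" "wf_tm (L_SK K) s \<and> tm_sort (L_SK K) s = VV" "wf_tm (L_SK K) t \<and> tm_sort (L_SK K) t = VV"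
  shows "wf_tm (L_SK K) (minus_tm K s t) \<and> tm_sort (L_SK K) (minus_tm K s t) = VV"
proof -
  interpret field K by (rule assms(1))
  show ?thesis using assms(2,3) by (auto simp: minus_tm_def)
qed

lemma fv_minus_tm [simp]: "fv_tm (minus_tm K s t) = fv_tm s \<union> fv_tm t"
  by (simp add: minus_tm_def)

lemma wf_realizable:
  assumes "field K" "\<And>t. t \<in> set ts \<Longrightarrow> wf_tm (L_SK K) t \<and> tm_sort (L_SK K) t = VV \<and> coeff K n t \<noteq> \<zero>\<^bsub>K\<^esub>"
  shows "wf_fm (skel_lang_K K) (realizable K n loc loc' ts)"
proof -
  have "wf_tm (skel_lang_K K) (monic_slot K n loc t) \<and> tm_sort (skel_lang_K K) (monic_slot K n loc t) = SS" if "t \<in> set ts" for t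
    using inv_closed(1)[OF assms(1) coeff_closed[OF assms(1)]] assms(2)[OF that] by (simp add: monic_slot_def)
  then show ?thesis by (auto simp: realizable_def fm_bplus_def fm_in_pi_def)
qed

section \<open>One vector quantifier over a fixed field\<close>

context valued
begin

lemma split_vector_tm:
  assumes "wf_tm (L_SK K) t" "tm_sort (L_SK K) t = VV" "env_ok X {VV, GG, SS} e"
  shows "un_vec (tm_val M e t) = coeff K n t \<odot>\<^bsub>V\<^esub> un_vec (e (VV, n)) \<oplus>\<^bsub>V\<^esub> un_vec (tm_val M e (rest_tm n t))"
  using assms(1,2)
proof (induction t)
  case (Var s m)
  have "un_vec (e (VV, l)) \<in> carrier V" for l using env_okD[OF assms(3), of VV l] by auto
  then show ?case using Var by simp
next
  case (App f ts)
  have n: "un_vec (e (VV, n)) \<in> carrier V" using env_okD[OF assms(3), of VV n] by auto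
  have c: "coeff K n t \<in> carrier K" if "wf_tm (L_SK K) t" "tm_sort (L_SK K) t = VV" for t
    using coeff_closed[OF R.field_axioms that] .
  have r: "un_vec (tm_val M e (rest_tm n t)) \<in> carrier V" if "wf_tm (L_SK K) t" "tm_sort (L_SK K) t = VV" for t
    using vector_tm_closed[OF _ _ assms(3)] wf_rest_tm[OF that] by blast
  consider a b where "f = AddV" "ts = [a, b]" "tm_sort (L_SK K) a = VV" "tm_sort (L_SK K) b = VV" "wf_tm (L_SK K) a" "wf_tm (L_SK K) b"
    | "f = ZeroV" "ts = []"
    | k a where "f = ScalAt k" "k \<in> carrier K" "ts = [a]" "tm_sort (L_SK K) a = VV" "wf_tm (L_SK K) a"
    using App.prems by (cases f) (auto simp: map_eq_Cons_conv)
  then show ?case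
  proof cases
    case 1
    then show ?thesis using App.IH[of a] App.IH[of b] c[of a] c[of b] r[of a] r[of b] n
      by (simp add: smult_l_distr M.a_ac)
  next
    case 2
    then show ?thesis using n by simp
  next
    case 3
    then show ?thesis using App.IH[of a] c[of a] r[of a] n
      by (simp add: smult_r_distr smult_assoc1)
  qed
qed

lemma tm_val_minus_tm:
  assumes "un_vec (tm_val M e s) \<in> carrier V" "un_vec (tm_val M e t) \<in> carrier V"
  shows "un_vec (tm_val M e (minus_tm K s t)) = un_vec (tm_val M e s) \<ominus>\<^bsub>V\<^esub> un_vec (tm_val M e t)"
  using assms by (simp add: minus_tm_def smult_l_minus a_minus_def)

lemma tm_val_root_tm:
  assumes "wf_tm (L_SK K) t" "tm_sort (L_SK K) t = VV" "env_ok X {VV, GG, SS} e" "coeff K n t \<noteq> \<zero>\<^bsub>K\<^esub>"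
  shows "un_vec (tm_val M e t) = coeff K n t \<odot>\<^bsub>V\<^esub> (un_vec (e (VV, n)) \<ominus>\<^bsub>V\<^esub> un_vec (tm_val M e (root_tm K n t)))"
proof -
  have c: "coeff K n t \<in> carrier K" using coeff_closed[OF R.field_axioms assms(1,2)] .
  note i = inv_closed[OF R.field_axioms c assms(4)]
  have r: "un_vec (tm_val M e (rest_tm n t)) \<in> carrier V"
    using vector_tm_closed[OF _ _ assms(3)] wf_rest_tm[OF assms(1,2)] by blast
  have n: "un_vec (e (VV, n)) \<in> carrier V" using env_okD[OF assms(3), of VV n] by auto
  have "un_vec (tm_val M e (root_tm K n t)) = \<ominus>\<^bsub>V\<^esub> ((inv\<^bsub>K\<^esub> (coeff K n t)) \<odot>\<^bsub>V\<^esub> un_vec (tm_val M e (rest_tm n t)))"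
    using i r by (simp add: root_tm_def smult_l_minus)
  then show ?thesis using split_vector_tm[OF assms(1-3), of n] c i r n
    by (simp add: a_minus_def smult_r_distr flip: smult_assoc1)
qed

lemma sat_realizable:
  assumes "\<And>t. t \<in> set ts \<Longrightarrow> e (SS, Suc (2 * loc t)) = Ske (a t)"
    "\<And>s t. s \<in> set ts \<Longrightarrow> t \<in> set ts \<Longrightarrow>
      e (SS, Suc (2 * loc' (minus_tm K (root_tm K n s) (root_tm K n t)))) = Ske (b s t)"
  shows "sat M e (realizable K n loc loc' ts) \<longleftrightarrow> (\<exists>s\<in>set ts. \<forall>t\<in>set ts.
    in_pi X (scal_skel X (inv\<^bsub>K\<^esub> (coeff K n t)) (a t)) \<and>
    scal_skel X (inv\<^bsub>K\<^esub> (coeff K n t)) (a t) = bplus X (scal_skel X (inv\<^bsub>K\<^esub> (coeff K n s)) (a s)) (b s t))"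
proof -
  have n: "tm_val M e (monic_slot K n loc t) = Ske (scal_skel X (inv\<^bsub>K\<^esub> (coeff K n t)) (a t))" if "t \<in> set ts" for t
    using assms(1)[OF that] by (simp add: monic_slot_def)
  have "sat M e (fm_bplus (monic_slot K n loc s) (slot loc' (minus_tm K (root_tm K n s) (root_tm K n t))) (monic_slot K n loc t)) \<longleftrightarrow>
      scal_skel X (inv\<^bsub>K\<^esub> (coeff K n t)) (a t) = bplus X (scal_skel X (inv\<^bsub>K\<^esub> (coeff K n s)) (a s)) (b s t)"
    if "s \<in> set ts" "t \<in> set ts" for s t
    using n[OF that(1)] n[OF that(2)] assms(2)[OF that] by (intro sat_fm_bplus) simp_all
  moreover have "sat M e (fm_in_pi (monic_slot K n loc t)) \<longleftrightarrow> in_pi X (scal_skel X (inv\<^bsub>K\<^esub> (coeff K n t)) (a t))"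
    if "t \<in> set ts" for t
    using n[OF that] by (rule sat_fm_in_pi)
  ultimately show ?thesis by (simp add: realizable_def)
qed

text \<open>Only the slots of the terms in \<open>ts\<close>, which involve v, are quantified. A
  term in \<open>U\<close> has coefficient zero and keeps the slot of its \<open>rest_tm\<close>,
  whose class is already known. Disjointness prevents the new slots from overwriting those of
  \<open>F\<close>, where the differences of roots are found.\<close>

lemma sat_exists_vector:
  assumes ts: "ts \<noteq> []" "\<And>t. t \<in> set ts \<Longrightarrow> wf_tm (L_SK K) t \<and> tm_sort (L_SK K) t = VV \<and> coeff K n t \<noteq> \<zero>\<^bsub>K\<^esub>"
    and us: "\<And>t. t \<in> U \<Longrightarrow> wf_tm (L_SK K) t \<and> tm_sort (L_SK K) t = VV \<and> coeff K n t = \<zero>\<^bsub>K\<^esub>"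
    and loc: "inj_on loc (set ts)" "\<And>t. t \<in> U \<Longrightarrow> loc t = loc' (rest_tm n t)"
    and F: "F = rest_tm n ` U \<union> (\<lambda>(s, t). minus_tm K (root_tm K n s) (root_tm K n t)) ` (set ts \<times> set ts)"
    and disj: "\<And>s t. t \<in> set ts \<Longrightarrow> s \<in> F \<Longrightarrow> loc t \<noteq> loc' s"
    and enc: "slotted X F loc' (fv p - {(VV, n)}) e e'"
    and IH: "\<And>e e'. slotted X (set ts \<union> U) loc (fv p) e e' \<Longrightarrow> sat M e p \<longleftrightarrow> sat M e' \<phi>"
  shows "sat M e (Exi VV n p) \<longleftrightarrow>
    sat M e' (Exis (map (\<lambda>t. (SS, Suc (2 * loc t))) ts) (Conj (realizable K n loc loc' ts) \<phi>))"
proof -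
  let ?xs = "map (\<lambda>t. (SS, Suc (2 * loc t))) ts"
  let ?iv = "\<lambda>t. inv\<^bsub>K\<^esub> (coeff K n t)"
  define d where "d t = un_vec (tm_val M e (root_tm K n t))" for t
  have eok: "env_ok X {VV, GG, SS} e" and e'ok: "env_ok X {SS, GG} e'" using enc by (simp_all add: slotted_def)
  have wfr: "wf_tm (L_SK K) (root_tm K n t) \<and> tm_sort (L_SK K) (root_tm K n t) = VV \<and> fv_tm (root_tm K n t) \<subseteq> fv_tm t - {(VV, n)}"
    if "t \<in> set ts" for t
    using wf_root_tm[OF R.field_axioms] ts(2)[OF that] by blast
  have c: "coeff K n t \<in> carrier K" if "t \<in> set ts" for t
    using coeff_closed[OF R.field_axioms] ts(2)[OF that] by blast
  have iv: "?iv t \<in> carrier K" "?iv t \<otimes>\<^bsub>K\<^esub> coeff K n t = \<one>\<^bsub>K\<^esub>" "coeff K n t \<otimes>\<^bsub>K\<^esub> ?iv t = \<one>\<^bsub>K\<^esub>" if "t \<in> set ts" for t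
    using inv_closed[OF R.field_axioms c[OF that]] ts(2)[OF that] by blast+
  have d: "d t \<in> carrier V" if "t \<in> set ts" for t
    unfolding d_def using vector_tm_closed[OF _ _ eok] wfr[OF that] by blast
  have e1ok: "env_ok X {VV, GG, SS} (e((VV, n) := Vec v))" if "v \<in> carrier V" for v
    using eok that by (auto simp: env_ok_def)
  have val_t: "un_vec (tm_val M (e((VV, n) := Vec v)) t) = coeff K n t \<odot>\<^bsub>V\<^esub> (v \<ominus>\<^bsub>V\<^esub> d t)"
    if "t \<in> set ts" "v \<in> carrier V" for t v
  proof -
    have "tm_val M (e((VV, n) := Vec v)) (root_tm K n t) = tm_val M e (root_tm K n t)"
      using wfr[OF that(1)] by (intro tm_val_cong) auto
    then show ?thesis using tm_val_root_tm[OF _ _ e1ok[OF that(2)], of t n] ts(2)[OF that(1)] by (simp add: d_def)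
  qed
  have val_u: "un_vec (tm_val M (e((VV, n) := Vec v)) t) = un_vec (tm_val M e (rest_tm n t))"
    if "t \<in> U" "v \<in> carrier V" for t v
  proof -
    have r: "wf_tm (L_SK K) (rest_tm n t) \<and> tm_sort (L_SK K) (rest_tm n t) = VV \<and> fv_tm (rest_tm n t) \<subseteq> fv_tm t - {(VV, n)}"
      using wf_rest_tm us[OF that(1)] by blast
    then have "tm_val M (e((VV, n) := Vec v)) (rest_tm n t) = tm_val M e (rest_tm n t)"
      by (intro tm_val_cong) auto
    moreover have "un_vec (tm_val M e (rest_tm n t)) \<in> carrier V" using vector_tm_closed[OF _ _ eok] r by blast
    ultimately show ?thesis using split_vector_tm[OF _ _ e1ok[OF that(2)], of t n] us[OF that(1)] that(2) by simp
  qed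
  have slot_F: "e1 (SS, Suc (2 * loc' s)) = Ske (pi_skel X (un_vec (tm_val M e s)))"
    if "s \<in> F" "\<And>y. y \<notin> set ?xs \<Longrightarrow> e1 y = e' y" for e1 s
  proof -
    have "e1 (SS, Suc (2 * loc' s)) = e' (SS, Suc (2 * loc' s))"
    proof (rule that(2), rule notI)
      assume "(SS, Suc (2 * loc' s)) \<in> set ?xs"
      then obtain t where "t \<in> set ts" "loc t = loc' s" by auto
      then show False using disj[OF _ that(1)] by blast
    qed
    then show ?thesis using enc that(1) by (simp add: slotted_def)
  qed
  have slot_d: "e1 (SS, Suc (2 * loc' (minus_tm K (root_tm K n s) (root_tm K n t)))) = Ske (pi_skel X (d s \<ominus>\<^bsub>V\<^esub> d t))"
    if "s \<in> set ts" "t \<in> set ts" "\<And>y. y \<notin> set ?xs \<Longrightarrow> e1 y = e' y" for e1 s t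
  proof -
    have "minus_tm K (root_tm K n s) (root_tm K n t) \<in> F" unfolding F using that(1,2) by force
    from slot_F[OF this that(3)] show ?thesis
      using tm_val_minus_tm[of e "root_tm K n s" "root_tm K n t"] d[OF that(1)] d[OF that(2)] by (simp add: d_def)
  qed
  have real: "sat M e1 (realizable K n loc loc' ts) \<longleftrightarrow> (\<exists>s\<in>set ts. \<forall>t\<in>set ts.
      in_pi X (scal_skel X (?iv t) (a t)) \<and>
      scal_skel X (?iv t) (a t) = bplus X (scal_skel X (?iv s) (a s)) (pi_skel X (d s \<ominus>\<^bsub>V\<^esub> d t)))"
    if e1: "\<And>y. y \<notin> set ?xs \<Longrightarrow> e1 y = e' y" and a: "\<And>t. t \<in> set ts \<Longrightarrow> e1 (SS, Suc (2 * loc t)) = Ske (a t)" for e1 a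
  proof (rule sat_realizable)
    fix s t assume st: "s \<in> set ts" "t \<in> set ts"
    show "e1 (SS, Suc (2 * loc' (minus_tm K (root_tm K n s) (root_tm K n t)))) = Ske (pi_skel X (d s \<ominus>\<^bsub>V\<^esub> d t))"
      by (rule slot_d[OF st e1])
  qed (rule a)
  have encode: "slotted X (set ts \<union> U) loc (fv p) (e((VV, n) := Vec v)) e1"
    if v: "v \<in> carrier V" and e1: "\<And>y. y \<notin> set ?xs \<Longrightarrow> e1 y = e' y"
      "\<And>t. t \<in> set ts \<Longrightarrow> e1 (SS, Suc (2 * loc t)) = Ske (pi_skel X (coeff K n t \<odot>\<^bsub>V\<^esub> (v \<ominus>\<^bsub>V\<^esub> d t)))" for v e1
    unfolding slotted_def
  proof (intro conjI allI impI ballI)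
    show "env_ok X {VV, GG, SS} (e((VV, n) := Vec v))" by (rule e1ok[OF v])
    show "env_ok X {SS, GG} e1"
      unfolding env_ok_def
    proof (intro ballI allI)
      fix s m assume s: "s \<in> {SS, GG}"
      show "e1 (s, m) \<in> vvs_dom X s"
      proof (cases "(s, m) \<in> set ?xs")
        case True
        then obtain t where t: "t \<in> set ts" "(s, m) = (SS, Suc (2 * loc t))" by auto
        then show ?thesis using e1(2)[OF t(1)] c[OF t(1)] d[OF t(1)] v by simp
      next
        case False
        then show ?thesis using e1(1)[OF False] env_okD[OF e'ok s] by simp
      qed
    qed
    fix s m assume sm: "(s, m) \<in> fv p" "s \<noteq> VV"
    have "e1 (s, 2 * m) = e' (s, 2 * m)" by (rule e1(1)) auto
    then show "e1 (s, 2 * m) = (e((VV, n) := Vec v)) (s, m)" using enc sm by (simp add: slotted_def)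
  next
    fix t assume "t \<in> set ts \<union> U"
    then show "e1 (SS, Suc (2 * loc t)) = Ske (pi_skel X (un_vec (tm_val M (e((VV, n) := Vec v)) t)))"
    proof
      assume "t \<in> set ts"
      then show ?thesis using e1(2) val_t v by simp
    next
      assume t: "t \<in> U"
      then have "rest_tm n t \<in> F" using F by blast
      from slot_F[OF this e1(1)] show ?thesis using t loc(2) val_u v by simp
    qed
  qed
  show ?thesis
  proof
    assume "sat M e (Exi VV n p)"
    then obtain v where v: "v \<in> carrier V" "sat M (e((VV, n) := Vec v)) p" by auto
    define a where "a t = pi_skel X (coeff K n t \<odot>\<^bsub>V\<^esub> (v \<ominus>\<^bsub>V\<^esub> d t))" for t
    \<comment> \<open>Injectivity of \<open>loc\<close> on \<open>ts\<close> recovers a term from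
      its slot.\<close>
    define e1 where "e1 y = (if y \<in> set ?xs then Ske (a (inv_into (set ts) loc (snd y div 2))) else e' y)" for y
    have e1: "\<And>y. y \<notin> set ?xs \<Longrightarrow> e1 y = e' y" by (simp add: e1_def)
    have e1a: "e1 (SS, Suc (2 * loc t)) = Ske (a t)" if "t \<in> set ts" for t
      using that loc(1) by (auto simp: e1_def)
    have "slotted X (set ts \<union> U) loc (fv p) (e((VV, n) := Vec v)) e1"
      by (rule encode[OF v(1) e1]) (simp_all add: e1a a_def)
    then have \<phi>: "sat M e1 \<phi>" using IH v(2) by blast
    have sa: "scal_skel X (?iv t) (a t) = pi_skel X (v \<ominus>\<^bsub>V\<^esub> d t)" if "t \<in> set ts" for t
    proof -
      have "a t = scal_skel X (coeff K n t) (pi_skel X (v \<ominus>\<^bsub>V\<^esub> d t))"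
        unfolding a_def using scal_pi[of "coeff K n t" "v \<ominus>\<^bsub>V\<^esub> d t"] c ts(2) d v(1) that by simp
      then show ?thesis using scal_skel_inverse[OF _ iv(1) c iv(2)] d v(1) that by simp
    qed
    obtain i where i: "i \<in> set ts" "\<forall>j\<in>set ts. pi_skel X (v \<ominus>\<^bsub>V\<^esub> d j) = bplus X (pi_skel X (v \<ominus>\<^bsub>V\<^esub> d i)) (pi_skel X (d i \<ominus>\<^bsub>V\<^esub> d j))"
      using pi_tuple[of "set ts" d v] ts(1) d v(1) by auto
    have ex: "\<exists>s\<in>set ts. \<forall>t\<in>set ts. in_pi X (scal_skel X (?iv t) (a t)) \<and>
        scal_skel X (?iv t) (a t) = bplus X (scal_skel X (?iv s) (a s)) (pi_skel X (d s \<ominus>\<^bsub>V\<^esub> d t))"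
    proof (rule bexI[OF _ i(1)], intro ballI conjI)
      fix t assume t: "t \<in> set ts"
      show "in_pi X (scal_skel X (?iv t) (a t))"
        unfolding sa[OF t] by (rule in_pi_pi) (use d[OF t] v(1) in simp)
      show "scal_skel X (?iv t) (a t) = bplus X (scal_skel X (?iv i) (a i)) (pi_skel X (d i \<ominus>\<^bsub>V\<^esub> d t))"
        unfolding sa[OF t] sa[OF i(1)] using i(2) t by blast
    qed
    have "sat M e1 (realizable K n loc loc' ts)"
      by (rule iffD2[OF real[of e1 a] ex]) (use e1 e1a in simp_all)
    moreover have "\<forall>y\<in>set ?xs. e1 y \<in> univ M (fst y)"
      using e1a c d v(1) by (auto simp: a_def)
    ultimately show "sat M e' (Exis ?xs (Conj (realizable K n loc loc' ts) \<phi>))"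
      unfolding sat_Exis sat.simps(4) using \<phi> e1 by blast
  next
    assume "sat M e' (Exis ?xs (Conj (realizable K n loc loc' ts) \<phi>))"
    then obtain e1 where e1: "\<And>y. y \<notin> set ?xs \<Longrightarrow> e1 y = e' y" "\<And>y. y \<in> set ?xs \<Longrightarrow> e1 y \<in> vvs_dom X (fst y)"
      "sat M e1 (realizable K n loc loc' ts)" "sat M e1 \<phi>"
      unfolding sat_Exis sat.simps(4) vvs_struct_simps by blast
    define a where "a t = un_ske (e1 (SS, Suc (2 * loc t)))" for t
    have a: "e1 (SS, Suc (2 * loc t)) = Ske (a t)" "a t \<in> skel X" if "t \<in> set ts" for t
      using e1(2)[of "(SS, Suc (2 * loc t))"] that by (auto simp: a_def)
    have "\<exists>s\<in>set ts. \<forall>t\<in>set ts. in_pi X (scal_skel X (?iv t) (a t)) \<and>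
        scal_skel X (?iv t) (a t) = bplus X (scal_skel X (?iv s) (a s)) (pi_skel X (d s \<ominus>\<^bsub>V\<^esub> d t))"
      by (rule iffD1[OF real[of e1 a] e1(3)]) (use e1(1) a(1) in simp_all)
    then obtain i where i: "i \<in> set ts" "\<And>t. t \<in> set ts \<Longrightarrow> in_pi X (scal_skel X (?iv t) (a t))"
      "\<And>t. t \<in> set ts \<Longrightarrow> scal_skel X (?iv t) (a t) = bplus X (scal_skel X (?iv i) (a i)) (pi_skel X (d i \<ominus>\<^bsub>V\<^esub> d t))"
      by blast
    have "scal_skel X (?iv i) (a i) \<in> skel X" using a(2) iv(1) i(1) by simp
    then obtain w where w: "w \<in> carrier V" "scal_skel X (?iv i) (a i) = pi_skel X w"
      using in_pi_iff i(1,2) by blast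
    define v where "v = d i \<oplus>\<^bsub>V\<^esub> w"
    have v: "v \<in> carrier V" using w(1) d[OF i(1)] by (simp add: v_def)
    have "a t = pi_skel X (coeff K n t \<odot>\<^bsub>V\<^esub> (v \<ominus>\<^bsub>V\<^esub> d t))" if t: "t \<in> set ts" for t
    proof -
      have eq: "w \<oplus>\<^bsub>V\<^esub> (d i \<ominus>\<^bsub>V\<^esub> d t) = v \<ominus>\<^bsub>V\<^esub> d t"
        using w(1) d[OF i(1)] d[OF t] by (simp add: v_def a_minus_def M.a_ac)
      have "scal_skel X (?iv t) (a t) = bplus X (pi_skel X w) (pi_skel X (d i \<ominus>\<^bsub>V\<^esub> d t))"
        using i(3)[OF t] w(2) by simp
      \<comment> \<open>The image condition in \<open>realizable\<close> certifies that
        \<open>w\<close> and the difference of the roots do not cancel.\<close>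
      moreover from this have "in_pi X (bplus X (pi_skel X w) (pi_skel X (d i \<ominus>\<^bsub>V\<^esub> d t)))"
        using i(2)[OF t] by simp
      then have "pi_skel X (w \<oplus>\<^bsub>V\<^esub> (d i \<ominus>\<^bsub>V\<^esub> d t)) = bplus X (pi_skel X w) (pi_skel X (d i \<ominus>\<^bsub>V\<^esub> d t))"
        using w(1) d[OF i(1)] d[OF t] by (intro pi_add_if_in_pi) simp_all
      ultimately have "scal_skel X (?iv t) (a t) = pi_skel X (v \<ominus>\<^bsub>V\<^esub> d t)" unfolding eq by simp
      then have "scal_skel X (coeff K n t) (pi_skel X (v \<ominus>\<^bsub>V\<^esub> d t)) = a t"
        using scal_skel_inverse[OF a(2)[OF t] c[OF t] iv(1)[OF t] iv(3)[OF t]] by simp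
      then show ?thesis using scal_pi[of "coeff K n t" "v \<ominus>\<^bsub>V\<^esub> d t"] c[OF t] ts(2)[OF t] d[OF t] v by simp
    qed
    then have "slotted X (set ts \<union> U) loc (fv p) (e((VV, n) := Vec v)) e1"
      by (intro encode[OF v e1(1)]) (simp_all add: a(1))
    then have "sat M (e((VV, n) := Vec v)) p" using IH e1(4) by blast
    then show "sat M e (Exi VV n p)" using v by auto
  qed
qed

end

text \<open>The finite set \<open>F\<close> is fixed before \<open>loc\<close>, and \<phi> serves
  all spaces over \<open>K\<close> at once. Leaving \<open>loc\<close> free lets a conjunction use
  one placement for both parts, and lets a vector quantifier prescribe the placement for its
  body.\<close>

lemma translate_L_SK:
  fixes K :: "'k ring" and p :: "(srt, 'k fsym, rsym) fm"
  assumes K: "field K" and "wf_fm (L_SK K) p"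
  shows "\<exists>F. finite F \<and> (\<forall>t\<in>F. wf_tm (L_SK K) t \<and> tm_sort (L_SK K) t = VV \<and> fv_tm t \<subseteq> fv p) \<and>
    (\<forall>loc. \<exists>\<phi>. wf_fm (skel_lang_K K) \<phi> \<and>
      (\<forall>(X :: ('k, 'v, 'g) vvs) e e'. valued_vector_space X \<longrightarrow> scalars X = K \<longrightarrow>
        slotted X F loc (fv p) e e' \<longrightarrow> sat (vvs_struct X) e p = sat (vvs_struct X) e' \<phi>))"
  using assms(2)
proof (induction p)
  case (Eq t u)
  then have wf: "wf_tm (L_SK K) t" "wf_tm (L_SK K) u" "tm_sort (L_SK K) u = tm_sort (L_SK K) t" by simp_all
  show ?case
  proof (cases "tm_sort (L_SK K) t = VV")
    case True
    \<comment> \<open>Equality of vectors becomes \<pi>(t - u) = 0.\<close>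
    let ?d = "minus_tm K t u"
    have d: "wf_tm (L_SK K) ?d \<and> tm_sort (L_SK K) ?d = VV" using wf_minus_tm[OF K] wf True by simp
    have "sat (vvs_struct X) e (Eq t u) = sat (vvs_struct X) e' (Eq (slot loc ?d) tZeroS)"
      if X: "valued_vector_space X" "scalars X = K" and sl: "slotted X {?d} loc (fv (Eq t u)) e e'"
      for X :: "('k, 'v, 'g) vvs" and e e' loc
    proof -
      interpret V: valued X by unfold_locales (rule X(1))
      have ok: "env_ok X {VV, GG, SS} e" using sl by (simp add: slotted_def)
      have dom: "tm_val (vvs_struct X) e t \<in> Vec ` carrier V.V" "tm_val (vvs_struct X) e u \<in> Vec ` carrier V.V"
        using V.L_SK_tm_in_dom[OF _ ok, unfolded X(2), of t] V.L_SK_tm_in_dom[OF _ ok, unfolded X(2), of u] wf True by simp_all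
      then obtain a b where ab: "tm_val (vvs_struct X) e t = Vec a" "tm_val (vvs_struct X) e u = Vec b"
        "a \<in> carrier V.V" "b \<in> carrier V.V" by auto
      have "un_vec (tm_val (vvs_struct X) e ?d) = a \<ominus>\<^bsub>V.V\<^esub> b"
        using V.tm_val_minus_tm[of e t u, unfolded X(2)] ab by simp
      then have "sat (vvs_struct X) e' (Eq (slot loc ?d) tZeroS) \<longleftrightarrow> a \<ominus>\<^bsub>V.V\<^esub> b = \<zero>\<^bsub>V.V\<^esub>"
        using sl V.pi_eq_zero[of "a \<ominus>\<^bsub>V.V\<^esub> b"] ab by (simp add: slotted_def)
      also have "\<dots> \<longleftrightarrow> a = b"
        using V.minus_add[OF ab(3,4)] ab by (auto simp: a_minus_def V.M.r_neg)
      finally show ?thesis using ab by simp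
    qed
    moreover have "wf_fm (skel_lang_K K) (Eq (slot loc ?d) tZeroS)" for loc :: "(srt, 'k fsym) tm \<Rightarrow> nat" by simp
    moreover have "fv_tm ?d \<subseteq> fv (Eq t u)" by simp
    ultimately show ?thesis using d by (intro exI[of _ "{?d}"]) blast
  next
    case False
    let ?F = "slots t \<union> slots u"
    have "sat (vvs_struct X) e (Eq t u) = sat (vvs_struct X) e' (Eq (slot_tm loc t) (slot_tm loc u))"
      if X: "valued_vector_space X" "scalars X = K" and sl: "slotted X ?F loc (fv (Eq t u)) e e'"
      for X :: "('k, 'v, 'g) vvs" and e e' loc
    proof -
      interpret V: valued X by unfold_locales (rule X(1))
      have "slotted X (slots t) loc (fv_tm t) e e'" "slotted X (slots u) loc (fv_tm u) e e'"
        using sl by (auto intro: slotted_mono)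
      then show ?thesis using V.tm_val_slot_tm[unfolded X(2), of t loc e e'] V.tm_val_slot_tm[unfolded X(2), of u loc e e'] wf False
        by simp
    qed
    moreover have "wf_fm (skel_lang_K K) (Eq (slot_tm loc t) (slot_tm loc u))" for loc
      using wf_slot_tm[of K t loc] wf_slot_tm[of K u loc] wf False by simp
    moreover have "\<forall>v\<in>?F. wf_tm (L_SK K) v \<and> tm_sort (L_SK K) v = VV \<and> fv_tm v \<subseteq> fv (Eq t u)"
      using slots_wf[OF wf(1)] slots_wf[OF wf(2)] by auto
    ultimately show ?thesis using finite_slots by (intro exI[of _ ?F]) blast
  qed
next
  case (Rel R ts)
  then obtain t u where ts: "ts = [t, u]" and wf: "wf_tm (L_SK K) t" "wf_tm (L_SK K) u"
    "tm_sort (L_SK K) t = GG" "tm_sort (L_SK K) u = GG" by (auto simp: map_eq_Cons_conv)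
  let ?F = "slots t \<union> slots u"
  have "sat (vvs_struct X) e (Rel R ts) = sat (vvs_struct X) e' (Rel R [slot_tm loc t, slot_tm loc u])"
    if X: "valued_vector_space X" "scalars X = K" and sl: "slotted X ?F loc (fv (Rel R ts)) e e'"
    for X :: "('k, 'v, 'g) vvs" and e e' loc
  proof -
    interpret V: valued X by unfold_locales (rule X(1))
    have "slotted X (slots t) loc (fv_tm t) e e'" "slotted X (slots u) loc (fv_tm u) e e'"
      using sl ts by (auto intro: slotted_mono)
    then show ?thesis using V.tm_val_slot_tm[unfolded X(2), of t loc e e'] V.tm_val_slot_tm[unfolded X(2), of u loc e e'] wf ts
      by simp
  qed
  moreover have "wf_fm (skel_lang_K K) (Rel R [slot_tm loc t, slot_tm loc u])" for loc
    using wf_slot_tm[of K t loc] wf_slot_tm[of K u loc] wf Rel.prems by simp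
  moreover have "\<forall>v\<in>?F. wf_tm (L_SK K) v \<and> tm_sort (L_SK K) v = VV \<and> fv_tm v \<subseteq> fv (Rel R ts)"
    using slots_wf[OF wf(1)] slots_wf[OF wf(2)] ts by auto
  ultimately show ?case using finite_slots by (intro exI[of _ ?F]) blast
next
  case (Neg p)
  then have "wf_fm (L_SK K) p" by simp
  from Neg.IH[OF this] obtain F where F: "finite F"
    "\<forall>t\<in>F. wf_tm (L_SK K) t \<and> tm_sort (L_SK K) t = VV \<and> fv_tm t \<subseteq> fv p"
    "\<And>loc. \<exists>\<phi>. wf_fm (skel_lang_K K) \<phi> \<and> (\<forall>(X :: ('k, 'v, 'g) vvs) e e'. valued_vector_space X \<longrightarrow>
      scalars X = K \<longrightarrow> slotted X F loc (fv p) e e' \<longrightarrow> sat (vvs_struct X) e p = sat (vvs_struct X) e' \<phi>)" by blast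
  show ?case
  proof (intro exI[of _ F] conjI allI)
    fix loc
    obtain \<phi> where "wf_fm (skel_lang_K K) \<phi>" "\<forall>(X :: ('k, 'v, 'g) vvs) e e'. valued_vector_space X \<longrightarrow>
      scalars X = K \<longrightarrow> slotted X F loc (fv p) e e' \<longrightarrow> sat (vvs_struct X) e p = sat (vvs_struct X) e' \<phi>"
      using F(3)[of loc] by blast
    then show "\<exists>\<phi>. wf_fm (skel_lang_K K) \<phi> \<and> (\<forall>(X :: ('k, 'v, 'g) vvs) e e'. valued_vector_space X \<longrightarrow>
      scalars X = K \<longrightarrow> slotted X F loc (fv (Neg p)) e e' \<longrightarrow> sat (vvs_struct X) e (Neg p) = sat (vvs_struct X) e' \<phi>)"
      by (intro exI[of _ "Neg \<phi>"]) simp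
  qed (use F in simp_all)
next
  case (Conj p q)
  then have wf: "wf_fm (L_SK K) p" "wf_fm (L_SK K) q" by simp_all
  from Conj.IH(1)[OF wf(1)] obtain F where F: "finite F"
    "\<forall>t\<in>F. wf_tm (L_SK K) t \<and> tm_sort (L_SK K) t = VV \<and> fv_tm t \<subseteq> fv p"
    "\<And>loc. \<exists>\<phi>. wf_fm (skel_lang_K K) \<phi> \<and> (\<forall>(X :: ('k, 'v, 'g) vvs) e e'. valued_vector_space X \<longrightarrow>
      scalars X = K \<longrightarrow> slotted X F loc (fv p) e e' \<longrightarrow> sat (vvs_struct X) e p = sat (vvs_struct X) e' \<phi>)" by blast
  from Conj.IH(2)[OF wf(2)] obtain G where G: "finite G"
    "\<forall>t\<in>G. wf_tm (L_SK K) t \<and> tm_sort (L_SK K) t = VV \<and> fv_tm t \<subseteq> fv q"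
    "\<And>loc. \<exists>\<phi>. wf_fm (skel_lang_K K) \<phi> \<and> (\<forall>(X :: ('k, 'v, 'g) vvs) e e'. valued_vector_space X \<longrightarrow>
      scalars X = K \<longrightarrow> slotted X G loc (fv q) e e' \<longrightarrow> sat (vvs_struct X) e q = sat (vvs_struct X) e' \<phi>)" by blast
  show ?case
  proof (intro exI[of _ "F \<union> G"] conjI allI)
    fix loc
    obtain \<phi> where \<phi>: "wf_fm (skel_lang_K K) \<phi>" "\<And>(X :: ('k, 'v, 'g) vvs) e e'. valued_vector_space X \<Longrightarrow>
      scalars X = K \<Longrightarrow> slotted X F loc (fv p) e e' \<Longrightarrow> sat (vvs_struct X) e p = sat (vvs_struct X) e' \<phi>"
      using F(3)[of loc] by blast
    obtain \<psi> where \<psi>: "wf_fm (skel_lang_K K) \<psi>" "\<And>(X :: ('k, 'v, 'g) vvs) e e'. valued_vector_space X \<Longrightarrow>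
      scalars X = K \<Longrightarrow> slotted X G loc (fv q) e e' \<Longrightarrow> sat (vvs_struct X) e q = sat (vvs_struct X) e' \<psi>"
      using G(3)[of loc] by blast
    have "sat (vvs_struct X) e (Conj p q) = sat (vvs_struct X) e' (Conj \<phi> \<psi>)"
      if "valued_vector_space X" "scalars X = K" "slotted X (F \<union> G) loc (fv (Conj p q)) e e'" for X :: "('k, 'v, 'g) vvs" and e e'
    proof -
      have "slotted X F loc (fv p) e e'" "slotted X G loc (fv q) e e'" using that(3) by (auto intro: slotted_mono)
      then show ?thesis using \<phi>(2)[OF that(1,2)] \<psi>(2)[OF that(1,2)] by simp
    qed
    moreover have "wf_fm (skel_lang_K K) (Conj \<phi> \<psi>)" using \<phi>(1) \<psi>(1) by simp
    ultimately show "\<exists>\<phi>. wf_fm (skel_lang_K K) \<phi> \<and> (\<forall>(X :: ('k, 'v, 'g) vvs) e e'. valued_vector_space X \<longrightarrow>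
      scalars X = K \<longrightarrow> slotted X (F \<union> G) loc (fv (Conj p q)) e e' \<longrightarrow> sat (vvs_struct X) e (Conj p q) = sat (vvs_struct X) e' \<phi>)"
      by blast
  qed (use F G in auto)
next
  case (Exi s n p)
  then have "wf_fm (L_SK K) p" and s: "s \<in> {VV, GG, SS}" by simp_all
  from Exi.IH[OF this(1)] obtain F where F: "finite F"
    "\<And>t. t \<in> F \<Longrightarrow> wf_tm (L_SK K) t \<and> tm_sort (L_SK K) t = VV \<and> fv_tm t \<subseteq> fv p"
    "\<And>loc. \<exists>\<phi>. wf_fm (skel_lang_K K) \<phi> \<and> (\<forall>(X :: ('k, 'v, 'g) vvs) e e'. valued_vector_space X \<longrightarrow>
      scalars X = K \<longrightarrow> slotted X F loc (fv p) e e' \<longrightarrow> sat (vvs_struct X) e p = sat (vvs_struct X) e' \<phi>)" by blast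
  show ?case
  proof (cases "s = VV")
    case False
    \<comment> \<open>As scalars are symbols, vector terms contain vector variables only, so a
      quantifier over another sort leaves all slots unchanged. This is what fails when the scalars
      form a sort.\<close>
    have Fv: "fv_tm t \<subseteq> {VV} \<times> UNIV" if "t \<in> F" for t using fv_vector_tm F(2)[OF that] by blast
    show ?thesis
    proof (intro exI[of _ F] conjI allI ballI)
      fix t assume t: "t \<in> F"
      show "wf_tm (L_SK K) t" "tm_sort (L_SK K) t = VV" using F(2)[OF t] by blast+
      show "fv_tm t \<subseteq> fv (Exi s n p)" using F(2)[OF t] Fv[OF t] False by auto
    next
      fix loc
      obtain \<phi> where \<phi>: "wf_fm (skel_lang_K K) \<phi>" "\<And>(X :: ('k, 'v, 'g) vvs) e e'. valued_vector_space X \<Longrightarrow>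
        scalars X = K \<Longrightarrow> slotted X F loc (fv p) e e' \<Longrightarrow> sat (vvs_struct X) e p = sat (vvs_struct X) e' \<phi>"
        using F(3)[of loc] by blast
      have "sat (vvs_struct X) e (Exi s n p) = sat (vvs_struct X) e' (Exi s (2 * n) \<phi>)"
        if X: "valued_vector_space X" "scalars X = K" and sl: "slotted X F loc (fv (Exi s n p)) e e'" for X :: "('k, 'v, 'g) vvs" and e e'
      proof -
        have "sat (vvs_struct X) (e((s, n) := a)) p = sat (vvs_struct X) (e'((s, 2 * n) := a)) \<phi>"
          if a: "a \<in> vvs_dom X s" for a
        proof (rule \<phi>(2)[OF X])
          have "tm_val (vvs_struct X) (e((s, n) := a)) t = tm_val (vvs_struct X) e t" if "t \<in> F" for t
            by (rule tm_val_cong) (use Fv[OF that] False in auto)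
          then show "slotted X F loc (fv p) (e((s, n) := a)) (e'((s, 2 * n) := a))"
            using sl a by (auto simp: slotted_def env_ok_def)
        qed
        then show ?thesis by simp
      qed
      moreover have "wf_fm (skel_lang_K K) (Exi s (2 * n) \<phi>)" using \<phi>(1) s False by auto
      ultimately show "\<exists>\<phi>. wf_fm (skel_lang_K K) \<phi> \<and> (\<forall>(X :: ('k, 'v, 'g) vvs) e e'. valued_vector_space X \<longrightarrow>
        scalars X = K \<longrightarrow> slotted X F loc (fv (Exi s n p)) e e' \<longrightarrow>
        sat (vvs_struct X) e (Exi s n p) = sat (vvs_struct X) e' \<phi>)" by blast
    qed (rule F(1))
  next
    case True
    \<comment> \<open>Including the variable itself ensures that some term has a nonzero
      coefficient, as \<open>pi_tuple\<close> requires a nonempty index set.\<close>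
    define G where "G = insert (Var VV n) F"
    define U where "U = {t \<in> G. coeff K n t = \<zero>\<^bsub>K\<^esub>}"
    have G: "wf_tm (L_SK K) t \<and> tm_sort (L_SK K) t = VV" "fv_tm t - {(VV, n)} \<subseteq> fv p - {(VV, n)}" if "t \<in> G" for t
      using that F(2)[of t] by (auto simp: G_def)
    have "finite {t \<in> G. coeff K n t \<noteq> \<zero>\<^bsub>K\<^esub>}" using F(1) by (simp add: G_def)
    then obtain ts where ts: "set ts = {t \<in> G. coeff K n t \<noteq> \<zero>\<^bsub>K\<^esub>}" using finite_list by blast
    have tsU: "set ts \<union> U = G" using ts by (auto simp: U_def)
    have "\<one>\<^bsub>K\<^esub> \<noteq> \<zero>\<^bsub>K\<^esub>" using K by (simp add: domain.one_not_zero field.axioms(1))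
    then have "Var VV n \<in> set ts" using ts by (simp add: G_def)
    then have ts_ne: "ts \<noteq> []" by auto
    have tsG: "wf_tm (L_SK K) t \<and> tm_sort (L_SK K) t = VV \<and> coeff K n t \<noteq> \<zero>\<^bsub>K\<^esub>" if "t \<in> set ts" for t
      using that ts G(1) by auto
    have UG: "wf_tm (L_SK K) t \<and> tm_sort (L_SK K) t = VV \<and> coeff K n t = \<zero>\<^bsub>K\<^esub>" if "t \<in> U" for t
      using that G(1) by (auto simp: U_def)
    define F' where "F' = rest_tm n ` U \<union> (\<lambda>(s, t). minus_tm K (root_tm K n s) (root_tm K n t)) ` (set ts \<times> set ts)"
    have finF': "finite F'" using F(1) by (simp add: F'_def U_def G_def)
    show ?thesis
    proof (intro exI[of _ F'] conjI allI)
      show "finite F'" by (rule finF')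
      show "\<forall>t\<in>F'. wf_tm (L_SK K) t \<and> tm_sort (L_SK K) t = VV \<and> fv_tm t \<subseteq> fv (Exi s n p)"
      proof
        fix t assume "t \<in> F'"
        then consider u where "u \<in> U" "t = rest_tm n u"
          | u v where "u \<in> set ts" "v \<in> set ts" "t = minus_tm K (root_tm K n u) (root_tm K n v)"
          by (auto simp: F'_def)
        then show "wf_tm (L_SK K) t \<and> tm_sort (L_SK K) t = VV \<and> fv_tm t \<subseteq> fv (Exi s n p)"
        proof cases
          case 1
          then have "u \<in> G" by (simp add: U_def)
          then show ?thesis using 1 wf_rest_tm[of K u n] G[of u] True by auto
        next
          case 2
          have r: "wf_tm (L_SK K) (root_tm K n u) \<and> tm_sort (L_SK K) (root_tm K n u) = VV \<and> fv_tm (root_tm K n u) \<subseteq> fv p - {(VV, n)}"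
            if "u \<in> set ts" for u
            using wf_root_tm[OF K, of u n] tsG[OF that] G(2)[of u] that ts by blast
          show ?thesis
            using r[OF 2(1)] r[OF 2(2)] 2(3) wf_minus_tm[OF K, of "root_tm K n u" "root_tm K n v"] True by auto
        qed
      qed
      fix loc' :: "(srt, 'k fsym) tm \<Rightarrow> nat"
      obtain B where B: "\<And>s. s \<in> F' \<Longrightarrow> loc' s < B"
        using finF' finite_nat_set_iff_bounded[of "loc' ` F'"] by auto
      obtain ix :: "(srt, 'k fsym) tm \<Rightarrow> nat" where ix: "inj_on ix (set ts)"
        using finite_imp_inj_to_nat_seg[of "set ts"] by auto
      \<comment> \<open>Terms without v reuse the slots prescribed by \<open>loc'\<close>; the
        offset \<open>B\<close> moves the others beyond all slots of \<open>F'\<close>.\<close>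
      define loc where "loc t = (if coeff K n t = \<zero>\<^bsub>K\<^esub> then loc' (rest_tm n t) else B + ix t)" for t
      have loc: "inj_on loc (set ts)" "\<And>t. t \<in> U \<Longrightarrow> loc t = loc' (rest_tm n t)" "\<And>s t. t \<in> set ts \<Longrightarrow> s \<in> F' \<Longrightarrow> loc t \<noteq> loc' s"
      proof -
        show "inj_on loc (set ts)" using ix ts by (auto simp: inj_on_def loc_def)
        show "loc t = loc' (rest_tm n t)" if "t \<in> U" for t using that by (simp add: U_def loc_def)
        show "loc t \<noteq> loc' s" if "t \<in> set ts" "s \<in> F'" for s t using B[OF that(2)] that(1) ts by (auto simp: loc_def)
      qed
      obtain \<phi> where \<phi>: "wf_fm (skel_lang_K K) \<phi>" "\<And>(X :: ('k, 'v, 'g) vvs) e e'. valued_vector_space X \<Longrightarrow>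
        scalars X = K \<Longrightarrow> slotted X F loc (fv p) e e' \<Longrightarrow> sat (vvs_struct X) e p = sat (vvs_struct X) e' \<phi>"
        using F(3)[of loc] by blast
      let ?\<psi> = "Exis (map (\<lambda>t. (SS, Suc (2 * loc t))) ts) (Conj (realizable K n loc loc' ts) \<phi>)"
      have "sat (vvs_struct X) e (Exi s n p) = sat (vvs_struct X) e' ?\<psi>"
        if X: "valued_vector_space X" "scalars X = K" and sl: "slotted X F' loc' (fv (Exi s n p)) e e'" for X :: "('k, 'v, 'g) vvs" and e e'
      proof -
        interpret V: valued X by unfold_locales (rule X(1))
        show ?thesis unfolding True
        proof (rule V.sat_exists_vector[unfolded X(2)])
          show "slotted X F' loc' (fv p - {(VV, n)}) e e'" using sl True by simp
          fix e e' assume "slotted X (set ts \<union> U) loc (fv p) e e'"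
          then have "slotted X F loc (fv p) e e'" unfolding tsU by (rule slotted_mono) (auto simp: G_def)
          then show "sat (vvs_struct X) e p \<longleftrightarrow> sat (vvs_struct X) e' \<phi>" by (rule \<phi>(2)[OF X])
        qed (use ts_ne tsG UG loc F'_def in blast)+
      qed
      moreover have "wf_fm (skel_lang_K K) ?\<psi>"
        using \<phi>(1) wf_realizable[OF K tsG] by (auto simp: wf_Exis)
      ultimately show "\<exists>\<phi>. wf_fm (skel_lang_K K) \<phi> \<and> (\<forall>(X :: ('k, 'v, 'g) vvs) e e'. valued_vector_space X \<longrightarrow>
        scalars X = K \<longrightarrow> slotted X F' loc' (fv (Exi s n p)) e e' \<longrightarrow>
        sat (vvs_struct X) e (Exi s n p) = sat (vvs_struct X) e' \<phi>)" by blast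
    qed
  qed
qed

text \<open>With \<pi>(t) substituted for the slot of each \<open>t\<close> in \<open>F\<close>, the
  whole skeleton formula becomes one predicate. The coefficients are part of the terms, so nothing
  is left to be guessed by a quantifier.\<close>

lemma eliminate_L_SK:
  fixes K :: "'k ring" and p :: "(srt, 'k fsym, (srt, 'k fsym, rsym) esym) fm"
  assumes K: "field K" and p: "wf_fm (enrich (L_SK K) (skel_lang_K K)) p"
  shows "\<exists>q. wf_fm (enrich (L_SK K) (skel_lang_K K)) q \<and> qfree q \<and> fv q \<subseteq> fv p \<and>
    equivalent (enrich (L_SK K) (skel_lang_K K))
      (expand ` (valued_spaces_over K :: (srt, 'k fsym, rsym, ('k, 'v, 'g) elem) struct set)) p q"
proof -
  obtain p' where p': "wf_fm (L_SK K) p'" "fv p' \<subseteq> fv p"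
    "\<And>(M :: (srt, 'k fsym, rsym, ('k, 'v, 'g) elem) struct) e. sat M e p' = sat (expand M) e p"
    using unenrich[OF sublanguage_skel_lang_K p] by blast
  obtain F where F: "finite F"
    "\<And>t. t \<in> F \<Longrightarrow> wf_tm (L_SK K) t \<and> tm_sort (L_SK K) t = VV \<and> fv_tm t \<subseteq> fv p'"
    "\<And>loc. \<exists>\<phi>. wf_fm (skel_lang_K K) \<phi> \<and> (\<forall>(X :: ('k, 'v, 'g) vvs) e e'. valued_vector_space X \<longrightarrow>
      scalars X = K \<longrightarrow> slotted X F loc (fv p') e e' \<longrightarrow> sat (vvs_struct X) e p' = sat (vvs_struct X) e' \<phi>)"
    using translate_L_SK[OF K p'(1)] by blast
  \<comment> \<open>Here the slot has to determine its term, because the class of the term is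
    substituted for it.\<close>
  obtain loc :: "(srt, 'k fsym) tm \<Rightarrow> nat" where loc: "inj_on loc F"
    using finite_imp_inj_to_nat_seg[OF F(1)] by auto
  obtain \<phi> where \<phi>: "wf_fm (skel_lang_K K) \<phi>" "\<And>(X :: ('k, 'v, 'g) vvs) e e'. valued_vector_space X \<Longrightarrow>
    scalars X = K \<Longrightarrow> slotted X F loc (fv p') e e' \<Longrightarrow> sat (vvs_struct X) e p' = sat (vvs_struct X) e' \<phi>"
    using F(3)[of loc] by blast
  define \<sigma> where "\<sigma> x = (if even (snd x)
      then if (fst x, snd x div 2) \<in> fv p' then Var (fst x) (snd x div 2) else default_tm (fst x)
      else if fst x = SS \<and> snd x div 2 \<in> loc ` F then App PiS [inv_into F loc (snd x div 2)]
      else default_tm (fst x))" for x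
  have default_tm: "wf_tm (L_SK K) (default_tm s) \<and> tm_sort (L_SK K) (default_tm s) = s" if "s \<noteq> KK" for s
    using that by (cases s) auto
  have inv: "inv_into F loc m \<in> F" if "m \<in> loc ` F" for m using that by (rule inv_into_into)
  have wf_\<sigma>: "wf_tm (L_SK K) (\<sigma> x) \<and> tm_sort (L_SK K) (\<sigma> x) = fst x" if "fst x \<in> {SS, GG}" for x
    using that default_tm[of "fst x"] F(2)[OF inv, of "snd x div 2"] by (auto simp: \<sigma>_def simp del: default_tm.simps)
  have fv_\<sigma>: "fv_tm (\<sigma> x) \<subseteq> fv p'" for x
    using F(2)[OF inv, of "snd x div 2"] by (auto simp: \<sigma>_def)
  have "fst x \<in> {SS, GG}" if "x \<in> fv \<phi>" for x using wf_fm_fv_sorts[OF \<phi>(1)] that by auto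
  with definable_atom[OF \<phi>(1), of "L_SK K" \<sigma>] wf_\<sigma> obtain a :: "(srt, 'k fsym, (srt, 'k fsym, rsym) esym) fm"
    where a: "wf_fm (enrich (L_SK K) (skel_lang_K K)) a" "qfree a" "fv a \<subseteq> (\<Union>x\<in>fv \<phi>. fv_tm (\<sigma> x))"
    "\<And>(M :: (srt, 'k fsym, rsym, ('k, 'v, 'g) elem) struct) e. sat (expand M) e a = sat M (\<lambda>x. tm_val M e (\<sigma> x)) \<phi>"
    by blast
  have "sat (expand M) e p \<longleftrightarrow> sat (expand M) e a"
    if M: "M \<in> (valued_spaces_over K :: (srt, 'k fsym, rsym, ('k, 'v, 'g) elem) struct set)"
      and e: "\<forall>s\<in>{VV, GG, SS}. \<forall>n. e (s, n) \<in> univ M s" for M e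
  proof -
    obtain X where XM: "valued_vector_space X" "scalars X = K" "M = vvs_struct X"
      using M by (auto simp: valued_spaces_over_def)
    interpret V: valued X by unfold_locales (rule XM(1))
    have ok: "env_ok X {VV, GG, SS} e" using e by (simp add: env_ok_def XM(3))
    have "slotted X F loc (fv p') e (\<lambda>x. tm_val M e (\<sigma> x))"
      unfolding slotted_def XM(3)
    proof (intro conjI allI impI ballI)
      show "env_ok X {SS, GG} (\<lambda>x. tm_val (vvs_struct X) e (\<sigma> x))"
        unfolding env_ok_def
      proof (intro ballI allI)
        fix s n assume "s \<in> {SS, GG}"
        then show "tm_val (vvs_struct X) e (\<sigma> (s, n)) \<in> vvs_dom X s"
          using V.L_SK_tm_in_dom[OF _ ok, unfolded XM(2), of "\<sigma> (s, n)"] wf_\<sigma>[of "(s, n)"] by simp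
      qed
      show "tm_val (vvs_struct X) e (\<sigma> (s, 2 * n)) = e (s, n)" if "(s, n) \<in> fv p'" "s \<noteq> VV" for s n
        using that by (simp add: \<sigma>_def)
      show "tm_val (vvs_struct X) e (\<sigma> (SS, Suc (2 * loc t))) = Ske (pi_skel X (un_vec (tm_val (vvs_struct X) e t)))"
        if "t \<in> F" for t
        using that loc by (simp add: \<sigma>_def)
    qed (rule ok)
    then have "sat M e p' = sat M (\<lambda>x. tm_val M e (\<sigma> x)) \<phi>"
      using \<phi>(2)[OF XM(1,2)] unfolding XM(3) by blast
    then show ?thesis unfolding p'(3) a(4) .
  qed
  then have "equivalent (enrich (L_SK K) (skel_lang_K K))
      (expand ` (valued_spaces_over K :: (srt, 'k fsym, rsym, ('k, 'v, 'g) elem) struct set)) p a"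
    unfolding equivalent_def by simp
  moreover have "fv a \<subseteq> fv p" using a(3) fv_\<sigma> p'(2) by blast
  ultimately show ?thesis using a(1,2) by blast
qed

theorem theorem1:
  fixes K :: "'k ring"
  shows "(field K \<longrightarrow>
      eliminates_quantifiers_relative_to (skel_lang_K K) (L_SK K)
        (valued_spaces_over K :: (srt, 'k fsym, rsym, ('k, 'v, 'g) elem) struct set)) \<and>
    eliminates_quantifiers_relative_to_up_to skel_lang KK L_S
      (valued_spaces :: (srt, 'k fsym, rsym, ('k, 'v, 'g) elem) struct set)"
  unfolding eliminates_quantifiers_relative_to_def eliminates_quantifiers_def
    eliminates_quantifiers_relative_to_up_to_def eliminates_quantifiers_up_to_def
  using eliminate_L_SK eliminate_L_S by blast

end
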